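(* Let $X$ be a metric space and let $U:\mathcal P(\Sigma_G^{\mathbb N})\to X$ be continuous with respect to the weak topology. Let $C\subseteq X$ be a subset of $X$. Fix a continuous function $\Phi:\Sigma_G^{\mathbb N}\to\mathbb R$ with $\Phi<0$ and let $f(C)$ be the unique real number such that $$\lim_{r\searrow0}\overline P^U_{B(C,r)}\big(f(C)\,\Phi\big)=0;$$ alternatively, $f(C)$ is the unique real number such that $$\lim_{r\searrow0}\sigma_{\mathrm{rad}}\big(\zeta^{\mathrm{dyn},U}_{B(C,r)}(f(C)\,\Phi;\cdot)\big)=1.$$ Then $$f(C)=\sup_{\mu\in\mathcal P_S(\Sigma_G^{\mathbb N}),\ U\mu\in\overline C}-\frac{h(\mu)}{\int\Phi\,d\mu}.$$
   Context: $G=(V,E)$ is a fixed finite directed multigraph (vertex set $V$, edge set $E$), assumed strongly connected. For $e\in E$, $\mathrm i(e)$ and $\mathrm t(e)$ are its initial and terminal vertices. $\Sigma_G^n$ is the set of strings $e_1\ldots e_n$ of edges with $\mathrm t(e_k)=\mathrm i(e_{k+1})$ for $1\le k<n$, and $\Sigma_G^{\mathbb N}$ is the set of infinite strings $e_1e_2\ldots$ with $\mathrm t(e_k)=\mathrm i(e_{k+1})$ for all $k\ge1$, with the product topology (discrete factors). For $\mathbf u=e_1e_2\ldots\in\Sigma_G^{\mathbb N}$, $\mathbf u|n=e_1\ldots e_n$; for $\mathbf i\in\Sigma_G^n$, the cylinder is $[\mathbf i]=\{\mathbf u\in\Sigma_G^{\mathbb N}:\mathbf u|n=\mathbf i\}$.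 $S(e_1e_2\ldots)=e_2e_3\ldots$ is the shift. $\mathcal P(\Sigma_G^{\mathbb N})$ (resp. $\mathcal P_S(\Sigma_G^{\mathbb N})$) is the set of Borel (resp. shift-invariant Borel) probability measures on $\Sigma_G^{\mathbb N}$, with the weak topology; $h(\mu)$ is the (Kolmogorov–Sinai) entropy of $\mu\in\mathcal P_S(\Sigma_G^{\mathbb N})$ with respect to $S$. $L_n:\Sigma_G^{\mathbb N}\to\mathcal P(\Sigma_G^{\mathbb N})$ is $L_n\mathbf u=\frac1n\sum_{k=0}^{n-1}\delta_{S^k\mathbf u}$, and $UL_n[\mathbf i]=\{U(L_n\mathbf u):\mathbf u\in[\mathbf i]\}$. For $D\subseteq X$ and continuous $\varphi:\Sigma_G^{\mathbb N}\to\mathbb R$ put $$Z_n(D,\varphi)=\sum_{\mathbf i\in\Sigma_G^n,\ UL_n[\mathbf i]\subseteq D}\ \sup_{\mathbf u\in[\mathbf i]}\exp\sum_{k=0}^{n-1}\varphi(S^k\mathbf u).$$ The upper multifractal pressure is $\overline P^U_D(\varphi)=\limsup_n\frac1n\log Z_n(D,\varphi)$, and the dynamical multifractal zeta-function is the power series $\zeta^{\mathrm{dyn},U}_D(\varphi;z)=\sum_n\frac{z^n}{n}Z_n(D,\varphi)$. $\sigma_{\mathrm{rad}}(f)\in[0,\infty]$ is the radius of convergence of a power series $f$. $B(C,r)=\{x\in X:\operatorname{dist}(x,C)<r\}$; $\log 0=-\infty$. *)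

theory Defs
  imports
    "HOL-Probability.Probability"
    "Graph_Theory.Graph_Theory"
begin

section \<open>The shift space of a finite directed multigraph\<close>

text \<open>
  For an arc \<open>e\<close> of a \<open>pre_digraph\<close> the initial vertex is \<open>tail G e\<close> and the terminal
  vertex is \<open>head G e\<close>. Infinite strings \<open>e\<^sub>1 e\<^sub>2 \<dots>\<close> are indexed from \<open>0\<close>.
\<close>

definition words :: "('v, 'e) pre_digraph \<Rightarrow> nat \<Rightarrow> 'e list set" where
  "words G n = {w. length w = n \<and> set w \<subseteq> arcs G \<and>
                   (\<forall>k. Suc k < n \<longrightarrow> head G (w ! k) = tail G (w ! Suc k))}"

definition paths :: "('v, 'e) pre_digraph \<Rightarrow> (nat \<Rightarrow> 'e) set" where
  "paths G = {u. (\<forall>k. u k \<in> arcs G) \<and> (\<forall>k. head G (u k) = tail G (u (Suc k)))}"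

definition cyl :: "('v, 'e) pre_digraph \<Rightarrow> 'e list \<Rightarrow> (nat \<Rightarrow> 'e) set" where
  "cyl G w = {u \<in> paths G. map u [0..<length w] = w}"

definition shift :: "(nat \<Rightarrow> 'e) \<Rightarrow> (nat \<Rightarrow> 'e)" where
  "shift u = (\<lambda>k. u (Suc k))"

definition path_topology :: "('v, 'e) pre_digraph \<Rightarrow> (nat \<Rightarrow> 'e) topology" where
  "path_topology G =
     subtopology (product_topology (\<lambda>_. discrete_topology (arcs G)) UNIV) (paths G)"

definition path_borel :: "('v, 'e) pre_digraph \<Rightarrow> (nat \<Rightarrow> 'e) measure" where
  "path_borel G = sigma (paths G) {A. openin (path_topology G) A}"


section \<open>Probability measures and the weak topology\<close>

definition prob_measures :: "('v, 'e) pre_digraph \<Rightarrow> (nat \<Rightarrow> 'e) measure set" where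
  "prob_measures G = {\<mu>. sets \<mu> = sets (path_borel G) \<and> prob_space \<mu>}"

definition invariant_measures :: "('v, 'e) pre_digraph \<Rightarrow> (nat \<Rightarrow> 'e) measure set" where
  "invariant_measures G = {\<mu> \<in> prob_measures G. distr \<mu> \<mu> shift = \<mu>}"

text \<open>
  The coarsest topology on \<open>prob_measures G\<close> making \<open>\<mu> \<mapsto> \<integral> f d\<mu>\<close> continuous for every
  continuous \<open>f\<close>. The case \<open>f = 0\<close>, \<open>W = UNIV\<close> ensures that the underlying set is all of
  \<open>prob_measures G\<close>. For finite \<open>G\<close> the space \<open>paths G\<close> is compact, so every continuous
  \<open>f\<close> is bounded.
\<close>

definition weak_topology :: "('v, 'e) pre_digraph \<Rightarrow> (nat \<Rightarrow> 'e) measure topology" where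
  "weak_topology G = topology_generated_by
     {{\<mu> \<in> prob_measures G. (\<integral>u. f u \<partial>\<mu>) \<in> W} | f W.
        continuous_map (path_topology G) euclideanreal f \<and> open (W :: real set)}"

text \<open>The empirical measure \<open>L\<^sub>n u = (1/n) (\<delta>\<^bsub>u\<^esub> + \<dots> + \<delta>\<^bsub>S\<^sup>n\<^sup>-\<^sup>1u\<^esub>)\<close>, used for \<open>n \<ge> 1\<close> only.\<close>

definition empirical :: "('v, 'e) pre_digraph \<Rightarrow> nat \<Rightarrow> (nat \<Rightarrow> 'e) \<Rightarrow> (nat \<Rightarrow> 'e) measure" where
  "empirical G n u = measure_of (space (path_borel G)) (sets (path_borel G))
     (\<lambda>A. (\<Sum>k<n. emeasure (return (path_borel G) ((shift ^^ k) u)) A) / of_nat n)"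


section \<open>Kolmogorov--Sinai entropy\<close>

text \<open>With \<open>0 * ln 0 = 0\<close>; empty cells contribute nothing.\<close>

definition partition_entropy :: "'a measure \<Rightarrow> 'a set set \<Rightarrow> real" where
  "partition_entropy \<mu> P = - (\<Sum>A\<in>P. measure \<mu> A * ln (measure \<mu> A))"

text \<open>
  \<open>refinement M T P n\<close> is the join of \<open>T\<^sup>-\<^sup>k P\<close> for \<open>k < n\<close>, possibly with the empty set as an
  additional cell.
\<close>

primrec refinement :: "'a set \<Rightarrow> ('a \<Rightarrow> 'a) \<Rightarrow> 'a set set \<Rightarrow> nat \<Rightarrow> 'a set set" where
  "refinement M T P 0 = {M}"
| "refinement M T P (Suc n) =
     {A \<inter> ((T ^^ n) -` B \<inter> M) | A B. A \<in> refinement M T P n \<and> B \<in> P}"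

definition ks_entropy :: "'a measure \<Rightarrow> ('a \<Rightarrow> 'a) \<Rightarrow> ereal" where
  "ks_entropy \<mu> T =
     (SUP P \<in> {P. finite P \<and> P \<subseteq> sets \<mu> \<and> partition_on (space \<mu>) P}.
        ereal (lim (\<lambda>n. partition_entropy \<mu> (refinement (space \<mu>) T P n) / real n)))"


section \<open>Multifractal pressure and zeta-function\<close>

definition multifractal_sum ::
  "('v, 'e) pre_digraph \<Rightarrow> ((nat \<Rightarrow> 'e) measure \<Rightarrow> 'x) \<Rightarrow> 'x set \<Rightarrow>
     ((nat \<Rightarrow> 'e) \<Rightarrow> real) \<Rightarrow> nat \<Rightarrow> real" where
  "multifractal_sum G U D \<phi> n =
     (\<Sum>w \<in> {w \<in> words G n. (\<lambda>u. U (empirical G n u)) ` cyl G w \<subseteq> D}.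
        SUP u \<in> cyl G w. exp (\<Sum>k<n. \<phi> ((shift ^^ k) u)))"

definition log_ereal :: "real \<Rightarrow> ereal" where
  "log_ereal x = (if x = 0 then -\<infinity> else ereal (ln x))"

definition upper_pressure ::
  "('v, 'e) pre_digraph \<Rightarrow> ((nat \<Rightarrow> 'e) measure \<Rightarrow> 'x) \<Rightarrow> 'x set \<Rightarrow>
     ((nat \<Rightarrow> 'e) \<Rightarrow> real) \<Rightarrow> ereal" where
  "upper_pressure G U D \<phi> =
     limsup (\<lambda>n. ereal (1 / real n) * log_ereal (multifractal_sum G U D \<phi> n))"

text \<open>The series starts at \<open>n = 1\<close>: the constant coefficient is \<open>0\<close> because \<open>x / 0 = 0\<close>.\<close>

definition zeta_dyn ::
  "('v, 'e) pre_digraph \<Rightarrow> ((nat \<Rightarrow> 'e) measure \<Rightarrow> 'x) \<Rightarrow> 'x set \<Rightarrow>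
     ((nat \<Rightarrow> 'e) \<Rightarrow> real) \<Rightarrow> complex fps" where
  "zeta_dyn G U D \<phi> = Abs_fps (\<lambda>n. complex_of_real (multifractal_sum G U D \<phi> n / real n))"

text \<open>
  \<open>B(C,r)\<close>. The distance to the empty set is \<open>\<infinity>\<close>, so \<open>B({},r)\<close> is empty, whereas
  \<open>infdist x {} = 0\<close> by convention.
\<close>

definition set_ball :: "'x::metric_space set \<Rightarrow> real \<Rightarrow> 'x set" where
  "set_ball C r = {x. C \<noteq> {} \<and> infdist x C < r}"

text \<open>The two defining properties of the number \<open>f(C)\<close>.\<close>

definition pressure_zero ::
  "('v, 'e) pre_digraph \<Rightarrow> ((nat \<Rightarrow> 'e) measure \<Rightarrow> 'x::metric_space) \<Rightarrow> 'x set \<Rightarrow>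
     ((nat \<Rightarrow> 'e) \<Rightarrow> real) \<Rightarrow> real \<Rightarrow> bool" where
  "pressure_zero G U C \<Phi> t \<longleftrightarrow>
     ((\<lambda>r. upper_pressure G U (set_ball C r) (\<lambda>u. t * \<Phi> u)) \<longlongrightarrow> 0) (at_right 0)"

definition zeta_radius_one ::
  "('v, 'e) pre_digraph \<Rightarrow> ((nat \<Rightarrow> 'e) measure \<Rightarrow> 'x::metric_space) \<Rightarrow> 'x set \<Rightarrow>
     ((nat \<Rightarrow> 'e) \<Rightarrow> real) \<Rightarrow> real \<Rightarrow> bool" where
  "zeta_radius_one G U C \<Phi> t \<longleftrightarrow>
     ((\<lambda>r. fps_conv_radius (zeta_dyn G U (set_ball C r) (\<lambda>u. t * \<Phi> u))) \<longlongrightarrow> 1) (at_right 0)"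

end

(*
  The number P(t) = lim_{r -> 0} P_{B(C,r)}(t Phi) equals the supremum of h(mu) + t int Phi dmu over the
  invariant mu with U mu in the closure of C. Since int Phi dmu is bounded away from 0 and from - infinity,
  P vanishes exactly at t = sup - h(mu) / int Phi dmu, and the radius of convergence tends to exp (- P(t)).

  Upper bound: by compactness, the words whose empirical measures lie near one suitable measure N already
  carry the full exponential growth; N is invariant, U N lies in the closure of C, and words with block
  frequencies close to those of N are counted by their weights under the q-step Markov chains of N.
  Lower bound: for an invariant, possibly non-ergodic mu, blocks of length k are repeated according to
  their mu-frequencies, closed up to loops at a fixed vertex and concatenated in all orders. The resulting
  words all have the same length, their empirical measures are close to mu, and Stirling's bounds give
  exp (n (h(mu) - o(1))) of them. No ergodic theorem is needed.
*)

theory Submission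
  imports
    Defs
    "HOL-Real_Asymp.Real_Asymp"
    "HOL-Combinatorics.Multiset_Permutations"
begin

section \<open>Paths, prefixes and compactness\<close>

text \<open>The upper bound is shaped by the need to compare all words of one length with a single
  measure. Compactness is therefore taken in the cube of block frequencies, a power of
  \<open>{0..1}\<close> indexed by all words; a point of it where the growth concentrates fixes
  every cylinder probability of N, and Caratheodory's theorem turns these numbers into a measure.
  Counting with the q-step chains bounds the growth only by
  \<open>word_entropy N (Suc q) - word_entropy N q\<close> plus the integral, one estimate per q;
  adding them up over q telescopes to a lower bound for \<open>word_entropy N q\<close>, hence for
  the entropy rate. In the lower bound the obstacle is that a word counts only if all points of its
  cylinder have empirical measures in the right place; this is why distortion estimates and
  indicators of cylinders, treated as continuous observables, are carried along. The entropy in the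
  statement is a supremum over all finite measurable partitions, so the one-letter partition has to
  be shown to generate. Both descriptions of f(C) are read off from the same two-sided growth bounds
  for the sums Z_n.\<close>

definition initial :: "nat \<Rightarrow> (nat \<Rightarrow> 'e) \<Rightarrow> 'e list" where
  "initial k u = map u [0..<k]"

lemma length_initial [simp]: "length (initial k u) = k"
  by (simp add: initial_def)

lemma nth_initial [simp]: "i < k \<Longrightarrow> initial k u ! i = u i"
  by (simp add: initial_def)

lemma initial_eq_iff: "initial k u = initial k v \<longleftrightarrow> (\<forall>i<k. u i = v i)"
  by (auto simp: initial_def)

lemma initial_mono: "initial k u = initial k v \<Longrightarrow> j \<le> k \<Longrightarrow> initial j u = initial j v"
  by (simp add: initial_eq_iff)

lemma take_initial: "j \<le> k \<Longrightarrow> take j (initial k u) = initial j u"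
  by (intro nth_equalityI) auto

lemma shift_power_apply: "(shift ^^ k) u i = u (k + i)"
  by (induction k arbitrary: i) (auto simp: shift_def)

lemma shift_power: "(shift ^^ k) u = (\<lambda>i. u (k + i))"
  by (simp add: fun_eq_iff shift_power_apply)

lemma initial_add: "initial (j + k) u = initial j u @ initial k ((shift ^^ j) u)"
  by (intro nth_equalityI) (auto simp: nth_append shift_power_apply)

lemma paths_shift: "u \<in> paths G \<Longrightarrow> shift u \<in> paths G"
  by (auto simp: paths_def shift_def)

lemma paths_shift_power: "u \<in> paths G \<Longrightarrow> (shift ^^ k) u \<in> paths G"
  by (induction k) (auto simp: paths_shift)

lemma initial_in_words: "u \<in> paths G \<Longrightarrow> initial k u \<in> words G k"
  by (auto simp: words_def paths_def initial_def)

lemma cyl_eq: "length w = k \<Longrightarrow> cyl G w = {u \<in> paths G. initial k u = w}"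
  by (auto simp: cyl_def initial_def)

lemma cyl_initial: "cyl G (initial k u) = {v \<in> paths G. initial k v = initial k u}"
  by (simp add: cyl_eq)

lemma length_words: "w \<in> words G k \<Longrightarrow> length w = k"
  by (simp add: words_def)

lemma cyl_word: "w \<in> words G k \<Longrightarrow> cyl G w = {u \<in> paths G. initial k u = w}"
  by (simp add: cyl_eq length_words)

section \<open>Words as walks in the graph\<close>

lemma words_appendD:
  assumes "v @ w \<in> words G n"
  shows "v \<in> words G (length v)" "w \<in> words G (length w)"
proof -
  have n: "n = length v + length w" and s: "set v \<subseteq> arcs G" "set w \<subseteq> arcs G"
    and c: "\<And>k. Suc k < n \<Longrightarrow> head G ((v @ w) ! k) = tail G ((v @ w) ! Suc k)"
    using assms by (auto simp: words_def)
  have "head G (v ! k) = tail G (v ! Suc k)" if "Suc k < length v" for k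
    using c[of k] that n by (simp add: nth_append)
  moreover have "head G (w ! k) = tail G (w ! Suc k)" if "Suc k < length w" for k
    using c[of "length v + k"] that n
    by (metis add_Suc_right nat_add_left_cancel_less nth_append_length_plus)
  ultimately show "v \<in> words G (length v)" "w \<in> words G (length w)"
    using s by (auto simp: words_def)
qed

lemma (in wf_digraph) cas_imp_chain:
  "cas u w v \<Longrightarrow> Suc k < length w \<Longrightarrow> head G (w ! k) = tail G (w ! Suc k)"
proof (induction w arbitrary: u k)
  case (Cons a w)
  then show ?case
    by (cases k; cases w) auto
qed simp

lemma (in wf_digraph) awalk_in_words: "awalk u w v \<Longrightarrow> w \<in> words G (length w)"
  by (auto simp: words_def awalk_def cas_imp_chain)

text \<open>Together with \<open>awalk_in_words\<close> this allows words to be joined by connecting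
  walks, which is how blocks are later closed up to loops.\<close>

lemma (in wf_digraph) words_imp_awalk:
  assumes "w \<in> words G n" "n > 0"
  shows "awalk (tail G (hd w)) w (head G (last w))"
  using assms
proof (induction w arbitrary: n)
  case (Cons a w)
  show ?case
  proof (cases w)
    case Nil
    then show ?thesis using Cons.prems by (auto simp: words_def awalk_def)
  next
    case (Cons b w')
    have "[a] @ w \<in> words G n" using Cons.prems by simp
    then have "w \<in> words G (length w)" by (rule words_appendD)
    then have "awalk (tail G (hd w)) w (head G (last w))"
      using Cons by (intro Cons.IH[of "length w"]) auto
    moreover have "head G a = tail G b" "a \<in> arcs G"
      using Cons.prems Cons by (force simp: words_def)+
    ultimately show ?thesis using Cons
      by (auto simp: awalk_Cons_iff)
  qed
qed (auto simp: words_def)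

lemma finite_words:
  assumes "finite (arcs G)" shows "finite (words G n)"
  by (rule finite_subset[OF _ finite_lists_length_eq[OF assms, of n]]) (auto simp: words_def)

text \<open>A single vertex without arcs is strongly connected as well, but carries no infinite
  strings; that case is kept out of the locale and treated separately in the final theorem.\<close>

locale graph_shift = fin_digraph G for G :: "('v, 'e) pre_digraph" +
  assumes strongly_connected: "strongly_connected G"
    and arcs_nonempty: "arcs G \<noteq> {}"
begin

section \<open>Existence of infinite strings\<close>

lemma awalk_exists:
  assumes "x \<in> verts G" "y \<in> verts G"
  shows "\<exists>p. awalk x p y"
  using strongly_connected assms by (auto simp: strongly_connected_def reachable_awalk)

text \<open>A walk from \<open>x\<close> to the tail of some arc \<open>e\<close>, extended by
  \<open>e\<close>, is nonempty even if \<open>x\<close> is that tail; its first arc leaves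
  \<open>x\<close>.\<close>

lemma out_arc_exists:
  assumes "x \<in> verts G" shows "\<exists>a\<in>arcs G. tail G a = x"
proof -
  obtain e where e: "e \<in> arcs G" using arcs_nonempty by auto
  obtain p where p: "awalk x p (tail G e)" using awalk_exists assms e by force
  then have "awalk x (p @ [e]) (head G e)" using e by (auto simp: awalk_append_iff awalk_Cons_iff awalk_Nil_iff)
  then show ?thesis by (cases p) (auto simp: awalk_Cons_iff)
qed

lemma path_from_exists:
  assumes "x \<in> verts G" shows "\<exists>u\<in>paths G. tail G (u 0) = x"
proof -
  define nxt where "nxt y = (SOME a. a \<in> arcs G \<and> tail G a = y)" for y
  have nxt: "nxt y \<in> arcs G \<and> tail G (nxt y) = y" if "y \<in> verts G" for y
    unfolding nxt_def by (rule someI_ex) (use out_arc_exists[OF that] in auto)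
  define s where "s = rec_nat (nxt x) (\<lambda>_ a. nxt (head G a))"
  have s: "s 0 = nxt x" "s (Suc k) = nxt (head G (s k))" for k
    by (simp_all add: s_def)
  have a: "s k \<in> arcs G" for k
  proof (induction k)
    case 0 then show ?case using nxt[OF assms] by (simp only: s)
  next
    case (Suc k) then show ?case using nxt[OF head_in_verts[OF Suc]] by (simp only: s)
  qed
  have "head G (s k) = tail G (s (Suc k))" for k
    using nxt[OF head_in_verts[OF a[of k]]] by (simp only: s)
  then have "s \<in> paths G" using a by (simp add: paths_def)
  then show ?thesis using nxt[OF assms] s(1) by (intro bexI[of _ s]) simp_all
qed

lemma paths_nonempty: "paths G \<noteq> {}"
  using path_from_exists strongly_connected by (force simp: strongly_connected_def)

text \<open>An infinite path leaves the head of the last letter and continues the word. Suprema over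
  cylinders are therefore over nonempty sets, and cylinders can serve as cells of a
  partition.\<close>

lemma cyl_nonempty:
  assumes "w \<in> words G n" shows "cyl G w \<noteq> {}"
proof (cases "n = 0")
  case True
  then show ?thesis using assms paths_nonempty by (auto simp: words_def cyl_def)
next
  case False
  have len: "length w = n" and sw: "set w \<subseteq> arcs G"
    and ch: "\<And>k. Suc k < n \<Longrightarrow> head G (w ! k) = tail G (w ! Suc k)"
    using assms by (auto simp: words_def)
  have "last w \<in> arcs G" using sw len False by (metis last_in_set length_0_conv subsetD)
  then obtain s where s: "s \<in> paths G" "tail G (s 0) = head G (last w)"
    using path_from_exists by force
  define u where "u i = (if i < n then w ! i else s (i - n))" for i
  have "u k \<in> arcs G" for k
    using s sw len nth_mem[of k w] by (auto simp: u_def paths_def)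
  moreover have "head G (u k) = tail G (u (Suc k))" for k
  proof -
    consider "Suc k < n" | "Suc k = n" | "n \<le> k" by linarith
    then show ?thesis
    proof cases
      case 2
      then have "w ! k = last w" using len False last_conv_nth[of w] by (cases w) auto
      then show ?thesis using 2 s by (auto simp: u_def)
    next
      case 3
      then have "Suc k - n = Suc (k - n)" by simp
      then show ?thesis using 3 s by (auto simp: u_def paths_def)
    qed (use ch in \<open>auto simp: u_def\<close>)
  qed
  ultimately have "u \<in> paths G" by (auto simp: paths_def)
  moreover have "initial n u = w" by (intro nth_equalityI) (auto simp: len u_def)
  ultimately show ?thesis using cyl_eq[OF len] by blast
qed

lemmas finite_words' [simp] = finite_words[OF finite_arcs]

section \<open>The topology of the path space in terms of prefixes\<close>

lemma topspace_path_topology [simp]: "topspace (path_topology G) = paths G"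
  by (auto simp: path_topology_def paths_def PiE_def Pi_def)

text \<open>A basic open set of the product restricts finitely many coordinates, all below some
  \<open>k\<close>; conversely, fixing the first \<open>k\<close> coordinates is a basic open
  condition. After this, topology is argued through prefixes.\<close>

lemma openin_path_topology_iff:
  "openin (path_topology G) A \<longleftrightarrow>
     A \<subseteq> paths G \<and> (\<forall>u\<in>A. \<exists>k. \<forall>v\<in>paths G. initial k v = initial k u \<longrightarrow> v \<in> A)"
  (is "_ \<longleftrightarrow> ?R")
proof
  assume "openin (path_topology G) A"
  then obtain T where T: "openin (product_topology (\<lambda>_. discrete_topology (arcs G)) (UNIV::nat set)) T"
    and A: "A = T \<inter> paths G"
    by (auto simp: path_topology_def openin_subtopology)
  have "\<exists>k. \<forall>v\<in>paths G. initial k v = initial k u \<longrightarrow> v \<in> A" if "u \<in> A" for u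
  proof -
    from T A that obtain W where W: "finite {i. W i \<noteq> arcs G}" "u \<in> Pi\<^sub>E UNIV W" "Pi\<^sub>E UNIV W \<subseteq> T"
      by (force simp: openin_product_topology_alt)
    obtain k where k: "\<And>i. W i \<noteq> arcs G \<Longrightarrow> i < k"
      using W(1) by (auto simp: finite_nat_set_iff_bounded)
    have "v \<in> A" if "v \<in> paths G" "initial k v = initial k u" for v
    proof -
      have "v i \<in> W i" for i
      proof (cases "i < k")
        case True
        then show ?thesis using that W(2) by (auto simp: initial_eq_iff PiE_def Pi_def)
      next
        case False
        then have "W i = arcs G" using k by blast
        then show ?thesis using that by (auto simp: paths_def)
      qed
      then show ?thesis using W(3) A that by (auto simp: PiE_def Pi_def)
    qed
    then show ?thesis by blast
  qed
  then show ?R using A by auto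
next
  assume R: ?R
  show "openin (path_topology G) A"
  proof (subst openin_subopen, intro ballI)
    fix u assume u: "u \<in> A"
    with R obtain k where k: "\<And>v. v \<in> paths G \<Longrightarrow> initial k v = initial k u \<Longrightarrow> v \<in> A" by blast
    define T where "T = Pi\<^sub>E UNIV (\<lambda>i. if i < k then {u i} else arcs G)"
    have up: "u \<in> paths G" using R u by auto
    have "openin (product_topology (\<lambda>_. discrete_topology (arcs G)) (UNIV::nat set)) T"
      unfolding T_def
    proof (intro product_topology_basis)
      show "openin (discrete_topology (arcs G)) (if i < k then {u i} else arcs G)" for i
        using up by (auto simp: paths_def)
      show "finite {i. (if i < k then {u i} else arcs G) \<noteq> topspace (discrete_topology (arcs G))}"
        by (rule finite_subset[of _ "{..<k}"]) (auto split: if_splits)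
    qed
    then have "openin (path_topology G) (T \<inter> paths G)"
      by (auto simp: path_topology_def openin_subtopology)
    moreover have "u \<in> T \<inter> paths G" using up by (auto simp: T_def paths_def)
    moreover have "v \<in> A" if v: "v \<in> T" "v \<in> paths G" for v
    proof -
      have "v i = u i" if "i < k" for i
        using v that unfolding T_def by (auto simp: PiE_def Pi_def split: if_splits)
      then show ?thesis using k[of v] v by (auto simp: initial_eq_iff)
    qed
    ultimately show "\<exists>T. openin (path_topology G) T \<and> u \<in> T \<and> T \<subseteq> A" by blast
  qed
qed

text \<open>Admissibility is a condition on each pair of neighbouring coordinates, and every set of
  pairs of arcs is closed in the discrete topology; \<open>paths G\<close> is the intersection of
  the preimages.\<close>

lemma closedin_paths:
  "closedin (product_topology (\<lambda>_. discrete_topology (arcs G)) (UNIV::nat set)) (paths G)"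
proof -
  let ?P = "product_topology (\<lambda>_. discrete_topology (arcs G)) (UNIV::nat set)"
  have proj: "continuous_map ?P (discrete_topology (arcs G)) (\<lambda>u. u k)" for k
    by (rule continuous_map_product_projection) auto
  have "closedin ?P {u \<in> topspace ?P. (u k, u (Suc k)) \<in> {(a, b). a \<in> arcs G \<and> b \<in> arcs G \<and> head G a = tail G b}}"
    (is "closedin ?P (?C k)") for k
  proof (rule closedin_continuous_map_preimage)
    show "continuous_map ?P (discrete_topology (arcs G \<times> arcs G)) (\<lambda>u. (u k, u (Suc k)))"
      unfolding prod_topology_discrete_topology
      by (intro continuous_map_pairedI proj)
  qed auto
  then have "closedin ?P (\<Inter>k. ?C k)" by (intro closedin_Inter) auto
  also have "(\<Inter>k. ?C k) = paths G"
    by (auto simp: paths_def PiE_def Pi_def)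
  finally show ?thesis .
qed

lemma compact_space_path_topology: "compact_space (path_topology G)"
proof -
  have "compact_space (product_topology (\<lambda>_. discrete_topology (arcs G)) (UNIV::nat set))"
    by (simp add: compact_space_product_topology compact_space_discrete_topology)
  then have "compactin (product_topology (\<lambda>_. discrete_topology (arcs G)) (UNIV::nat set)) (paths G)"
    using closedin_paths closedin_compact_space by blast
  then show ?thesis
    unfolding path_topology_def by (rule compact_space_subtopology)
qed

text \<open>Compactness phrased for prefixes: the sets of points sharing \<open>k u\<close> letters
  with \<open>u\<close> form an open cover, and \<open>F\<close> collects the centres of a finite
  subcover.\<close>

lemma initial_cover_finite:
  fixes k :: "(nat \<Rightarrow> 'e) \<Rightarrow> nat"
  obtains F where "finite F" "F \<subseteq> paths G"
    "\<And>v. v \<in> paths G \<Longrightarrow> \<exists>u\<in>F. initial (k u) v = initial (k u) u"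
proof -
  define A where "A u = {v \<in> paths G. initial (k u) v = initial (k u) u}" for u
  have "openin (path_topology G) (A u)" for u
    unfolding openin_path_topology_iff A_def by (auto intro!: exI[of _ "k u"])
  moreover have "paths G \<subseteq> \<Union> (A ` paths G)" by (auto simp: A_def)
  ultimately obtain \<F> where "finite \<F>" "\<F> \<subseteq> A ` paths G" "paths G \<subseteq> \<Union> \<F>"
    using compact_space_path_topology unfolding compact_space_def compactin_def
    by (metis (no_types, lifting) imageE topspace_path_topology)
  then obtain F where "finite F" "F \<subseteq> paths G" "paths G \<subseteq> \<Union> (A ` F)"
    by (metis finite_subset_image)
  then show ?thesis by (intro that[of F]) (auto simp: A_def)
qed

text \<open>Heine-Cantor with agreement of prefixes in place of a metric. The longest prefix length
  in a finite cover serves all points; \<open>u\<close> and \<open>v\<close> are both compared with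
  a common centre, whence \<open>e/2\<close>.\<close>

lemma uniformly_continuous_initial:
  assumes g: "continuous_map (path_topology G) euclideanreal g" and e: "e > 0"
  shows "\<exists>k. \<forall>u\<in>paths G. \<forall>v\<in>paths G. initial k u = initial k v \<longrightarrow> \<bar>g u - g v\<bar> < e"
proof -
  have "\<exists>k. \<forall>v\<in>paths G. initial k v = initial k u \<longrightarrow> \<bar>g v - g u\<bar> < e/2" if u: "u \<in> paths G" for u
  proof -
    have "openin (path_topology G) {v \<in> topspace (path_topology G). g v \<in> {g u - e/2<..<g u + e/2}}"
      by (rule openin_continuous_map_preimage[OF g]) auto
    moreover have "u \<in> {v \<in> topspace (path_topology G). g v \<in> {g u - e/2<..<g u + e/2}}"
      using u e by auto
    ultimately obtain k where k: "\<forall>v\<in>paths G. initial k v = initial k u \<longrightarrow>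
        v \<in> {v \<in> topspace (path_topology G). g v \<in> {g u - e/2<..<g u + e/2}}"
      unfolding openin_path_topology_iff by meson
    have "\<bar>g v - g u\<bar> < e/2" if "v \<in> paths G" "initial k v = initial k u" for v
    proof -
      have "g u - e/2 < g v" "g v < g u + e/2" using k that by auto
      then show ?thesis by linarith
    qed
    then show ?thesis by blast
  qed
  then obtain k where k: "\<And>u v. u \<in> paths G \<Longrightarrow> v \<in> paths G \<Longrightarrow> initial (k u) v = initial (k u) u \<Longrightarrow> \<bar>g v - g u\<bar> < e/2"
    by metis
  obtain F where F: "finite F" "F \<subseteq> paths G"
    "\<And>v. v \<in> paths G \<Longrightarrow> \<exists>u\<in>F. initial (k u) v = initial (k u) u"
    by (rule initial_cover_finite[of k]) auto
  define K where "K = Max (k ` F)"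
  have "\<bar>g u - g v\<bar> < e" if uv: "u \<in> paths G" "v \<in> paths G" "initial K u = initial K v" for u v
  proof -
    obtain x where x: "x \<in> F" "initial (k x) u = initial (k x) x" using F(3) uv by blast
    have "k x \<le> K" unfolding K_def using F(1) x by auto
    then have "initial (k x) v = initial (k x) x" using uv(3) x(2) initial_mono by metis
    then have "\<bar>g u - g x\<bar> < e/2" "\<bar>g v - g x\<bar> < e/2" using k x F(2) uv by auto
    then show ?thesis by linarith
  qed
  then show ?thesis by blast
qed

lemma bounded_continuous_map:
  assumes "continuous_map (path_topology G) euclideanreal g"
  obtains B where "B > 0" "\<And>u. u \<in> paths G \<Longrightarrow> \<bar>g u\<bar> \<le> B"
proof -
  have "compactin euclideanreal (g ` paths G)"
    using image_compactin[OF _ assms] compact_space_path_topology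
    by (metis compact_space_def topspace_path_topology)
  then have "bounded (g ` paths G)" by (simp add: compact_imp_bounded)
  then obtain B where "B > 0" "\<And>x. x \<in> g ` paths G \<Longrightarrow> norm x \<le> B"
    by (auto simp: bounded_pos)
  then show ?thesis by (intro that[of B]) auto
qed

end

section \<open>Measures on the path space\<close>

lemma sets_prob_measures: "M \<in> prob_measures G \<Longrightarrow> sets M = sets (path_borel G)"
  by (simp add: prob_measures_def)

lemma prob_space_prob_measures: "M \<in> prob_measures G \<Longrightarrow> prob_space M"
  by (simp add: prob_measures_def)

lemma invariant_imp_prob: "M \<in> invariant_measures G \<Longrightarrow> M \<in> prob_measures G"
  by (simp add: invariant_measures_def)

section \<open>The algebra of sets decided by a prefix, and the Borel sets\<close>

context graph_shift
begin

text \<open>The length \<open>k\<close> is uniform over \<open>A\<close>, unlike in the description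
  of open sets; this makes the family stable under complements and turns each member into a finite
  disjoint union of cylinders.\<close>

definition cylsets :: "(nat \<Rightarrow> 'e) set set" where
  "cylsets = {A. A \<subseteq> paths G \<and>
     (\<exists>k. \<forall>u\<in>A. \<forall>v\<in>paths G. initial k v = initial k u \<longrightarrow> v \<in> A)}"

lemma cylsetsI:
  assumes "A \<subseteq> paths G"
    "\<And>u v. u \<in> A \<Longrightarrow> v \<in> paths G \<Longrightarrow> initial k v = initial k u \<Longrightarrow> v \<in> A"
  shows "A \<in> cylsets"
  unfolding cylsets_def using assms by blast

lemma cyl_in_cylsets: "cyl G w \<in> cylsets"
  by (rule cylsetsI[of _ "length w"]) (auto simp: cyl_eq)

lemma algebra_cylsets: "algebra (paths G) cylsets"
  unfolding algebra_iff_Un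
proof (intro conjI ballI)
  show "cylsets \<subseteq> Pow (paths G)" by (auto simp: cylsets_def)
  show "{} \<in> cylsets" by (auto simp: cylsets_def)
next
  fix A assume "A \<in> cylsets"
  then obtain k where A: "A \<subseteq> paths G"
    "\<And>u v. u \<in> A \<Longrightarrow> v \<in> paths G \<Longrightarrow> initial k v = initial k u \<Longrightarrow> v \<in> A" unfolding cylsets_def by blast
  show "paths G - A \<in> cylsets"
    proof (rule cylsetsI[of _ k])
    fix u v assume "u \<in> paths G - A" "v \<in> paths G" "initial k v = initial k u"
    then show "v \<in> paths G - A" using A(2)[of v u] by auto
  qed auto
next
  fix A B assume "A \<in> cylsets" "B \<in> cylsets"
  then obtain k l where A: "A \<subseteq> paths G"
    "\<And>u v. u \<in> A \<Longrightarrow> v \<in> paths G \<Longrightarrow> initial k v = initial k u \<Longrightarrow> v \<in> A"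
    and B: "B \<subseteq> paths G"
    "\<And>u v. u \<in> B \<Longrightarrow> v \<in> paths G \<Longrightarrow> initial l v = initial l u \<Longrightarrow> v \<in> B"
    unfolding cylsets_def by blast
  show "A \<union> B \<in> cylsets"
  proof (rule cylsetsI[of _ "max k l"])
    fix u v assume u: "u \<in> A \<union> B" and v: "v \<in> paths G" "initial (max k l) v = initial (max k l) u"
    then have "initial k v = initial k u" "initial l v = initial l u"
      by (auto intro: initial_mono)
    then show "v \<in> A \<union> B" using A(2) B(2) u v(1) by blast
  qed (use A B in auto)
qed

lemma cylsets_openin: "A \<in> cylsets \<Longrightarrow> openin (path_topology G) A"
  unfolding openin_path_topology_iff cylsets_def by blast

lemma space_path_borel [simp]: "space (path_borel G) = paths G"
  unfolding path_borel_def by (rule space_measure_of) (use openin_subset in fastforce)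

lemma sets_path_borel_open: "sets (path_borel G) = sigma_sets (paths G) {A. openin (path_topology G) A}"
  unfolding path_borel_def by (rule sets_measure_of) (use openin_subset in fastforce)

lemma open_eq_Union_cyl:
  assumes "openin (path_topology G) A"
  shows "A = (\<Union>w\<in>{w. (\<exists>k. w \<in> words G k) \<and> cyl G w \<subseteq> A}. cyl G w)"
proof (intro subset_antisym subsetI)
  fix u assume u: "u \<in> A"
  then obtain k where k: "\<forall>v\<in>paths G. initial k v = initial k u \<longrightarrow> v \<in> A" and up: "u \<in> paths G"
    using assms unfolding openin_path_topology_iff by blast
  then have "initial k u \<in> words G k" "cyl G (initial k u) \<subseteq> A" "u \<in> cyl G (initial k u)"
    by (auto simp: cyl_initial initial_in_words)
  then show "u \<in> (\<Union>w\<in>{w. (\<exists>k. w \<in> words G k) \<and> cyl G w \<subseteq> A}. cyl G w)" by blast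
qed auto

lemma countable_all_words: "countable {w. \<exists>k. w \<in> words G k}"
proof -
  have "{w. \<exists>k. w \<in> words G k} = (\<Union>k. words G k)" by auto
  then show ?thesis by (simp add: countable_finite)
qed

text \<open>Every open set is a union of cylinders, and there are only countably many cylinders; so
  the open sets and the prefix-determined sets generate the same sigma-algebra.\<close>

lemma sets_path_borel: "sets (path_borel G) = sigma_sets (paths G) cylsets"
  unfolding sets_path_borel_open
proof (rule sigma_sets_eqI)
  fix A assume "A \<in> {A. openin (path_topology G) A}"
  then have A: "A = (\<Union>w\<in>{w. (\<exists>k. w \<in> words G k) \<and> cyl G w \<subseteq> A}. cyl G w)"
    using open_eq_Union_cyl by simp
  have "countable {w. (\<exists>k. w \<in> words G k) \<and> cyl G w \<subseteq> A}"
    by (rule countable_subset[OF _ countable_all_words]) auto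
  then have "(\<Union>w\<in>{w. (\<exists>k. w \<in> words G k) \<and> cyl G w \<subseteq> A}. cyl G w) \<in> sigma_sets (paths G) cylsets"
    by (intro sigma_sets_UNION) (auto intro!: sigma_sets.Basic cyl_in_cylsets)
  then show "A \<in> sigma_sets (paths G) cylsets" using A by simp
next
  fix A assume "A \<in> cylsets"
  then show "A \<in> sigma_sets (paths G) {A. openin (path_topology G) A}"
    by (intro sigma_sets.Basic) (simp add: cylsets_openin)
qed

lemma cylsets_sets: "A \<in> cylsets \<Longrightarrow> A \<in> sets (path_borel G)"
  unfolding sets_path_borel by (rule sigma_sets.Basic)

lemma cyl_sets [measurable, simp]: "cyl G w \<in> sets (path_borel G)"
  by (intro cylsets_sets cyl_in_cylsets)

lemma space_prob_measures: "M \<in> prob_measures G \<Longrightarrow> space M = paths G"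
  using sets_eq_imp_space_eq[OF sets_prob_measures[of M G]] by simp

lemma shift_vimage_cylsets:
  assumes "A \<in> cylsets" shows "shift -` A \<inter> paths G \<in> cylsets"
proof -
  obtain k where A: "A \<subseteq> paths G"
    "\<And>u v. u \<in> A \<Longrightarrow> v \<in> paths G \<Longrightarrow> initial k v = initial k u \<Longrightarrow> v \<in> A"
    using assms unfolding cylsets_def by blast
  show ?thesis
  proof (rule cylsetsI[of _ "Suc k"])
    fix u v assume *: "u \<in> shift -` A \<inter> paths G" "v \<in> paths G" "initial (Suc k) v = initial (Suc k) u"
    then have "initial k (shift v) = initial k (shift u)" by (auto simp: initial_eq_iff shift_def)
    then show "v \<in> shift -` A \<inter> paths G" using A(2)[of "shift u" "shift v"] * paths_shift by auto
  qed auto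
qed

lemma measurable_shift: "shift \<in> measurable (path_borel G) (path_borel G)"
proof (rule measurable_sigma_sets[OF sets_path_borel])
  show "cylsets \<subseteq> Pow (paths G)" by (auto simp: cylsets_def)
  show "shift \<in> space (path_borel G) \<rightarrow> paths G" using paths_shift by auto
  show "\<And>y. y \<in> cylsets \<Longrightarrow> shift -` y \<inter> space (path_borel G) \<in> sets (path_borel G)"
    using shift_vimage_cylsets cylsets_sets by simp
qed

section \<open>Integrals of continuous functions and empirical measures\<close>

lemma continuous_measurable:
  assumes "continuous_map (path_topology G) euclideanreal g"
  shows "g \<in> borel_measurable (path_borel G)"
proof (rule borel_measurableI)
  fix S :: "real set" assume "open S"
  then have "openin (path_topology G) {u \<in> topspace (path_topology G). g u \<in> S}"
    by (intro openin_continuous_map_preimage[OF assms]) auto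
  moreover have "{u \<in> topspace (path_topology G). g u \<in> S} = g -` S \<inter> space (path_borel G)" by auto
  ultimately show "g -` S \<inter> space (path_borel G) \<in> sets (path_borel G)"
    unfolding sets_path_borel_open by (auto intro: sigma_sets.Basic)
qed

lemma integrable_continuous:
  assumes g: "continuous_map (path_topology G) euclideanreal g" and "M \<in> prob_measures G"
  shows "integrable M g"
proof -
  interpret prob_space M using assms(2) by (rule prob_space_prob_measures)
  obtain B where "B > 0" "\<And>u. u \<in> paths G \<Longrightarrow> \<bar>g u\<bar> \<le> B" using bounded_continuous_map[OF g] by blast
  then show ?thesis
    using continuous_measurable[OF g] measurable_cong_sets[OF sets_prob_measures[OF assms(2)] refl, of borel]
    by (intro integrable_const_bound[of _ B]) (auto simp: space_prob_measures[OF assms(2)])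
qed

text \<open>As the image of the uniform distribution on \<open>{..<n}\<close> under
  \<open>k \<mapsto> (shift ^^ k) u\<close>, the set function in the definition is seen to be a
  measure, and its integrals and values become finite averages along the orbit.\<close>

lemma empirical_eq:
  assumes n: "n > 0" and u: "u \<in> paths G"
  shows "empirical G n u = distr (measure_pmf (pmf_of_set {..<n})) (path_borel G) (\<lambda>k. (shift ^^ k) u)"
    (is "_ = ?D")
proof -
  have [measurable]: "(\<lambda>k. (shift ^^ k) u) \<in> measurable (measure_pmf (pmf_of_set {..<n})) (path_borel G)"
    using u by (auto simp: paths_shift_power)
  have "emeasure ?D A = (\<Sum>k<n. emeasure (return (path_borel G) ((shift ^^ k) u)) A) / of_nat n"
    if A: "A \<in> sets (path_borel G)" for A
  proof -
    have "emeasure ?D A = emeasure (measure_pmf (pmf_of_set {..<n})) ((\<lambda>k. (shift ^^ k) u) -` A)"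
      using A u by (subst emeasure_distr) (auto simp: paths_shift_power)
    also have "\<dots> = ennreal (real (card ({..<n} \<inter> (\<lambda>k. (shift ^^ k) u) -` A)) / real n)"
      using n by (subst emeasure_pmf_of_set) auto
    also have "\<dots> = of_nat (card ({..<n} \<inter> (\<lambda>k. (shift ^^ k) u) -` A)) / of_nat n"
      using n by (simp add: divide_ennreal[symmetric] ennreal_of_nat_eq_real_of_nat)
    also have "of_nat (card ({..<n} \<inter> (\<lambda>k. (shift ^^ k) u) -` A)) =
        (\<Sum>k<n. indicator A ((shift ^^ k) u) :: ennreal)"
      by (simp add: indicator_def sum.If_cases vimage_def)
    finally show ?thesis using A by simp
  qed note * = this
  have "empirical G n u = measure_of (space (path_borel G)) (sets (path_borel G)) (emeasure ?D)"
    unfolding empirical_def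
    by (rule measure_of_eq) (simp_all only: sets.space_closed sets.sigma_sets_eq *)
  also have "\<dots> = ?D" using measure_of_of_measure[of ?D] by simp
  finally show ?thesis .
qed

lemma empirical_prob:
  assumes "n > 0" "u \<in> paths G" shows "empirical G n u \<in> prob_measures G"
  unfolding empirical_eq[OF assms] prob_measures_def
  using assms(2) by (auto intro!: prob_space.prob_space_distr measure_pmf.prob_space_axioms simp: paths_shift_power)

lemma integral_empirical:
  fixes g :: "(nat \<Rightarrow> 'e) \<Rightarrow> real"
  assumes "n > 0" "u \<in> paths G" "g \<in> borel_measurable (path_borel G)"
  shows "integral\<^sup>L (empirical G n u) g = (\<Sum>k<n. g ((shift ^^ k) u)) / n"
  unfolding empirical_eq[OF assms(1,2)]
  using assms by (subst integral_distr) (auto simp: paths_shift_power integral_pmf_of_set lessThan_empty_iff)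

lemma measure_empirical:
  assumes "n > 0" "u \<in> paths G" "A \<in> sets (path_borel G)"
  shows "measure (empirical G n u) A = card {k. k < n \<and> (shift ^^ k) u \<in> A} / n"
  unfolding empirical_eq[OF assms(1,2)]
  using assms by (subst measure_distr)
    (auto simp: paths_shift_power measure_pmf_of_set lessThan_empty_iff vimage_def Int_def)

section \<open>Measures determined by their cylinder probabilities\<close>

lemma cylset_eq_Union:
  assumes "A \<subseteq> paths G" "\<And>u v. u \<in> A \<Longrightarrow> v \<in> paths G \<Longrightarrow> initial k v = initial k u \<Longrightarrow> v \<in> A"
  shows "A = (\<Union>w\<in>initial k ` A. cyl G w)"
  using assms by (auto simp: cyl_initial)

lemma measure_cylset:
  assumes "M \<in> prob_measures G"
    and A: "A \<subseteq> paths G" "\<And>u v. u \<in> A \<Longrightarrow> v \<in> paths G \<Longrightarrow> initial k v = initial k u \<Longrightarrow> v \<in> A"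
  shows "measure M A = (\<Sum>w\<in>initial k ` A. measure M (cyl G w))"
proof -
  interpret prob_space M using assms(1) by (rule prob_space_prob_measures)
  have fin: "finite (initial k ` A)"
    by (rule finite_subset[OF _ finite_words'[of k]]) (use A(1) initial_in_words[of _ G] in blast)
  have "measure M (\<Union>w\<in>initial k ` A. cyl G w) = (\<Sum>w\<in>initial k ` A. measure M (cyl G w))"
  proof (rule finite_measure_finite_Union[OF fin])
    show "cyl G ` initial k ` A \<subseteq> events"
      unfolding sets_prob_measures[OF assms(1)] by (rule image_subsetI) (rule cyl_sets)
    show "disjoint_family_on (cyl G) (initial k ` A)"
      by (auto simp: disjoint_family_on_def cyl_initial)
  qed
  then show ?thesis by (simp only: cylset_eq_Union[OF A, symmetric])
qed

text \<open>The family \<open>cylsets\<close> is stable under intersection and generates the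
  sigma-algebra, and measures of its members are finite sums of cylinder probabilities. Invariance
  is reduced to cylinders by applying this to \<open>M\<close> and its image under the
  shift.\<close>

lemma prob_measure_eqI:
  assumes M: "M \<in> prob_measures G" and N: "N \<in> prob_measures G"
    and eq: "\<And>w. measure M (cyl G w) = measure N (cyl G w)"
  shows "M = N"
proof -
  interpret M: prob_space M using M by (rule prob_space_prob_measures)
  interpret N: prob_space N using N by (rule prob_space_prob_measures)
  interpret algebra "paths G" cylsets by (rule algebra_cylsets)
  show ?thesis
  proof (rule measure_eqI_generator_eq[where E = cylsets and \<Omega> = "paths G" and A = "\<lambda>_. paths G"])
    fix X assume "X \<in> cylsets"
    then obtain k where A: "X \<subseteq> paths G"
      "\<And>u v. u \<in> X \<Longrightarrow> v \<in> paths G \<Longrightarrow> initial k v = initial k u \<Longrightarrow> v \<in> X" unfolding cylsets_def by blast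
    show "emeasure M X = emeasure N X"
      unfolding M.emeasure_eq_measure N.emeasure_eq_measure
      using measure_cylset[OF M A] measure_cylset[OF N A] eq by simp
  qed (use M N sets_prob_measures sets_path_borel space_closed in \<open>auto simp: Int_stable_def\<close>)
qed

lemma invariantI:
  assumes M: "M \<in> prob_measures G"
    and eq: "\<And>w. measure M (shift -` cyl G w \<inter> paths G) = measure M (cyl G w)"
  shows "M \<in> invariant_measures G"
proof -
  interpret M: prob_space M using M by (rule prob_space_prob_measures)
  have m: "shift \<in> measurable M M"
    using measurable_shift measurable_cong_sets[OF sets_prob_measures[OF M] sets_prob_measures[OF M]] by simp
  have "distr M M shift = M"
  proof (rule prob_measure_eqI)
    show "distr M M shift \<in> prob_measures G"
      using M.prob_space_distr[OF m] sets_prob_measures[OF M] by (simp add: prob_measures_def)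
    show "measure (distr M M shift) (cyl G w) = measure M (cyl G w)" for w
      using eq by (subst measure_distr[OF m]) (simp_all add: sets_prob_measures[OF M] space_prob_measures[OF M])
  qed fact
  then show ?thesis using M by (simp add: invariant_measures_def)
qed

lemma integral_initial:
  fixes c :: "'e list \<Rightarrow> real"
  assumes M: "M \<in> prob_measures G"
  shows "(\<integral>u. c (initial k u) \<partial>M) = (\<Sum>w\<in>words G k. c w * measure M (cyl G w))"
    and "integrable M (\<lambda>u. c (initial k u))"
proof -
  interpret prob_space M using M by (rule prob_space_prob_measures)
  have [simp, measurable]: "cyl G w \<in> events" for w by (simp add: sets_prob_measures[OF M])
  have eq: "c (initial k u) = (\<Sum>w\<in>words G k. c w * indicator (cyl G w) u)" if "u \<in> space M" for u
  proof -
    have u: "u \<in> paths G" using that space_prob_measures[OF M] by simp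
    have "(\<Sum>w\<in>words G k. c w * indicator (cyl G w) u) =
        (\<Sum>w\<in>words G k. if initial k u = w then c w else 0)"
      by (intro sum.cong) (auto simp: cyl_word u indicator_def)
    then show ?thesis using initial_in_words[OF u] by simp
  qed
  have int: "integrable M (\<lambda>u. \<Sum>w\<in>words G k. c w * indicator (cyl G w) u)"
    by (intro Bochner_Integration.integrable_sum integrable_mult_right) (auto simp: emeasure_eq_measure)
  then show "integrable M (\<lambda>u. c (initial k u))"
    by (subst Bochner_Integration.integrable_cong[OF refl eq]) auto
  have "(\<integral>u. c (initial k u) \<partial>M) = (\<integral>u. (\<Sum>w\<in>words G k. c w * indicator (cyl G w) u) \<partial>M)"
    by (rule Bochner_Integration.integral_cong[OF refl eq])
  also have "\<dots> = (\<Sum>w\<in>words G k. c w * measure M (cyl G w))"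
    by (subst Bochner_Integration.integral_sum) (auto simp: emeasure_eq_measure intro!: integrable_mult_right)
  finally show "(\<integral>u. c (initial k u) \<partial>M) = (\<Sum>w\<in>words G k. c w * measure M (cyl G w))" .
qed

lemma sum_measure_cyl:
  assumes M: "M \<in> prob_measures G"
  shows "(\<Sum>w\<in>words G k. measure M (cyl G w)) = 1"
proof -
  interpret prob_space M using M by (rule prob_space_prob_measures)
  show ?thesis using integral_initial(1)[OF M, of "\<lambda>_. 1" k] by (simp add: prob_space)
qed

text \<open>Up to \<open>e/4\<close>, uniformly, \<open>g\<close> is a function \<open>c\<close> of
  the first \<open>k\<close> letters, whose integral is a finite linear combination of cylinder
  probabilities. So finitely many of these control the integral, with a tolerance independent of the
  measures.\<close>

lemma integral_near:
  assumes g: "continuous_map (path_topology G) euclideanreal g" and e: "e > 0"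
  obtains F d where "finite F" "d > 0"
    "\<And>M N. M \<in> prob_measures G \<Longrightarrow> N \<in> prob_measures G \<Longrightarrow>
       (\<And>w. w \<in> F \<Longrightarrow> \<bar>measure M (cyl G w) - measure N (cyl G w)\<bar> < d) \<Longrightarrow>
       \<bar>(\<integral>u. g u \<partial>M) - (\<integral>u. g u \<partial>N)\<bar> < e"
proof -
  obtain k where k: "\<And>u v. u \<in> paths G \<Longrightarrow> v \<in> paths G \<Longrightarrow> initial k u = initial k v \<Longrightarrow> \<bar>g u - g v\<bar> < e/4"
    using uniformly_continuous_initial[OF g, of "e/4"] e by auto
  define c where "c w = g (SOME u. u \<in> cyl G w)" for w
  have c: "\<bar>g u - c (initial k u)\<bar> \<le> e/4" if u: "u \<in> paths G" for u
  proof -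
    have "u \<in> cyl G (initial k u)" using u by (simp add: cyl_initial)
    then have "(SOME v. v \<in> cyl G (initial k u)) \<in> cyl G (initial k u)" by (rule someI[of "\<lambda>v. v \<in> cyl G (initial k u)"])
    then show ?thesis unfolding c_def using k[OF u] by (intro less_imp_le) (auto simp: cyl_initial)
  qed
  have *: "\<bar>(\<integral>u. g u \<partial>M) - (\<Sum>w\<in>words G k. c w * measure M (cyl G w))\<bar> \<le> e/4"
    if M: "M \<in> prob_measures G" for M
  proof -
    interpret prob_space M using M by (rule prob_space_prob_measures)
    have i: "integrable M g" "integrable M (\<lambda>u. c (initial k u))"
      using integrable_continuous[OF g M] integral_initial(2)[OF M] by auto
    have "\<bar>(\<integral>u. g u \<partial>M) - (\<integral>u. c (initial k u) \<partial>M)\<bar> = \<bar>\<integral>u. g u - c (initial k u) \<partial>M\<bar>"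
      using i by (simp add: Bochner_Integration.integral_diff)
    also have "\<dots> \<le> (\<integral>u. \<bar>g u - c (initial k u)\<bar> \<partial>M)" by (rule integral_abs_bound)
    also have "\<dots> \<le> (\<integral>u. e/4 \<partial>M)"
    proof (rule integral_mono)
      show "\<bar>g u - c (initial k u)\<bar> \<le> e/4" if "u \<in> space M" for u
        by (rule c) (use that space_prob_measures[OF M] in simp)
    qed (use i in auto)
    finally show ?thesis using integral_initial(1)[OF M, of c k] by (simp add: prob_space)
  qed
  define S where "S = (\<Sum>w\<in>words G k. \<bar>c w\<bar>)"
  have S: "S \<ge> 0" unfolding S_def by (intro sum_nonneg) auto
  \<comment> \<open>Two approximation errors of \<open>e/4\<close> and
    \<open>S * d \<le> e/4\<close> add up to less than \<open>e\<close>; the summand 1 covers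
    \<open>S = 0\<close>.\<close>
  define d where "d = e / (4 * (S + 1))"
  have d: "d > 0" using e S by (auto simp: d_def)
  show ?thesis
  proof (rule that[OF finite_words'[of k] d])
    fix M N assume M: "M \<in> prob_measures G" and N: "N \<in> prob_measures G"
      and near: "\<And>w. w \<in> words G k \<Longrightarrow> \<bar>measure M (cyl G w) - measure N (cyl G w)\<bar> < d"
    have "\<bar>(\<Sum>w\<in>words G k. c w * measure M (cyl G w)) - (\<Sum>w\<in>words G k. c w * measure N (cyl G w))\<bar>
        = \<bar>\<Sum>w\<in>words G k. c w * (measure M (cyl G w) - measure N (cyl G w))\<bar>"
      by (simp add: sum_subtractf algebra_simps)
    also have "\<dots> \<le> (\<Sum>w\<in>words G k. \<bar>c w\<bar> * d)"
      by (rule order_trans[OF sum_abs])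
        (intro sum_mono, simp add: abs_mult mult_left_mono less_imp_le near)
    also have "\<dots> = S * d" by (simp add: S_def sum_distrib_right)
    also have "\<dots> \<le> e/4" using S e by (simp add: d_def field_simps)
    finally show "\<bar>(\<integral>u. g u \<partial>M) - (\<integral>u. g u \<partial>N)\<bar> < e"
      using *[OF M] *[OF N] e by linarith
  qed
qed

section \<open>Weak neighbourhoods\<close>

lemma topspace_weak_topology: "topspace (weak_topology G) = prob_measures G"
proof -
  have "prob_measures G \<in> {{M \<in> prob_measures G. (\<integral>u. f u \<partial>M) \<in> W} | f W.
        continuous_map (path_topology G) euclideanreal f \<and> open (W :: real set)}"
    by (rule CollectI, rule exI[of _ "\<lambda>_. 0"], rule exI[of _ UNIV]) auto
  then show ?thesis unfolding weak_topology_def topology_generated_by_topspace by blast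
qed

text \<open>Induction over the generated topology: a subbasic set is handled by
  \<open>integral_near\<close>, and an intersection by the union of the two word sets and the
  smaller tolerance.\<close>

lemma weak_open_near:
  assumes "openin (weak_topology G) A" "M \<in> A" "M \<in> prob_measures G"
  shows "\<exists>F d. finite F \<and> d > 0 \<and> (\<forall>N\<in>prob_measures G.
       (\<forall>w\<in>F. \<bar>measure N (cyl G w) - measure M (cyl G w)\<bar> < d) \<longrightarrow> N \<in> A)"
proof -
  have "generate_topology_on {{M \<in> prob_measures G. (\<integral>u. f u \<partial>M) \<in> W} | f W.
        continuous_map (path_topology G) euclideanreal f \<and> open (W :: real set)} A"
    using assms(1) unfolding weak_topology_def by (rule openin_topology_generated_by)
  then show ?thesis using assms(2)
  proof (induction)
    case Empty then show ?case by simp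
  next
    case (Int a b)
    then obtain F d F' d' where
      "finite F" "d > 0" "\<forall>N\<in>prob_measures G.
       (\<forall>w\<in>F. \<bar>measure N (cyl G w) - measure M (cyl G w)\<bar> < d) \<longrightarrow> N \<in> a"
      "finite F'" "d' > 0" "\<forall>N\<in>prob_measures G.
       (\<forall>w\<in>F'. \<bar>measure N (cyl G w) - measure M (cyl G w)\<bar> < d') \<longrightarrow> N \<in> b" by blast
    then show ?case
      by (intro exI[of _ "F \<union> F'"] exI[of _ "min d d'"]) auto
  next
    case (UN K)
    then obtain a where a: "a \<in> K" "M \<in> a" by auto
    then show ?case using UN.IH[OF a] by (meson UnionI)
  next
    case (Basis a)
    then obtain f W where a: "a = {M \<in> prob_measures G. (\<integral>u. f u \<partial>M) \<in> W}"
      and f: "continuous_map (path_topology G) euclideanreal f" and W: "open W" by auto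
    then obtain e where e: "e > 0" "ball (\<integral>u. f u \<partial>M) e \<subseteq> W"
      using Basis.prems by (auto elim: openE)
    obtain F d where F: "finite F" "d > 0"
      "\<And>M N. M \<in> prob_measures G \<Longrightarrow> N \<in> prob_measures G \<Longrightarrow>
       (\<And>w. w \<in> F \<Longrightarrow> \<bar>measure M (cyl G w) - measure N (cyl G w)\<bar> < d) \<Longrightarrow>
       \<bar>(\<integral>u. f u \<partial>M) - (\<integral>u. f u \<partial>N)\<bar> < e" by (rule integral_near[OF f e(1)]) metis
    have "N \<in> a" if "N \<in> prob_measures G" "\<forall>w\<in>F. \<bar>measure N (cyl G w) - measure M (cyl G w)\<bar> < d" for N
    proof -
      have "\<bar>(\<integral>u. f u \<partial>N) - (\<integral>u. f u \<partial>M)\<bar> < e" using F(3)[of N M] that assms(3) by blast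
      then have "(\<integral>u. f u \<partial>N) \<in> ball (\<integral>u. f u \<partial>M) e" by (simp add: dist_real_def abs_minus_commute)
      then show ?thesis using e(2) a that by auto
    qed
    then show ?case using F(1,2) by blast
  qed
qed

text \<open>In both bounds for the pressure, continuity of \<open>U\<close> is used in this form:
  finitely many cylinder probabilities control the position of \<open>U N\<close>.\<close>

lemma weak_continuous_near:
  fixes U :: "(nat \<Rightarrow> 'e) measure \<Rightarrow> 'x::metric_space"
  assumes U: "continuous_map (weak_topology G) euclidean U" and M: "M \<in> prob_measures G" and e: "e > 0"
  obtains F d where "finite F" "d > 0"
    "\<And>N. N \<in> prob_measures G \<Longrightarrow>
       (\<And>w. w \<in> F \<Longrightarrow> \<bar>measure N (cyl G w) - measure M (cyl G w)\<bar> < d) \<Longrightarrow> dist (U N) (U M) < e"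
proof -
  have "openin (weak_topology G) {N \<in> topspace (weak_topology G). U N \<in> ball (U M) e}"
    by (rule openin_continuous_map_preimage[OF U]) auto
  then obtain F d where "finite F" "d > 0" "\<forall>N\<in>prob_measures G.
       (\<forall>w\<in>F. \<bar>measure N (cyl G w) - measure M (cyl G w)\<bar> < d) \<longrightarrow>
        N \<in> {N \<in> topspace (weak_topology G). U N \<in> ball (U M) e}"
    using weak_open_near[OF _ _ M] M e by (metis (no_types, lifting) CollectI centre_in_ball topspace_weak_topology)
  then show ?thesis by (intro that[of F d]) (auto simp: dist_commute)
qed

section \<open>Limits of measures along cylinder probabilities\<close>

lemma decseq_cylsets_empty:
  assumes A: "range A \<subseteq> cylsets" "decseq A" and empty: "(\<Inter>i. A i) = {}"
  shows "\<exists>N. \<forall>i\<ge>N. A i = {}"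
proof -
  interpret algebra "paths G" cylsets by (rule algebra_cylsets)
  have "paths G - A i \<in> cylsets" for i using A by auto
  then have "openin (path_topology G) (paths G - A i)" for i by (rule cylsets_openin)
  moreover have "paths G \<subseteq> \<Union> (range (\<lambda>i. paths G - A i))" using empty by auto
  ultimately obtain \<F> where "finite \<F>" "\<F> \<subseteq> range (\<lambda>i. paths G - A i)" "paths G \<subseteq> \<Union> \<F>"
    using compact_space_path_topology unfolding compact_space_def compactin_def
    by (metis (no_types, lifting) imageE topspace_path_topology)
  then obtain I where I: "finite I" "paths G \<subseteq> (\<Union>i\<in>I. paths G - A i)"
    by (metis finite_subset_image)
  then obtain N where N: "\<And>i. i \<in> I \<Longrightarrow> i \<le> N" using finite_nat_set_iff_bounded_le by meson
  have "A i = {}" if "i \<ge> N" for i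
  proof (rule ccontr)
    assume "A i \<noteq> {}"
    then obtain u where u: "u \<in> A i" by auto
    moreover have "u \<in> paths G" using u A(1) by (auto simp: cylsets_def)
    ultimately obtain j where j: "j \<in> I" "u \<notin> A j" using I(2) by auto
    then have "A i \<subseteq> A j" using N[of j] that A(2) by (intro decseqD[of A j i]) auto
    then show False using u j by auto
  qed
  then show ?thesis by blast
qed

text \<open>Convergence on cylinders passes to \<open>cylsets\<close> through finite sums, so the
  limits form a finitely additive set function. It is continuous at the empty set because, by
  compactness, a decreasing sequence in \<open>cylsets\<close> with empty intersection is eventually
  empty; Caratheodory's theorem then extends it.\<close>

lemma limit_measure_exists:
  assumes M: "\<And>i. M i \<in> prob_measures G"
    and conv: "\<And>w. convergent (\<lambda>i::nat. measure (M i) (cyl G w))"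
  shows "\<exists>N\<in>prob_measures G. \<forall>A\<in>cylsets. (\<lambda>i. measure (M i) A) \<longlonglongrightarrow> measure N A"
proof -
  interpret algebra "paths G" cylsets by (rule algebra_cylsets)
  interpret M: prob_space "M i" for i by (rule prob_space_prob_measures[OF M])
  have sets: "A \<in> cylsets \<Longrightarrow> A \<in> sets (M i)" for A i
    by (simp add: cylsets_sets sets_prob_measures[OF M])
  define l where "l A = lim (\<lambda>i. measure (M i) A)" for A
  have l: "(\<lambda>i. measure (M i) A) \<longlonglongrightarrow> l A" if "A \<in> cylsets" for A
  proof -
    obtain k where A: "A \<subseteq> paths G"
      "\<And>u v. u \<in> A \<Longrightarrow> v \<in> paths G \<Longrightarrow> initial k v = initial k u \<Longrightarrow> v \<in> A"
      using \<open>A \<in> cylsets\<close> unfolding cylsets_def by blast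
    have "convergent (\<lambda>i. \<Sum>w\<in>initial k ` A. measure (M i) (cyl G w))"
      by (intro convergent_sum conv)
    then show ?thesis
      unfolding l_def using measure_cylset[OF M A] by (simp add: convergent_LIMSEQ_iff)
  qed
  have l0: "0 \<le> l A" if "A \<in> cylsets" for A
    by (rule LIMSEQ_le_const[OF l[OF that]]) auto
  define f where "f A = ennreal (l A)" for A
  have "\<exists>m. (\<forall>s\<in>cylsets. m s = f s) \<and> measure_space (paths G) (sigma_sets (paths G) cylsets) m"
  proof (rule caratheodory_empty_continuous)
    have "l {} = 0" unfolding l_def by simp
    then show "positive cylsets f" by (simp add: positive_def f_def)
    show "additive cylsets f"
    proof (unfold additive_def, intro ballI impI)
      fix A B assume AB: "A \<in> cylsets" "B \<in> cylsets" "A \<inter> B = {}"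
      then have "(\<lambda>i. measure (M i) (A \<union> B)) \<longlonglongrightarrow> l A + l B"
        using tendsto_add[OF l[OF AB(1)] l[OF AB(2)]] sets by (simp add: M.finite_measure_Union)
      then have "l (A \<union> B) = l A + l B" using l[OF Un[OF AB(1,2)]] LIMSEQ_unique by blast
      then show "f (A \<union> B) = f A + f B" unfolding f_def using l0 AB by (simp add: ennreal_plus)
    qed
    show "f A \<noteq> \<infinity>" for A by (simp add: f_def)
  next
    fix A :: "nat \<Rightarrow> _" assume "range A \<subseteq> cylsets" "decseq A" "(\<Inter>i. A i) = {}"
    then obtain j where "\<forall>i\<ge>j. A i = {}" using decseq_cylsets_empty by blast
    then have "\<forall>\<^sub>F i in sequentially. f (A i) = 0"
      by (auto simp: eventually_sequentially f_def l_def intro!: exI[of _ j])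
    then show "(\<lambda>i. f (A i)) \<longlonglongrightarrow> 0" by (rule tendsto_eventually)
  qed
  then obtain m where m: "\<forall>s\<in>cylsets. m s = f s" "measure_space (paths G) (sigma_sets (paths G) cylsets) m"
    by blast
  define N where "N = measure_of (paths G) cylsets m"
  have sub: "cylsets \<subseteq> Pow (paths G)" by (rule space_closed)
  have sets_N: "sets N = sets (path_borel G)" and space_N: "space N = paths G"
    unfolding N_def using sub by (simp_all add: sets_path_borel sets_measure_of space_measure_of)
  have em: "emeasure N A = f A" if "A \<in> cylsets" for A
  proof -
    have "emeasure N A = m A"
    proof (rule emeasure_measure_of[OF N_def])
      show "positive (sets N) m" "countably_additive (sets N) m"
        using m(2) unfolding measure_space_def sets_N sets_path_borel by auto
    qed (use that sub in \<open>auto simp: sets_N cylsets_sets\<close>)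
    then show ?thesis using m(1) that by simp
  qed
  have "l (paths G) = 1"
  proof -
    have "measure (M i) (paths G) = 1" for i using M.prob_space[of i] space_prob_measures[OF M] by simp
    then show ?thesis unfolding l_def by simp
  qed
  then have "emeasure N (space N) = 1" using em[OF top] by (simp add: space_N f_def)
  then have "N \<in> prob_measures G" unfolding prob_measures_def using sets_N by (auto intro: prob_spaceI)
  moreover have "measure N A = l A" if "A \<in> cylsets" for A
    unfolding measure_def using em[OF that] l0[OF that] by (simp add: f_def)
  ultimately show ?thesis using l by metis
qed

end

section \<open>Entropy of labellings\<close>

lemma subadditive_mult:
  fixes a :: "nat \<Rightarrow> real"
  assumes sub: "\<And>m n. a (m + n) \<le> a m + a n"
  shows "a (q * k + r) \<le> q * a k + a r"
proof (induction q)
  case (Suc q)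
  have "a (Suc q * k + r) \<le> a k + a (q * k + r)" using sub[of k "q * k + r"] by (simp add: add.assoc)
  then show ?case using Suc by (simp add: algebra_simps)
qed simp

text \<open>Fekete's lemma, from the division of \<open>n\<close> by a length \<open>k\<close> at
  which \<open>a k / k\<close> is nearly minimal.\<close>

lemma subadditive_limit:
  fixes a :: "nat \<Rightarrow> real"
  assumes sub: "\<And>m n. a (m + n) \<le> a m + a n" and nonneg: "\<And>n. a n \<ge> 0"
  shows "(\<lambda>n. a n / n) \<longlonglongrightarrow> (INF n\<in>{1..}. a n / n)"
    and "n \<ge> 1 \<Longrightarrow> (INF n\<in>{1..}. a n / n) \<le> a n / n"
proof -
  define L where "L = (INF n\<in>{1..}. a n / n)"
  have bdd: "bdd_below ((\<lambda>n. a n / n) ` {1..})" using nonneg by (auto intro!: bdd_belowI[of _ 0])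
  show le: "(INF n\<in>{1..}. a n / n) \<le> a n / n" if "n \<ge> 1" for n
    by (rule cINF_lower[OF bdd]) (use that in auto)
  show "(\<lambda>n. a n / n) \<longlonglongrightarrow> (INF n\<in>{1..}. a n / n)"
  proof (rule order_tendstoI)
    fix y assume "y < (INF n\<in>{1..}. a n / n)"
    then show "\<forall>\<^sub>F n in sequentially. y < a n / n"
      using le by (intro eventually_sequentiallyI[of 1]) (meson less_le_trans)
  next
    fix y assume "(INF n\<in>{1..}. a n / n) < y"
    then obtain k where k: "k \<ge> 1" "a k / k < y"
      using cINF_less_iff[OF _ bdd] by auto
    \<comment> \<open>\<open>C\<close> bounds the contribution of the remainder
      \<open>n mod k\<close>, uniformly in \<open>n\<close>.\<close>
    define C where "C = Max (a ` {..<k})"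
    have C: "a r \<le> C" if "r < k" for r unfolding C_def using that by (intro Max_ge) auto
    have bound: "a n / n \<le> a k / k + C / n" if "n \<ge> 1" for n
    proof -
      have "a n \<le> (n div k) * a k + a (n mod k)"
        using subadditive_mult[of a "n div k" k "n mod k", OF sub] by simp
      also have "\<dots> \<le> (n / k) * a k + C"
      proof (intro add_mono mult_right_mono nonneg C)
        show "real (n div k) \<le> n / k" by (rule of_nat_div_le_of_nat)
      qed (use k in auto)
      finally show ?thesis using that k by (simp add: field_simps)
    qed
    have "(\<lambda>n. a k / k + C / real n) \<longlonglongrightarrow> a k / k + 0"
      by (intro tendsto_intros lim_const_over_n)
    then have "\<forall>\<^sub>F n in sequentially. a k / k + C / real n < y" using k by (intro order_tendstoD) auto
    then show "\<forall>\<^sub>F n in sequentially. a n / n < y"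
      using eventually_ge_at_top[of 1] by eventually_elim (use bound in force)
  qed
qed

text \<open>Only the limit 0 needs an argument: there \<open>x * ln x\<close> tends to 0 from the
  right, and its value at 0 is 0 as well.\<close>

lemma tendsto_x_ln_x:
  fixes f :: "'a \<Rightarrow> real"
  assumes "(f \<longlongrightarrow> l) F" and nonneg: "\<And>x. f x \<ge> 0" "l \<ge> 0"
  shows "((\<lambda>x. f x * ln (f x)) \<longlongrightarrow> l * ln l) F"
proof (cases "l = 0")
  case False
  then show ?thesis by (intro tendsto_intros assms)
next
  case True
  have "((\<lambda>x::real. x * ln x) \<longlongrightarrow> 0) (at_right 0)" by real_asymp
  then have "((\<lambda>x::real. x * ln x) \<longlongrightarrow> 0) (at 0 within {0..})"
    by (rule Lim_transform_within_set) (simp add: eventually_at_filter, intro always_eventually, auto)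
  then have "continuous (at 0 within {0..}) (\<lambda>x::real. x * ln x)" by (simp add: continuous_within)
  then have "((\<lambda>x. f x * ln (f x)) \<longlongrightarrow> 0 * ln 0) F"
    by (rule continuous_within_tendsto_compose) (use assms True in auto)
  then show ?thesis using True by simp
qed

text \<open>The pointwise estimate behind strong subadditivity is \<open>ln x \<le> x - 1\<close> at
  \<open>x = pac a c * pbc b c / (p a b c * pc c)\<close>.\<close>

lemma sum_ln_strong_subadditive:
  fixes p :: "'a \<Rightarrow> 'b \<Rightarrow> 'c \<Rightarrow> real"
  assumes fin: "finite A" "finite B" "finite C"
    and nonneg: "\<And>a b c. p a b c \<ge> 0"
  defines "pac \<equiv> \<lambda>a c. \<Sum>b\<in>B. p a b c"
    and "pbc \<equiv> \<lambda>b c. \<Sum>a\<in>A. p a b c"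
    and "pc \<equiv> \<lambda>c. \<Sum>a\<in>A. \<Sum>b\<in>B. p a b c"
  shows "(\<Sum>a\<in>A. \<Sum>c\<in>C. pac a c * ln (pac a c)) + (\<Sum>b\<in>B. \<Sum>c\<in>C. pbc b c * ln (pbc b c))
    \<le> (\<Sum>a\<in>A. \<Sum>b\<in>B. \<Sum>c\<in>C. p a b c * ln (p a b c)) + (\<Sum>c\<in>C. pc c * ln (pc c))"
proof -
  have pointwise: "p a b c * (ln (pac a c) + ln (pbc b c) - ln (p a b c) - ln (pc c))
      \<le> pac a c * pbc b c / pc c - p a b c" if abc: "a \<in> A" "b \<in> B" "c \<in> C" for a b c
  proof (cases "p a b c = 0")
    case True
    have "0 \<le> pac a c * pbc b c / pc c"
      unfolding pac_def pbc_def pc_def by (intro divide_nonneg_nonneg mult_nonneg_nonneg sum_nonneg nonneg)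
    then show ?thesis using True by simp
  next
    case False
    then have p: "p a b c > 0" using nonneg[of a b c] by simp
    have 1: "p a b c \<le> pac a c" unfolding pac_def by (rule member_le_sum) (use abc fin nonneg in auto)
    have 2: "p a b c \<le> pbc b c" unfolding pbc_def by (rule member_le_sum[of a A "\<lambda>a. p a b c"]) (use abc fin nonneg in auto)
    have 3: "pac a c \<le> pc c" unfolding pac_def pc_def
      by (rule member_le_sum[of a A "\<lambda>a. \<Sum>b\<in>B. p a b c"]) (use abc fin nonneg in \<open>auto intro: sum_nonneg\<close>)
    define x where "x = pac a c * pbc b c / (p a b c * pc c)"
    have x: "x > 0" unfolding x_def using p 1 2 3 by simp
    have "ln (pac a c) + ln (pbc b c) - ln (p a b c) - ln (pc c) = ln x"
      unfolding x_def using p 1 2 3 by (simp add: ln_div ln_mult)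
    also have "\<dots> \<le> x - 1" using x by (rule ln_le_minus_one)
    finally have "p a b c * (ln (pac a c) + ln (pbc b c) - ln (p a b c) - ln (pc c)) \<le> p a b c * (x - 1)"
      using p by (intro mult_left_mono) auto
    also have "\<dots> = pac a c * pbc b c / pc c - p a b c"
      unfolding x_def using p by (simp add: field_simps)
    finally show ?thesis .
  qed
  have pc: "pc c = (\<Sum>a\<in>A. pac a c)" "pc c = (\<Sum>b\<in>B. pbc b c)" for c
    unfolding pc_def pac_def pbc_def by (rule refl, rule sum.swap)
  have "(\<Sum>c\<in>C. \<Sum>a\<in>A. \<Sum>b\<in>B. p a b c * (ln (pac a c) + ln (pbc b c) - ln (p a b c) - ln (pc c)))
      \<le> (\<Sum>c\<in>C. \<Sum>a\<in>A. \<Sum>b\<in>B. pac a c * pbc b c / pc c - p a b c)"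
    by (intro sum_mono pointwise)
  \<comment> \<open>The quotient is left uncancelled because \<open>pc c\<close> may vanish; as
    division by 0 gives 0, each summand is 0 in either case.\<close>
  also have "\<dots> = (\<Sum>c\<in>C. pc c * pc c / pc c - pc c)"
  proof (intro sum.cong refl)
    fix c
    have "(\<Sum>a\<in>A. \<Sum>b\<in>B. pac a c * pbc b c / pc c) = (\<Sum>a\<in>A. pac a c) * (\<Sum>b\<in>B. pbc b c) / pc c"
      by (simp add: sum_product sum_divide_distrib)
    then show "(\<Sum>a\<in>A. \<Sum>b\<in>B. pac a c * pbc b c / pc c - p a b c) = pc c * pc c / pc c - pc c"
      by (simp add: sum_subtractf flip: pc) (simp add: pc_def)
  qed
  also have "\<dots> = 0" by (intro sum.neutral) auto
  finally have "(\<Sum>c\<in>C. (\<Sum>a\<in>A. \<Sum>b\<in>B. p a b c * ln (pac a c)) + (\<Sum>a\<in>A. \<Sum>b\<in>B. p a b c * ln (pbc b c))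
      - (\<Sum>a\<in>A. \<Sum>b\<in>B. p a b c * ln (p a b c)) - (\<Sum>a\<in>A. \<Sum>b\<in>B. p a b c * ln (pc c))) \<le> 0"
    by (simp add: algebra_simps sum.distrib sum_subtractf)
  moreover have "(\<Sum>a\<in>A. \<Sum>b\<in>B. p a b c * ln (pac a c)) = (\<Sum>a\<in>A. pac a c * ln (pac a c))" for c
    by (simp add: pac_def sum_distrib_right)
  moreover have "(\<Sum>a\<in>A. \<Sum>b\<in>B. p a b c * ln (pbc b c)) = (\<Sum>b\<in>B. pbc b c * ln (pbc b c))" for c
    by (subst sum.swap) (simp add: pbc_def sum_distrib_right)
  moreover have "(\<Sum>a\<in>A. \<Sum>b\<in>B. p a b c * ln (pc c)) = pc c * ln (pc c)" for c
    by (simp add: pc_def sum_distrib_right)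
  ultimately have "(\<Sum>c\<in>C. \<Sum>a\<in>A. pac a c * ln (pac a c)) + (\<Sum>c\<in>C. \<Sum>b\<in>B. pbc b c * ln (pbc b c))
    \<le> (\<Sum>c\<in>C. \<Sum>a\<in>A. \<Sum>b\<in>B. p a b c * ln (p a b c)) + (\<Sum>c\<in>C. pc c * ln (pc c))"
    by (simp add: sum.distrib sum_subtractf)
  moreover have "(\<Sum>c\<in>C. \<Sum>a\<in>A. \<Sum>b\<in>B. p a b c * ln (p a b c)) = (\<Sum>a\<in>A. \<Sum>b\<in>B. \<Sum>c\<in>C. p a b c * ln (p a b c))"
    by (subst sum.swap, intro sum.cong refl, rule sum.swap)
  moreover have "(\<Sum>c\<in>C. \<Sum>a\<in>A. pac a c * ln (pac a c)) = (\<Sum>a\<in>A. \<Sum>c\<in>C. pac a c * ln (pac a c))"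
    "(\<Sum>c\<in>C. \<Sum>b\<in>B. pbc b c * ln (pbc b c)) = (\<Sum>b\<in>B. \<Sum>c\<in>C. pbc b c * ln (pbc b c))"
    by (rule sum.swap)+
  ultimately show ?thesis by simp
qed

text \<open>Shannon entropy of the partition of the space into the fibres of \<open>F\<close>. With
  labellings in place of partitions, a join is a pair of labels and empty cells do not
  occur.\<close>

definition label_entropy :: "'a measure \<Rightarrow> ('a \<Rightarrow> 'b) \<Rightarrow> real" where
  "label_entropy M F =
     - (\<Sum>y\<in>F ` space M. measure M (F -` {y} \<inter> space M) * ln (measure M (F -` {y} \<inter> space M)))"

lemma label_entropy_superset:
  assumes "finite Y" "F ` space M \<subseteq> Y"
  shows "label_entropy M F =
     - (\<Sum>y\<in>Y. measure M (F -` {y} \<inter> space M) * ln (measure M (F -` {y} \<inter> space M)))"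
proof -
  have "F -` {y} \<inter> space M = {}" if "y \<in> Y - F ` space M" for y using that by auto
  then show ?thesis
    unfolding label_entropy_def using assms by (subst sum.mono_neutral_left[of Y "F ` space M"]) auto
qed

text \<open>The entropy depends only on the fibres. Choosing a point \<open>x y\<close> in each
  fibre of \<open>F\<close> gives a bijection \<open>y \<mapsto> F' (x y)\<close> between the label
  sets, which may have different types.\<close>

lemma label_entropy_cong:
  assumes "\<And>x y. x \<in> space M \<Longrightarrow> y \<in> space M \<Longrightarrow> F x = F y \<longleftrightarrow> F' x = F' y"
  shows "label_entropy M F = label_entropy M F'"
proof -
  define x where "x y = (SOME x. x \<in> space M \<and> F x = y)" for y
  have x: "x y \<in> space M \<and> F (x y) = y" if "y \<in> F ` space M" for y
    unfolding x_def by (rule someI_ex) (use that in auto)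
  have F': "F' (x (F z)) = F' z" if "z \<in> space M" for z
    using x[of "F z"] that assms by blast
  have "label_entropy M F' = - (\<Sum>y\<in>(\<lambda>y. F' (x y)) ` F ` space M.
      measure M (F' -` {y} \<inter> space M) * ln (measure M (F' -` {y} \<inter> space M)))"
  proof -
    have "F' ` space M = (\<lambda>y. F' (x y)) ` F ` space M"
      unfolding image_image by (intro image_cong refl) (simp add: F')
    then show ?thesis unfolding label_entropy_def by simp
  qed
  also have "\<dots> = - (\<Sum>y\<in>F ` space M.
      measure M (F' -` {F' (x y)} \<inter> space M) * ln (measure M (F' -` {F' (x y)} \<inter> space M)))"
  proof (subst sum.reindex)
    show "inj_on (\<lambda>y. F' (x y)) (F ` space M)"
      by (intro inj_onI) (metis x assms)
  qed auto
  also have "\<dots> = label_entropy M F"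
  proof -
    have "F' -` {F' (x y)} \<inter> space M = F -` {y} \<inter> space M" if "y \<in> F ` space M" for y
      using x[OF that] assms by auto
    then show ?thesis unfolding label_entropy_def by simp
  qed
  finally show ?thesis by simp
qed

context prob_space
begin

lemma measure_split:
  assumes Y: "simple_function M Y" and A: "A \<in> events" and B: "finite B" "Y ` space M \<subseteq> B"
  shows "prob A = (\<Sum>b\<in>B. prob (A \<inter> (Y -` {b} \<inter> space M)))"
proof -
  have "prob (\<Union>b\<in>B. A \<inter> (Y -` {b} \<inter> space M)) = (\<Sum>b\<in>B. prob (A \<inter> (Y -` {b} \<inter> space M)))"
  proof (rule finite_measure_finite_Union[OF B(1)])
    show "(\<lambda>b. A \<inter> (Y -` {b} \<inter> space M)) ` B \<subseteq> events"
      using A simple_functionD(2)[OF Y] by auto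
    show "disjoint_family_on (\<lambda>b. A \<inter> (Y -` {b} \<inter> space M)) B"
      by (auto simp: disjoint_family_on_def)
  qed
  moreover have "(\<Union>b\<in>B. A \<inter> (Y -` {b} \<inter> space M)) = A"
    using B(2) sets.sets_into_space[OF A] by auto
  ultimately show ?thesis by simp
qed

lemma label_entropy_nonneg:
  "label_entropy M F \<ge> 0"
proof -
  have "prob A * ln (prob A) \<le> 0" for A
    by (cases "prob A = 0") (auto intro!: mult_nonneg_nonpos simp: zero_less_measure_iff)
  then show ?thesis unfolding label_entropy_def by (simp add: sum_nonpos)
qed

text \<open>Nonnegativity of the conditional mutual information of \<open>X\<close> and
  \<open>Y\<close> given \<open>Z\<close>. Subadditivity (\<open>Z\<close> constant), monotonicity
  (\<open>Y = X\<close>) and the estimates for conditional entropies below are all obtained from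
  it.\<close>

lemma label_entropy_strong_subadditive:
  assumes X: "simple_function M X" and Y: "simple_function M Y" and Z: "simple_function M Z"
  shows "label_entropy M (\<lambda>x. (X x, Y x, Z x)) + label_entropy M Z
    \<le> label_entropy M (\<lambda>x. (X x, Z x)) + label_entropy M (\<lambda>x. (Y x, Z x))"
proof -
  define A B C where "A = X ` space M" and "B = Y ` space M" and "C = Z ` space M"
  have fin: "finite A" "finite B" "finite C"
    unfolding A_def B_def C_def using X Y Z by (auto dest: simple_functionD)
  define E where "E a b c = (X -` {a} \<inter> space M) \<inter> (Y -` {b} \<inter> space M) \<inter> (Z -` {c} \<inter> space M)" for a b c
  have ev: "X -` {a} \<inter> space M \<in> events" "Y -` {b} \<inter> space M \<in> events" "Z -` {c} \<inter> space M \<in> events" for a b c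
    using X Y Z by (auto dest: simple_functionD)
  define p where "p a b c = prob (E a b c)" for a b c
  have XZ: "prob ((\<lambda>x. (X x, Z x)) -` {(a, c)} \<inter> space M) = (\<Sum>b\<in>B. p a b c)" for a c
  proof -
    have "prob ((X -` {a} \<inter> space M) \<inter> (Z -` {c} \<inter> space M)) = (\<Sum>b\<in>B. p a b c)"
      unfolding p_def E_def
      by (subst measure_split[OF Y sets.Int[OF ev(1) ev(3)] fin(2)]) (auto simp: B_def Int_ac)
    moreover have "(\<lambda>x. (X x, Z x)) -` {(a, c)} \<inter> space M = (X -` {a} \<inter> space M) \<inter> (Z -` {c} \<inter> space M)"
      by auto
    ultimately show ?thesis by (simp only:)
  qed
  have YZ: "prob ((\<lambda>x. (Y x, Z x)) -` {(b, c)} \<inter> space M) = (\<Sum>a\<in>A. p a b c)" for b c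
  proof -
    have "prob ((Y -` {b} \<inter> space M) \<inter> (Z -` {c} \<inter> space M)) = (\<Sum>a\<in>A. p a b c)"
      unfolding p_def E_def
      by (subst measure_split[OF X sets.Int[OF ev(2) ev(3)] fin(1)]) (auto simp: A_def Int_ac)
    moreover have "(\<lambda>x. (Y x, Z x)) -` {(b, c)} \<inter> space M = (Y -` {b} \<inter> space M) \<inter> (Z -` {c} \<inter> space M)"
      by auto
    ultimately show ?thesis by (simp only:)
  qed
  have Zc: "prob (Z -` {c} \<inter> space M) = (\<Sum>a\<in>A. \<Sum>b\<in>B. p a b c)" for c
  proof -
    have "prob (Z -` {c} \<inter> space M) = (\<Sum>a\<in>A. prob ((\<lambda>x. (X x, Z x)) -` {(a, c)} \<inter> space M))"
      by (subst measure_split[OF X _ fin(1)])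
        (use ev in \<open>auto simp: A_def intro!: sum.cong arg_cong[where f = prob]\<close>)
    then show ?thesis by (simp add: XZ)
  qed
  have XYZ: "prob ((\<lambda>x. (X x, Y x, Z x)) -` {(a, b, c)} \<inter> space M) = p a b c" for a b c
    unfolding p_def E_def by (intro arg_cong[where f = prob]) auto
  have "label_entropy M (\<lambda>x. (X x, Y x, Z x)) = - (\<Sum>a\<in>A. \<Sum>b\<in>B. \<Sum>c\<in>C. p a b c * ln (p a b c))"
    by (subst label_entropy_superset[of "A \<times> B \<times> C"])
      (use fin in \<open>simp_all add: sum.cartesian_product' XYZ image_subset_iff\<close>, simp add: A_def B_def C_def)
  moreover have "label_entropy M (\<lambda>x. (X x, Z x)) = - (\<Sum>a\<in>A. \<Sum>c\<in>C. (\<Sum>b\<in>B. p a b c) * ln (\<Sum>b\<in>B. p a b c))"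
    by (subst label_entropy_superset[of "A \<times> C"])
      (use fin in \<open>simp_all add: sum.cartesian_product' XZ image_subset_iff\<close>, simp add: A_def C_def)
  moreover have "label_entropy M (\<lambda>x. (Y x, Z x)) = - (\<Sum>b\<in>B. \<Sum>c\<in>C. (\<Sum>a\<in>A. p a b c) * ln (\<Sum>a\<in>A. p a b c))"
    by (subst label_entropy_superset[of "B \<times> C"])
      (use fin in \<open>simp_all add: sum.cartesian_product' YZ image_subset_iff\<close>, simp add: B_def C_def)
  moreover have "label_entropy M Z = - (\<Sum>c\<in>C. (\<Sum>a\<in>A. \<Sum>b\<in>B. p a b c) * ln (\<Sum>a\<in>A. \<Sum>b\<in>B. p a b c))"
    by (subst label_entropy_superset[of C]) (use fin in \<open>simp_all add: Zc\<close>, simp add: C_def)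
  ultimately show ?thesis
    using sum_ln_strong_subadditive[OF fin, of p] by (simp add: p_def)
qed

lemma label_entropy_const: "label_entropy M (\<lambda>_. c) = 0"
proof -
  have "(\<lambda>_. c) -` {y} \<inter> space M = (if y = c then space M else {})" for y by auto
  then show ?thesis by (subst label_entropy_superset[of "{c}"]) (auto simp: prob_space)
qed

lemma label_entropy_subadditive:
  assumes X: "simple_function M X" and Y: "simple_function M Y"
  shows "label_entropy M (\<lambda>x. (X x, Y x)) \<le> label_entropy M X + label_entropy M Y"
proof -
  have "label_entropy M (\<lambda>x. (X x, Y x, ())) + label_entropy M (\<lambda>_. ())
    \<le> label_entropy M (\<lambda>x. (X x, ())) + label_entropy M (\<lambda>x. (Y x, ()))"
    by (rule label_entropy_strong_subadditive[OF X Y]) auto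
  moreover have "label_entropy M (\<lambda>x. (X x, Y x, ())) = label_entropy M (\<lambda>x. (X x, Y x))"
    "label_entropy M (\<lambda>x. (X x, ())) = label_entropy M X"
    "label_entropy M (\<lambda>x. (Y x, ())) = label_entropy M Y"
    by (rule label_entropy_cong; auto)+
  ultimately show ?thesis by (simp add: label_entropy_const)
qed

text \<open>Strong subadditivity with \<open>X\<close> taken twice: the triple
  \<open>(X, X, Y)\<close> has the same fibres as the pair \<open>(X, Y)\<close>.\<close>

lemma label_entropy_le_pair:
  assumes X: "simple_function M X" and Y: "simple_function M Y"
  shows "label_entropy M Y \<le> label_entropy M (\<lambda>x. (X x, Y x))"
proof -
  have "label_entropy M (\<lambda>x. (X x, X x, Y x)) + label_entropy M Y
    \<le> label_entropy M (\<lambda>x. (X x, Y x)) + label_entropy M (\<lambda>x. (X x, Y x))"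
    by (rule label_entropy_strong_subadditive[OF X X Y])
  moreover have "label_entropy M (\<lambda>x. (X x, X x, Y x)) = label_entropy M (\<lambda>x. (X x, Y x))"
    by (rule label_entropy_cong) auto
  ultimately show ?thesis by simp
qed

lemma label_entropy_le_refine:
  assumes X: "simple_function M X" and Y: "simple_function M Y"
    and "\<And>x y. x \<in> space M \<Longrightarrow> y \<in> space M \<Longrightarrow> X x = X y \<Longrightarrow> Y x = Y y"
  shows "label_entropy M Y \<le> label_entropy M X"
proof -
  have "label_entropy M (\<lambda>x. (X x, Y x)) = label_entropy M X"
  proof (rule label_entropy_cong)
    fix x y assume "x \<in> space M" "y \<in> space M"
    from assms(3)[OF this] show "(X x, Y x) = (X y, Y y) \<longleftrightarrow> X x = X y" by auto
  qed
  then show ?thesis using label_entropy_le_pair[OF X Y] by simp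
qed

end

section \<open>Entropy of itineraries under a measure-preserving map\<close>

definition itinerary :: "('a \<Rightarrow> 'a) \<Rightarrow> ('a \<Rightarrow> 'b) \<Rightarrow> nat \<Rightarrow> 'a \<Rightarrow> 'b list" where
  "itinerary T F n x = map (\<lambda>i. F ((T ^^ i) x)) [0..<n]"

lemma itinerary_eq_iff:
  "itinerary T F n x = itinerary T F n y \<longleftrightarrow> (\<forall>i<n. F ((T ^^ i) x) = F ((T ^^ i) y))"
  by (auto simp: itinerary_def)

lemma itinerary_Suc: "itinerary T F (Suc n) x = itinerary T F n x @ [F ((T ^^ n) x)]"
  by (simp add: itinerary_def)

locale measure_preserving = prob_space M for M :: "'a measure" +
  fixes T :: "'a \<Rightarrow> 'a"
  assumes measurable_T: "T \<in> measurable M M"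
    and distr_T: "distr M M T = M"
begin

lemma measurable_T_power: "T ^^ k \<in> measurable M M"
  by (rule measurable_compose_n[OF measurable_T])

lemma distr_T_power: "distr M M (T ^^ k) = M"
proof (induction k)
  case 0 then show ?case by (simp add: distr_id2 id_def)
next
  case (Suc k)
  have "distr M M (T ^^ Suc k) = distr (distr M M (T ^^ k)) M T"
    using measurable_T measurable_T_power by (subst distr_distr) (auto simp: o_def)
  also have "\<dots> = M" using Suc distr_T by simp
  finally show ?case .
qed

lemma prob_vimage_T_power:
  assumes "A \<in> events" shows "prob ((T ^^ k) -` A \<inter> space M) = prob A"
proof -
  have "measure (distr M M (T ^^ k)) A = prob ((T ^^ k) -` A \<inter> space M)"
    by (rule measure_distr[OF measurable_T_power assms])
  then show ?thesis using distr_T_power by simp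
qed

lemma space_T_power: "x \<in> space M \<Longrightarrow> (T ^^ k) x \<in> space M"
  using measurable_space[OF measurable_T_power] .

lemma simple_function_T_power:
  assumes "simple_function M F" shows "simple_function M (\<lambda>x. F ((T ^^ k) x))"
  using simple_function_comp[OF measurable_T_power assms] by (simp add: comp_def)

lemma simple_function_itinerary:
  assumes F: "simple_function M F" shows "simple_function M (itinerary T F n)"
proof (induction n)
  case 0
  then show ?case by (simp add: itinerary_def[abs_def])
next
  case (Suc n)
  have "simple_function M ((\<lambda>(l, a). l @ [a]) \<circ> (\<lambda>x. (itinerary T F n x, F ((T ^^ n) x))))"
    by (intro simple_function_compose simple_function_Pair Suc simple_function_T_power F)
  then show ?case by (simp add: itinerary_Suc[abs_def] o_def)
qed

lemma label_entropy_T_power: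
  assumes F: "simple_function M F" shows "label_entropy M (\<lambda>x. F ((T ^^ k) x)) = label_entropy M F"
proof -
  have eq: "prob ((\<lambda>x. F ((T ^^ k) x)) -` {y} \<inter> space M) = prob (F -` {y} \<inter> space M)" for y
  proof -
    have "(\<lambda>x. F ((T ^^ k) x)) -` {y} \<inter> space M = (T ^^ k) -` (F -` {y} \<inter> space M) \<inter> space M"
      using space_T_power by auto
    then show ?thesis using prob_vimage_T_power[OF simple_functionD(2)[OF F]] by (simp only:)
  qed
  show ?thesis
    by (subst (1 2) label_entropy_superset[of "F ` space M"])
      (use F space_T_power in \<open>auto dest: simple_functionD simp: eq\<close>)
qed

text \<open>The first \<open>m\<close> labels and the last \<open>n\<close> labels together make up
  the itinerary, and by invariance the last \<open>n\<close> have the entropy of the first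
  \<open>n\<close>.\<close>

lemma label_entropy_itinerary_subadditive:
  assumes F: "simple_function M F"
  shows "label_entropy M (itinerary T F (m + n)) \<le>
    label_entropy M (itinerary T F m) + label_entropy M (itinerary T F n)"
proof -
  have "label_entropy M (itinerary T F (m + n)) =
      label_entropy M (\<lambda>x. (itinerary T F m x, itinerary T F n ((T ^^ m) x)))"
  proof (rule label_entropy_cong)
    fix x y
    have "(\<forall>i<m + n. P i) \<longleftrightarrow> (\<forall>i<m. P i) \<and> (\<forall>i<n. P (i + m))" for P
      by (metis add.commute add_less_cancel_left le_Suc_ex linorder_not_le trans_less_add1)
    from this[of "\<lambda>i. F ((T ^^ i) x) = F ((T ^^ i) y)"]
    show "itinerary T F (m + n) x = itinerary T F (m + n) y \<longleftrightarrow>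
      (itinerary T F m x, itinerary T F n ((T ^^ m) x)) = (itinerary T F m y, itinerary T F n ((T ^^ m) y))"
      by (simp add: itinerary_eq_iff funpow_add)
  qed
  also have "\<dots> \<le> label_entropy M (itinerary T F m) + label_entropy M (\<lambda>x. itinerary T F n ((T ^^ m) x))"
    by (intro label_entropy_subadditive simple_function_T_power simple_function_itinerary F)
  finally show ?thesis by (simp add: label_entropy_T_power simple_function_itinerary F)
qed

text \<open>The dynamical entropy of the partition into fibres of \<open>F\<close>, written as the
  infimum that Fekete's lemma identifies with the limit.\<close>

definition itinerary_entropy :: "('a \<Rightarrow> 'b) \<Rightarrow> real" where
  "itinerary_entropy F = (INF n\<in>{1..}. label_entropy M (itinerary T F n) / real n)"

lemma itinerary_entropy_limit:
  assumes F: "simple_function M F"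
  shows "(\<lambda>n. label_entropy M (itinerary T F n) / real n) \<longlonglongrightarrow> itinerary_entropy F"
    and "n \<ge> 1 \<Longrightarrow> itinerary_entropy F \<le> label_entropy M (itinerary T F n) / real n"
  unfolding itinerary_entropy_def
  by (rule subadditive_limit[OF label_entropy_itinerary_subadditive[OF F] label_entropy_nonneg], assumption?)+

text \<open>In conditional terms: given the \<open>Q\<close>-itinerary, the
  \<open>F\<close>-itinerary of length \<open>n\<close> costs at most \<open>n\<close> times the
  entropy of \<open>F\<close> given \<open>Q\<close>. Each new letter of \<open>F\<close> is charged
  against the letter of \<open>Q\<close> at the same time.\<close>

lemma label_entropy_itinerary_conditional:
  assumes F: "simple_function M F" and Q: "simple_function M Q"
  shows "label_entropy M (\<lambda>x. (itinerary T F n x, itinerary T Q n x)) - label_entropy M (itinerary T Q n)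
    \<le> n * (label_entropy M (\<lambda>x. (F x, Q x)) - label_entropy M Q)"
proof (induction n)
  case 0
  then show ?case by (simp add: itinerary_def[abs_def] label_entropy_const)
next
  case (Suc n)
  define A B f q where "A = itinerary T F n" and "B = itinerary T Q n"
    and "f = (\<lambda>x. F ((T ^^ n) x))" and "q = (\<lambda>x. Q ((T ^^ n) x))"
  have A: "simple_function M A" and B: "simple_function M B" and f: "simple_function M f" and q: "simple_function M q"
    unfolding A_def B_def f_def q_def by (intro simple_function_itinerary simple_function_T_power F Q)+
  have Bq: "simple_function M (\<lambda>x. (B x, q x))" by (intro simple_function_Pair B q)
  \<comment> \<open>Given \<open>(B, q)\<close>, the pair \<open>(A, f)\<close> costs at most
    \<open>A\<close> plus \<open>f\<close>; knowing \<open>q\<close> besides \<open>B\<close> does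
    not raise the cost of \<open>A\<close>; knowing \<open>B\<close> besides \<open>q\<close> does
    not raise the cost of \<open>f\<close>.\<close>
  note 1 = label_entropy_strong_subadditive[OF A f Bq]
  note 2 = label_entropy_strong_subadditive[OF A q B]
  note 3 = label_entropy_strong_subadditive[OF f B q]
  have "label_entropy M (\<lambda>x. (A x, q x, B x)) = label_entropy M (\<lambda>x. (A x, B x, q x))"
    "label_entropy M (\<lambda>x. (q x, B x)) = label_entropy M (\<lambda>x. (B x, q x))"
    by (rule label_entropy_cong; auto)+
  moreover have "label_entropy M (itinerary T Q (Suc n)) = label_entropy M (\<lambda>x. (B x, q x))"
    unfolding B_def q_def by (rule label_entropy_cong) (auto simp: itinerary_Suc)
  moreover have "label_entropy M (\<lambda>x. (itinerary T F (Suc n) x, itinerary T Q (Suc n) x)) =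
      label_entropy M (\<lambda>x. (A x, f x, B x, q x))"
    unfolding A_def f_def B_def q_def by (rule label_entropy_cong) (auto simp: itinerary_Suc)
  moreover have "label_entropy M (\<lambda>x. (f x, q x)) = label_entropy M (\<lambda>x. (F x, Q x))"
    unfolding f_def q_def
    using label_entropy_T_power[OF simple_function_Pair[OF F Q], of n] by simp
  moreover have "label_entropy M q = label_entropy M Q"
    unfolding q_def by (rule label_entropy_T_power[OF Q])
  ultimately show ?case using Suc 1 2 3 by (simp add: A_def B_def algebra_simps)
qed

text \<open>This measures how far the dynamical entropy can move when a labelling is replaced by an
  approximation; it is the previous bound divided by \<open>n\<close>.\<close>

lemma itinerary_entropy_conditional:
  assumes F: "simple_function M F" and Q: "simple_function M Q"
  shows "itinerary_entropy F \<le> itinerary_entropy Q + (label_entropy M (\<lambda>x. (F x, Q x)) - label_entropy M Q)"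
proof (rule LIMSEQ_le[OF itinerary_entropy_limit(1)[OF F]])
  let ?d = "label_entropy M (\<lambda>x. (F x, Q x)) - label_entropy M Q"
  show "(\<lambda>n. label_entropy M (itinerary T Q n) / real n + ?d) \<longlonglongrightarrow> itinerary_entropy Q + ?d"
    by (intro tendsto_add itinerary_entropy_limit(1)[OF Q] tendsto_const)
  have "label_entropy M (itinerary T F n) / real n \<le> label_entropy M (itinerary T Q n) / real n + ?d"
    if "n \<ge> 1" for n
  proof -
    have "label_entropy M (itinerary T F n) \<le> label_entropy M (\<lambda>x. (itinerary T F n x, itinerary T Q n x))"
      by (rule label_entropy_le_refine) (auto intro!: simple_function_Pair simple_function_itinerary F Q)
    then have "label_entropy M (itinerary T F n) \<le> label_entropy M (itinerary T Q n) + n * ?d"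
      using label_entropy_itinerary_conditional[OF F Q, of n] by linarith
    then show ?thesis using that by (simp add: field_simps)
  qed
  then show "\<exists>N. \<forall>n\<ge>N. label_entropy M (itinerary T F n) / real n
      \<le> label_entropy M (itinerary T Q n) / real n + ?d" by blast
qed

end

section \<open>Entropy of invariant measures\<close>

lemma (in prob_space) abs_prob_diff_le:
  assumes "A \<in> events" "B \<in> events" "E \<in> events" "A \<subseteq> B \<union> E" "B \<subseteq> A \<union> E"
  shows "\<bar>prob A - prob B\<bar> \<le> prob E"
proof -
  have "prob A \<le> prob (B \<union> E)" "prob B \<le> prob (A \<union> E)"
    using assms by (auto intro!: finite_measure_mono)
  moreover have "prob (B \<union> E) \<le> prob B + prob E" "prob (A \<union> E) \<le> prob A + prob E"
    using assms by (auto intro!: measure_Un_le)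
  ultimately show ?thesis by linarith
qed

text \<open>All fibre probabilities of \<open>(F, Q m)\<close> and of \<open>Q m\<close> converge to
  those of \<open>(F, F)\<close> and of \<open>F\<close>, whose entropies agree. The common bound
  \<open>l\<close> on the labels keeps the index set of the sums fixed, so continuity of
  \<open>x * ln x\<close> suffices.\<close>

lemma (in prob_space) conditional_entropy_tendsto_0:
  fixes F :: "'a \<Rightarrow> nat" and Q :: "nat \<Rightarrow> 'a \<Rightarrow> nat"
  assumes F: "simple_function M F" and Q: "\<And>m. simple_function M (Q m)"
    and bound: "\<And>x. x \<in> space M \<Longrightarrow> F x \<le> l" "\<And>m x. x \<in> space M \<Longrightarrow> Q m x \<le> l"
    and lim: "(\<lambda>m. prob {x \<in> space M. F x \<noteq> Q m x}) \<longlonglongrightarrow> 0"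
  shows "(\<lambda>m. label_entropy M (\<lambda>x. (F x, Q m x)) - label_entropy M (Q m)) \<longlonglongrightarrow> 0"
proof -
  have sf: "f -` {i} \<inter> space M \<in> events" if "simple_function M f" for f :: "'a \<Rightarrow> 'c" and i
    using that by (rule simple_functionD)
  define E where "E m = {x \<in> space M. F x \<noteq> Q m x}" for m
  have E: "E m \<in> events" for m
  proof -
    have "simple_function M (\<lambda>x. F x \<noteq> Q m x)" by (rule simple_function_compose2[OF F Q])
    from sf[OF this, of True] have "(\<lambda>x. F x \<noteq> Q m x) -` {True} \<inter> space M \<in> events" .
    moreover have "(\<lambda>x. F x \<noteq> Q m x) -` {True} \<inter> space M = E m" unfolding E_def by auto
    ultimately show ?thesis by (simp only:)
  qed
  have tendsto: "(\<lambda>m. prob (A m)) \<longlonglongrightarrow> prob B"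
    if "\<And>m. A m \<in> events" "B \<in> events" "\<And>m. A m \<subseteq> B \<union> E m" "\<And>m. B \<subseteq> A m \<union> E m" for A B
  proof (rule LIM_zero_cancel, rule Lim_null_comparison)
    show "(\<lambda>m. prob (E m)) \<longlonglongrightarrow> 0" using lim by (simp add: E_def)
    show "\<forall>\<^sub>F m in sequentially. norm (prob (A m) - prob B) \<le> prob (E m)"
      using abs_prob_diff_le[OF that(1,2) E that(3,4)] by simp
  qed
  have pair: "(\<lambda>m. prob ((\<lambda>x. (F x, Q m x)) -` {y} \<inter> space M)) \<longlonglongrightarrow>
      prob ((\<lambda>x. (F x, F x)) -` {y} \<inter> space M)" for y
    by (rule tendsto) (intro sf simple_function_Pair F Q | force simp: E_def)+
  have single: "(\<lambda>m. prob (Q m -` {y} \<inter> space M)) \<longlonglongrightarrow> prob (F -` {y} \<inter> space M)" for y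
    by (rule tendsto) (intro sf simple_function_Pair F Q | force simp: E_def)+
  have "(\<lambda>m. label_entropy M (\<lambda>x. (F x, Q m x)) - label_entropy M (Q m)) \<longlonglongrightarrow>
      label_entropy M (\<lambda>x. (F x, F x)) - label_entropy M F"
  proof (intro tendsto_diff)
    have "label_entropy M (\<lambda>x. (F x, Q m x)) = - (\<Sum>y\<in>{..l} \<times> {..l}.
        prob ((\<lambda>x. (F x, Q m x)) -` {y} \<inter> space M) * ln (prob ((\<lambda>x. (F x, Q m x)) -` {y} \<inter> space M)))" for m
      by (rule label_entropy_superset) (use bound in auto)
    moreover have "label_entropy M (\<lambda>x. (F x, F x)) = - (\<Sum>y\<in>{..l} \<times> {..l}.
        prob ((\<lambda>x. (F x, F x)) -` {y} \<inter> space M) * ln (prob ((\<lambda>x. (F x, F x)) -` {y} \<inter> space M)))"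
      by (rule label_entropy_superset) (use bound in auto)
    ultimately show "(\<lambda>m. label_entropy M (\<lambda>x. (F x, Q m x))) \<longlonglongrightarrow> label_entropy M (\<lambda>x. (F x, F x))"
      by (simp only:) (intro tendsto_minus tendsto_sum tendsto_x_ln_x pair measure_nonneg)
    have "label_entropy M (Q m) = - (\<Sum>y\<in>{..l}.
        prob (Q m -` {y} \<inter> space M) * ln (prob (Q m -` {y} \<inter> space M)))" for m
      by (rule label_entropy_superset) (use bound in auto)
    moreover have "label_entropy M F = - (\<Sum>y\<in>{..l}.
        prob (F -` {y} \<inter> space M) * ln (prob (F -` {y} \<inter> space M)))"
      by (rule label_entropy_superset) (use bound in auto)
    ultimately show "(\<lambda>m. label_entropy M (Q m)) \<longlonglongrightarrow> label_entropy M F"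
      by (simp only:) (intro tendsto_minus tendsto_sum tendsto_x_ln_x single measure_nonneg)
  qed
  moreover have "label_entropy M (\<lambda>x. (F x, F x)) = label_entropy M F"
    by (rule label_entropy_cong) auto
  ultimately show ?thesis by simp
qed

context measure_preserving
begin

lemma itinerary_entropy_le_refine:
  assumes X: "simple_function M X" and Y: "simple_function M Y"
    and refine: "\<And>x y. x \<in> space M \<Longrightarrow> y \<in> space M \<Longrightarrow> X x = X y \<Longrightarrow> Y x = Y y"
  shows "itinerary_entropy Y \<le> itinerary_entropy X"
proof (rule LIMSEQ_le[OF itinerary_entropy_limit(1)[OF Y] itinerary_entropy_limit(1)[OF X]])
  have "label_entropy M (itinerary T Y n) \<le> label_entropy M (itinerary T X n)" for n
  proof (rule label_entropy_le_refine)
    fix x y assume "x \<in> space M" "y \<in> space M" "itinerary T X n x = itinerary T X n y"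
    then show "itinerary T Y n x = itinerary T Y n y"
      unfolding itinerary_eq_iff using refine space_T_power by blast
  qed (intro simple_function_itinerary X Y)+
  then show "\<exists>N. \<forall>n\<ge>N. label_entropy M (itinerary T Y n) / real n \<le> label_entropy M (itinerary T X n) / real n"
    by (auto intro!: divide_right_mono)
qed

section \<open>Finite partitions as labellings\<close>

definition cell_of :: "'a set set \<Rightarrow> 'a \<Rightarrow> 'a set" where
  "cell_of P x = (THE A. A \<in> P \<and> x \<in> A)"

lemma cell_of_eq:
  assumes "partition_on (space M) P" "A \<in> P" "x \<in> A" shows "cell_of P x = A"
  unfolding cell_of_def
  using assms by (intro the_equality) (auto simp: partition_on_def disjoint_def)

lemma cell_of_in:
  assumes "partition_on (space M) P" "x \<in> space M" shows "cell_of P x \<in> P" "x \<in> cell_of P x"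
proof -
  obtain A where "A \<in> P" "x \<in> A" using assms by (auto simp: partition_on_def)
  then show "cell_of P x \<in> P" "x \<in> cell_of P x" using cell_of_eq[OF assms(1)] by auto
qed

lemma simple_function_cell_of:
  assumes P: "partition_on (space M) P" "finite P" "P \<subseteq> events"
  shows "simple_function M (cell_of P)"
  unfolding simple_function_def
proof (intro conjI ballI)
  show "finite (cell_of P ` space M)"
    by (rule finite_subset[OF _ P(2)]) (use cell_of_in[OF P(1)] in auto)
  fix A assume "A \<in> cell_of P ` space M"
  then have A: "A \<in> P" using cell_of_in[OF P(1)] by auto
  have "cell_of P -` {A} \<inter> space M = A"
  proof (intro subset_antisym subsetI)
    fix x assume "x \<in> cell_of P -` {A} \<inter> space M" then show "x \<in> A" using cell_of_in(2)[OF P(1)] by auto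
  next
    fix x assume x: "x \<in> A"
    then have "x \<in> space M" using A P(1) by (auto simp: partition_on_def)
    then show "x \<in> cell_of P -` {A} \<inter> space M" using cell_of_eq[OF P(1) A x] by auto
  qed
  then show "cell_of P -` {A} \<inter> space M \<in> events" using A P by auto
qed

text \<open>A nonempty cell is determined by any point \<open>x\<close> in it: the factor coming
  from \<open>P\<close> must be the cell of \<open>(T ^^ n) x\<close>, and the other factor the
  fibre of \<open>x\<close> at the previous stage. The empty set, which the join may produce, is
  removed.\<close>

lemma refinement_eq:
  assumes P: "partition_on (space M) P"
  shows "refinement (space M) T P n - {{}} =
    (\<lambda>x. itinerary T (cell_of P) n -` {itinerary T (cell_of P) n x} \<inter> space M) ` space M"
    (is "_ = ?C n ` _")
proof (induction n)
  case 0
  show ?case by (auto simp: itinerary_def)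
next
  case (Suc n)
  have step: "?C (Suc n) x = ?C n x \<inter> ((T ^^ n) -` (cell_of P ((T ^^ n) x)) \<inter> space M)" if x: "x \<in> space M" for x
  proof -
    have "y \<in> ?C (Suc n) x \<longleftrightarrow> y \<in> ?C n x \<and> (T ^^ n) y \<in> cell_of P ((T ^^ n) x)" if y: "y \<in> space M" for y
    proof -
      have "cell_of P ((T ^^ n) y) = cell_of P ((T ^^ n) x) \<longleftrightarrow> (T ^^ n) y \<in> cell_of P ((T ^^ n) x)"
        using cell_of_in[OF P space_T_power[OF y, of n]] cell_of_in[OF P space_T_power[OF x, of n]]
          cell_of_eq[OF P] by metis
      then show ?thesis using y by (auto simp: itinerary_Suc)
    qed
    then show ?thesis by blast
  qed
  show ?case
  proof (intro subset_antisym subsetI)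
    fix D assume "D \<in> refinement (space M) T P (Suc n) - {{}}"
    then obtain A B x where AB: "D = A \<inter> ((T ^^ n) -` B \<inter> space M)" "A \<in> refinement (space M) T P n" "B \<in> P"
      and x: "x \<in> D" by auto
    then have "A \<in> refinement (space M) T P n - {{}}" by auto
    then obtain z where z: "A = ?C n z" using Suc by auto
    have xs: "x \<in> space M" using x AB by auto
    have "A = ?C n x" using z x AB(1) by auto
    moreover have "B = cell_of P ((T ^^ n) x)" using x AB cell_of_eq[OF P] by auto
    ultimately have "D = ?C (Suc n) x" using step[OF xs] AB(1) by simp
    then show "D \<in> ?C (Suc n) ` space M" using xs by (rule image_eqI)
  next
    fix D assume "D \<in> ?C (Suc n) ` space M"
    then obtain x where x: "x \<in> space M" "D = ?C (Suc n) x" by auto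
    have "?C n x \<in> refinement (space M) T P n" using Suc x(1) by blast
    moreover have "cell_of P ((T ^^ n) x) \<in> P" by (intro cell_of_in P space_T_power x)
    ultimately have "D \<in> refinement (space M) T P (Suc n)" using step[OF x(1)] x(2) by auto
    moreover have "x \<in> D" using x by auto
    ultimately show "D \<in> refinement (space M) T P (Suc n) - {{}}" by auto
  qed
qed

text \<open>A possible empty cell contributes \<open>0 * ln 0 = 0\<close>, and the other cells are
  the fibres of the itinerary of \<open>cell_of P\<close>.\<close>

lemma partition_entropy_refinement:
  assumes P: "partition_on (space M) P" "finite P" "P \<subseteq> events"
  shows "partition_entropy M (refinement (space M) T P n) = label_entropy M (itinerary T (cell_of P) n)"
proof -
  let ?I = "itinerary T (cell_of P) n"
  have fin: "finite (refinement (space M) T P n)"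
  proof (induction n)
    case (Suc n)
    have "refinement (space M) T P (Suc n) =
        (\<lambda>(A, B). A \<inter> ((T ^^ n) -` B \<inter> space M)) ` (refinement (space M) T P n \<times> P)" by auto
    then show ?case using Suc P(2) by simp
  qed simp
  have "partition_entropy M (refinement (space M) T P n) =
      - (\<Sum>A\<in>refinement (space M) T P n - {{}}. prob A * ln (prob A))"
    unfolding partition_entropy_def using fin by (subst sum.mono_neutral_right[where S = "refinement (space M) T P n - {{}}"]) auto
  also have "refinement (space M) T P n - {{}} = (\<lambda>l. ?I -` {l} \<inter> space M) ` ?I ` space M"
    unfolding refinement_eq[OF P(1)] image_image ..
  also have "- (\<Sum>A\<in>(\<lambda>l. ?I -` {l} \<inter> space M) ` ?I ` space M. prob A * ln (prob A)) = label_entropy M ?I"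
    unfolding label_entropy_def by (subst sum.reindex) (auto simp: inj_on_def)
  finally show ?thesis .
qed

lemma partition_entropy_rate:
  assumes P: "partition_on (space M) P" "finite P" "P \<subseteq> events"
  shows "lim (\<lambda>n. partition_entropy M (refinement (space M) T P n) / real n) = itinerary_entropy (cell_of P)"
  unfolding partition_entropy_refinement[OF P]
  by (rule limI[OF itinerary_entropy_limit(1)[OF simple_function_cell_of[OF P]]])

end

section \<open>Entropy of the shift and the generating partition\<close>

context graph_shift
begin

lemma invariant_measure_preserving:
  assumes "M \<in> invariant_measures G" shows "measure_preserving M shift"
proof -
  interpret prob_space M using assms by (intro prob_space_prob_measures invariant_imp_prob)
  note sets = sets_prob_measures[OF invariant_imp_prob[OF assms]]
  have "shift \<in> measurable M M"
    using measurable_shift measurable_cong_sets[OF sets sets] by simp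
  then show ?thesis
    using assms by unfold_locales (auto simp: invariant_measures_def)
qed

definition word_entropy :: "(nat \<Rightarrow> 'e) measure \<Rightarrow> nat \<Rightarrow> real" where
  "word_entropy M n = - (\<Sum>w\<in>words G n. measure M (cyl G w) * ln (measure M (cyl G w)))"

lemma initial_vimage:
  assumes "M \<in> prob_measures G"
  shows "initial n -` {w} \<inter> space M = (if length w = n then cyl G w else {})"
  using space_prob_measures[OF assms] by (auto simp: cyl_eq)

lemma simple_function_initial:
  assumes M: "M \<in> prob_measures G" shows "simple_function M (initial n)"
  unfolding simple_function_def
proof (intro conjI ballI)
  show "finite (initial n ` space M)"
    by (rule finite_subset[OF _ finite_words'[of n]]) (auto simp: space_prob_measures[OF M] initial_in_words)
qed (simp add: initial_vimage[OF M] sets_prob_measures[OF M])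

lemma label_entropy_initial:
  assumes M: "M \<in> prob_measures G" shows "label_entropy M (initial n) = word_entropy M n"
  unfolding word_entropy_def
  by (subst label_entropy_superset[of "words G n"])
    (auto simp: space_prob_measures[OF M] initial_in_words length_words
      initial_vimage[OF M, unfolded space_prob_measures[OF M]] intro!: sum.cong)

lemma itinerary_first: "itinerary shift (\<lambda>u. u 0) n = initial n"
  by (auto simp: itinerary_def initial_def shift_power_apply fun_eq_iff)

lemma simple_function_first:
  assumes M: "M \<in> prob_measures G" shows "simple_function M (\<lambda>u. u 0)"
proof -
  have "simple_function M (hd \<circ> initial 1)" by (intro simple_function_compose simple_function_initial M)
  then show ?thesis by (simp add: o_def initial_def)
qed

text \<open>Induction over the generated sigma-algebra. For a countable union, finitely many members
  exhaust the measure up to \<open>e/2\<close>, and each of these is replaced by an approximation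
  from the algebra.\<close>

lemma cylset_approx:
  assumes M: "M \<in> prob_measures G" and A: "A \<in> sets M" and e: "e > 0"
  shows "\<exists>C\<in>cylsets. measure M ((A - C) \<union> (C - A)) < e"
proof -
  interpret prob_space M using M by (rule prob_space_prob_measures)
  interpret alg: algebra "paths G" cylsets by (rule algebra_cylsets)
  have cyls: "C \<in> cylsets \<Longrightarrow> C \<in> events" for C by (simp add: cylsets_sets sets_prob_measures[OF M])
  have events: "events = sigma_sets (paths G) cylsets"
    using sets_prob_measures[OF M] sets_path_borel by simp
  have "A \<in> sigma_sets (paths G) cylsets" using A events by simp
  then show ?thesis using e
  proof (induction arbitrary: e)
    case (Basic a)
    then show ?case by (intro bexI[of _ a]) auto
  next
    case Empty
    then show ?case by (intro bexI[of _ "{}"]) auto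
  next
    case (Compl a)
    then obtain C where C: "C \<in> cylsets" "prob ((a - C) \<union> (C - a)) < e" by blast
    have "a \<subseteq> paths G" using Compl.hyps sigma_sets_into_sp[OF alg.space_closed] by auto
    then have "((paths G - a) - (paths G - C)) \<union> ((paths G - C) - (paths G - a)) = (a - C) \<union> (C - a)"
      using alg.sets_into_space[OF C(1)] by auto
    then show ?case using C by (intro bexI[of _ "paths G - C"]) auto
  next
    case (Union a)
    have a: "a i \<in> events" for i using Union.hyps events by auto
    have "(\<lambda>m. prob (\<Union>i<m. a i)) \<longlonglongrightarrow> prob (\<Union>m. \<Union>i<m. a i)"
    proof (rule finite_Lim_measure_incseq)
      show "incseq (\<lambda>m. \<Union>i<m. a i)" by (intro monoI UN_mono) auto
    qed (use a in auto)
    moreover have "(\<Union>m. \<Union>i<m. a i) = (\<Union>i. a i)" by auto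
    ultimately have "\<forall>\<^sub>F m in sequentially. prob (\<Union>i. a i) - e/2 < prob (\<Union>i<m. a i)"
      using Union.prems by (intro order_tendstoD) auto
    then obtain m where m: "prob (\<Union>i. a i) - e/2 < prob (\<Union>i<m. a i)"
      by (auto simp: eventually_sequentially)
    have "prob ((\<Union>i. a i) - (\<Union>i<m. a i)) = prob (\<Union>i. a i) - prob (\<Union>i<m. a i)"
      using a by (intro finite_measure_Diff) auto
    then have tail: "prob ((\<Union>i. a i) - (\<Union>i<m. a i)) < e/2" using m by simp
    \<comment> \<open>The \<open>m\<close> errors sum to at most \<open>e/2\<close>; adding 1 in the
      denominator covers \<open>m = 0\<close>.\<close>
    have "\<exists>C\<in>cylsets. prob ((a i - C) \<union> (C - a i)) < e / (2 * (m + 1))" for i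
      using Union.IH[of "e / (2 * (m + 1))"] Union.prems by simp
    then obtain C where C: "\<And>i. C i \<in> cylsets" "\<And>i. prob ((a i - C i) \<union> (C i - a i)) < e / (2 * (m + 1))"
      by metis
    have Cm: "(\<Union>i<m. C i) \<in> cylsets" using C(1) by (intro alg.finite_UN) auto
    let ?D = "\<lambda>i. (a i - C i) \<union> (C i - a i)"
    have D: "?D i \<in> events" for i using a cyls[OF C(1)] by auto
    have "prob (((\<Union>i. a i) - (\<Union>i<m. C i)) \<union> ((\<Union>i<m. C i) - (\<Union>i. a i)))
        \<le> prob (((\<Union>i. a i) - (\<Union>i<m. a i)) \<union> (\<Union>i<m. ?D i))"
      using a cyls[OF C(1)] by (intro finite_measure_mono) auto
    also have "\<dots> \<le> prob ((\<Union>i. a i) - (\<Union>i<m. a i)) + prob (\<Union>i<m. ?D i)"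
      using a D by (intro measure_Un_le) auto
    also have "prob (\<Union>i<m. ?D i) \<le> (\<Sum>i<m. prob (?D i))"
      using D by (intro finite_measure_subadditive_finite) auto
    also have "\<dots> \<le> (\<Sum>i<m. e / (2 * (m + 1)))"
      using C(2) by (intro sum_mono less_imp_le) auto
    also have "\<dots> \<le> e/2" using Union.prems by (simp add: field_simps)
    finally show ?case using tail Cm by (intro bexI[of _ "\<Union>i<m. C i"]) auto
  qed
qed

text \<open>Membership in \<open>C\<close> can be read off from the cylinder of any sufficiently
  long prefix; this is what makes an approximating labelling a function of the prefix.\<close>

lemma cylset_cyl_subset_iff:
  assumes "C \<in> cylsets"
  obtains k where "\<And>j u. j \<ge> k \<Longrightarrow> u \<in> paths G \<Longrightarrow> cyl G (initial j u) \<subseteq> C \<longleftrightarrow> u \<in> C"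
proof -
  obtain k where k: "\<forall>u\<in>C. \<forall>v\<in>paths G. initial k v = initial k u \<longrightarrow> v \<in> C"
    using assms unfolding cylsets_def by blast
  have "cyl G (initial j u) \<subseteq> C \<longleftrightarrow> u \<in> C" if "j \<ge> k" "u \<in> paths G" for j u
    using k that initial_mono[of j _ u k] by (auto simp: cyl_initial)
  then show ?thesis using that by blast
qed

text \<open>The partition into cylinders of length one generates, so it attains the entropy.\<close>

lemma itinerary_entropy_le_first:
  fixes F :: "(nat \<Rightarrow> 'e) \<Rightarrow> nat"
  assumes M: "M \<in> invariant_measures G" and F: "simple_function M F"
    and bound: "\<And>u. u \<in> paths G \<Longrightarrow> F u < l"
  shows "measure_preserving.itinerary_entropy M shift F \<le> measure_preserving.itinerary_entropy M shift (\<lambda>u. u 0)"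
proof -
  interpret measure_preserving M shift using M by (rule invariant_measure_preserving)
  note P = invariant_imp_prob[OF M]
  note sp = space_prob_measures[OF P]
  \<comment> \<open>The itinerary of length \<open>n\<close> of the labels \<open>initial k\<close>
    is determined by \<open>n + k\<close> letters, and the surplus of \<open>k\<close> letters
    vanishes after division by \<open>n\<close>.\<close>
  have init: "itinerary_entropy (initial k) \<le> itinerary_entropy (\<lambda>u. u 0)" for k
  proof (rule LIMSEQ_le[OF itinerary_entropy_limit(1)[OF simple_function_initial[OF P]]])
    show "(\<lambda>n. label_entropy M (initial n) / n + label_entropy M (initial k) / n) \<longlonglongrightarrow>
        itinerary_entropy (\<lambda>u. u 0)"
      using tendsto_add[OF itinerary_entropy_limit(1)[OF simple_function_first[OF P]]
          lim_const_over_n[of "label_entropy M (initial k)"]] by (simp add: itinerary_first)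
    have "label_entropy M (itinerary shift (initial k) n) \<le> label_entropy M (initial n) + label_entropy M (initial k)" for n
    proof -
      have "label_entropy M (itinerary shift (initial k) n) \<le> label_entropy M (initial (n + k))"
        by (rule label_entropy_le_refine)
          (auto simp: simple_function_itinerary simple_function_initial P itinerary_eq_iff initial_eq_iff shift_power_apply)
      then show ?thesis
        using label_entropy_itinerary_subadditive[OF simple_function_first[OF P], of n k]
        by (simp add: itinerary_first)
    qed
    then show "\<exists>N. \<forall>n\<ge>N. label_entropy M (itinerary shift (initial k) n) / real n
        \<le> label_entropy M (initial n) / n + label_entropy M (initial k) / n"
      by (auto simp: add_divide_distrib[symmetric] intro!: divide_right_mono)
  qed
  define A where "A i = F -` {i} \<inter> space M" for i
  have A: "A i \<in> events" for i unfolding A_def by (rule simple_functionD(2)[OF F])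
  have "\<exists>C\<in>cylsets. prob ((A i - C) \<union> (C - A i)) < 1 / Suc m" for i m
    by (rule cylset_approx[OF P A]) auto
  then obtain C where C: "\<And>i m. C i m \<in> cylsets"
    "\<And>i m. prob ((A i - C i m) \<union> (C i m - A i)) < 1 / Suc m" by metis
  have cyls: "C i m \<in> events" for i m by (simp add: C cylsets_sets sets_prob_measures[OF P])
  have "\<exists>k. \<forall>i<l. \<forall>u\<in>paths G. cyl G (initial k u) \<subseteq> C i m \<longleftrightarrow> u \<in> C i m" for m
  proof -
    have "\<exists>k. \<forall>j\<ge>k. \<forall>u\<in>paths G. cyl G (initial j u) \<subseteq> C i m \<longleftrightarrow> u \<in> C i m" for i
      using cylset_cyl_subset_iff[OF C(1)[of i m]] by metis
    then obtain k where k: "\<And>i j u. j \<ge> k i \<Longrightarrow> u \<in> paths G \<Longrightarrow> cyl G (initial j u) \<subseteq> C i m \<longleftrightarrow> u \<in> C i m"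
      by metis
    have "k i \<le> Max (k ` {..<l})" if "i < l" for i using that by auto
    then show ?thesis using k by blast
  qed
  then obtain k where k: "\<And>m i u. i < l \<Longrightarrow> u \<in> paths G \<Longrightarrow> cyl G (initial (k m) u) \<subseteq> C i m \<longleftrightarrow> u \<in> C i m"
    by metis
  \<comment> \<open>The label of a word is the least index whose approximating set contains its
    cylinder; \<open>l\<close> is the default if there is none. Outside the symmetric differences
    exactly one index qualifies, namely the value of \<open>F\<close>.\<close>
  define q where "q m w = (LEAST i. i = l \<or> cyl G w \<subseteq> C i m)" for m w
  define Q where "Q m u = q m (initial (k m) u)" for m u
  have Q: "simple_function M (Q m)" for m
    using simple_function_compose[OF simple_function_initial[OF P, of "k m"], of "q m"] by (simp add: Q_def[abs_def] o_def)
  have Ql: "Q m u \<le> l" for m u unfolding Q_def q_def by (rule Least_le) simp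
  have diff: "{u \<in> space M. F u \<noteq> Q m u} \<subseteq> (\<Union>i<l. (A i - C i m) \<union> (C i m - A i))" for m
  proof
    fix u assume u: "u \<in> {u \<in> space M. F u \<noteq> Q m u}"
    show "u \<in> (\<Union>i<l. (A i - C i m) \<union> (C i m - A i))"
    proof (rule ccontr)
      assume no: "u \<notin> (\<Union>i<l. (A i - C i m) \<union> (C i m - A i))"
      have up: "u \<in> paths G" using u sp by auto
      have iff: "i < l \<Longrightarrow> u \<in> A i \<longleftrightarrow> u \<in> C i m" for i using no by blast
      have "Q m u = F u"
        unfolding Q_def q_def
      proof (rule Least_equality)
        have "u \<in> A (F u)" using u by (auto simp: A_def)
        then show "F u = l \<or> cyl G (initial (k m) u) \<subseteq> C (F u) m" using k iff bound up by blast
        fix y assume y: "y = l \<or> cyl G (initial (k m) u) \<subseteq> C y m"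
        show "F u \<le> y"
        proof (cases "y < l")
          case True
          then have "u \<in> A y" using y k iff up by auto
          then show ?thesis by (auto simp: A_def)
        next
          case False then show ?thesis using bound[OF up] by simp
        qed
      qed
      then show False using u by simp
    qed
  qed
  have small: "prob {u \<in> space M. F u \<noteq> Q m u} \<le> l * (1 / Suc m)" for m
  proof -
    have "prob {u \<in> space M. F u \<noteq> Q m u} \<le> prob (\<Union>i<l. (A i - C i m) \<union> (C i m - A i))"
      by (rule finite_measure_mono[OF diff]) (use A cyls in auto)
    also have "\<dots> \<le> (\<Sum>i<l. prob ((A i - C i m) \<union> (C i m - A i)))"
      by (rule finite_measure_subadditive_finite) (use A cyls in auto)
    also have "\<dots> \<le> (\<Sum>i<l. 1 / Suc m)" by (intro sum_mono less_imp_le C)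
    finally show ?thesis by simp
  qed
  have "(\<lambda>m. prob {u \<in> space M. F u \<noteq> Q m u}) \<longlonglongrightarrow> 0"
  proof (rule tendsto_sandwich[OF _ _ tendsto_const])
    have "(\<lambda>m. real l * (1 / Suc m)) \<longlonglongrightarrow> real l * 0"
      using LIMSEQ_inverse_real_of_nat by (intro tendsto_mult tendsto_const) (simp add: inverse_eq_divide)
    then show "(\<lambda>m. real l * (1 / Suc m)) \<longlonglongrightarrow> 0" by simp
  qed (use small in \<open>auto intro!: always_eventually\<close>)
  then have lim: "(\<lambda>m. label_entropy M (\<lambda>x. (F x, Q m x)) - label_entropy M (Q m)) \<longlonglongrightarrow> 0"
    by (intro conditional_entropy_tendsto_0[where l = l] F Q Ql) (use bound sp in \<open>auto intro: less_imp_le\<close>)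
  have "itinerary_entropy F \<le> itinerary_entropy (\<lambda>u. u 0) +
      (label_entropy M (\<lambda>x. (F x, Q m x)) - label_entropy M (Q m))" for m
  proof -
    have "itinerary_entropy (Q m) \<le> itinerary_entropy (initial (k m))"
      by (rule itinerary_entropy_le_refine[OF simple_function_initial[OF P] Q]) (simp add: Q_def)
    then show ?thesis using itinerary_entropy_conditional[OF F Q, of m] init[of "k m"] by linarith
  qed
  then show ?thesis
    using LIMSEQ_le_const[OF tendsto_add[OF tendsto_const lim]] by fastforce
qed

text \<open>The Kolmogorov-Sinai entropy of an invariant measure, by \<open>ks_entropy_eq\<close>.
  As an infimum it is bounded above by each word entropy, and a lower bound can be verified length
  by length.\<close>

definition entropy_rate :: "(nat \<Rightarrow> 'e) measure \<Rightarrow> real" where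
  "entropy_rate M = (INF n\<in>{1..}. word_entropy M n / real n)"

lemma entropy_rate_eq:
  assumes M: "M \<in> invariant_measures G"
  shows "entropy_rate M = measure_preserving.itinerary_entropy M shift (\<lambda>u. u 0)"
proof -
  interpret measure_preserving M shift using M by (rule invariant_measure_preserving)
  show ?thesis
    unfolding entropy_rate_def itinerary_entropy_def itinerary_first label_entropy_initial[OF invariant_imp_prob[OF M]] ..
qed

lemma entropy_rate_le:
  assumes M: "M \<in> invariant_measures G" "n \<ge> 1" shows "entropy_rate M \<le> word_entropy M n / n"
proof -
  interpret measure_preserving M shift using M(1) by (rule invariant_measure_preserving)
  show ?thesis
    using itinerary_entropy_limit(2)[OF simple_function_first[OF invariant_imp_prob[OF M(1)]] M(2)]
    by (simp add: entropy_rate_eq[OF M(1)] itinerary_first label_entropy_initial[OF invariant_imp_prob[OF M(1)]])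
qed

lemma entropy_rate_ge:
  assumes "\<And>n. n \<ge> 1 \<Longrightarrow> x * n \<le> word_entropy M n" shows "x \<le> entropy_rate M"
  unfolding entropy_rate_def by (rule cINF_greatest) (use assms in \<open>auto simp: field_simps\<close>)

lemma word_entropy_nonneg:
  assumes "M \<in> prob_measures G" shows "word_entropy M n \<ge> 0"
proof -
  interpret prob_space M using assms by (rule prob_space_prob_measures)
  show ?thesis using label_entropy_nonneg[of "initial n"] label_entropy_initial[OF assms] by simp
qed

lemma entropy_rate_nonneg:
  assumes "M \<in> invariant_measures G" shows "entropy_rate M \<ge> 0"
  by (rule entropy_rate_ge) (simp add: word_entropy_nonneg invariant_imp_prob[OF assms])

text \<open>The cells of an arbitrary finite partition are numbered, so that the labelling can be
  compared with the first letter. Conversely, the cylinders of length one form an admissible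
  partition whose cells determine the first letter.\<close>

lemma ks_entropy_eq:
  assumes M: "M \<in> invariant_measures G"
  shows "ks_entropy M shift = ereal (entropy_rate M)"
proof -
  interpret measure_preserving M shift using M by (rule invariant_measure_preserving)
  note P = invariant_imp_prob[OF M]
  note sp = space_prob_measures[OF P]
  show ?thesis
    unfolding ks_entropy_def entropy_rate_eq[OF M]
  proof (intro antisym SUP_least)
    fix A assume "A \<in> {P. finite P \<and> P \<subseteq> events \<and> partition_on (space M) P}"
    then have A: "partition_on (space M) A" "finite A" "A \<subseteq> events" by auto
    obtain h where h: "bij_betw h A {0..<card A}" using ex_bij_betw_finite_nat[OF A(2)] by blast
    let ?F = "\<lambda>x. h (cell_of A x)"
    have F: "simple_function M ?F" by (rule simple_function_compose1[OF simple_function_cell_of[OF A]])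
    have "itinerary_entropy (cell_of A) \<le> itinerary_entropy ?F"
    proof (rule itinerary_entropy_le_refine[OF F simple_function_cell_of[OF A]])
      fix x y assume "x \<in> space M" "y \<in> space M" "h (cell_of A x) = h (cell_of A y)"
      then show "cell_of A x = cell_of A y"
        using h cell_of_in(1)[OF A(1)] by (auto simp: bij_betw_def inj_on_def)
    qed
    also have "\<dots> \<le> itinerary_entropy (\<lambda>u. u 0)"
      using h cell_of_in(1)[OF A(1)] sp
      by (intro itinerary_entropy_le_first[OF M F, of "card A"]) (auto simp: bij_betw_def)
    finally show "ereal (lim (\<lambda>n. partition_entropy M (refinement (space M) shift A n) / real n))
        \<le> ereal (itinerary_entropy (\<lambda>u. u 0))"
      by (simp add: partition_entropy_rate[OF A])
  next
    define A where "A = (\<lambda>a. cyl G [a]) ` arcs G"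
    have arc_word: "[a] \<in> words G 1" if "a \<in> arcs G" for a using that by (auto simp: words_def)
    have mem: "u \<in> cyl G [a] \<longleftrightarrow> u \<in> paths G \<and> u 0 = a" for u a by (auto simp: cyl_def)
    have "partition_on (space M) A"
      unfolding partition_on_def disjoint_def A_def sp
    proof (intro conjI)
      show "\<Union> ((\<lambda>a. cyl G [a]) ` arcs G) = paths G" by (auto simp: mem paths_def)
      show "{} \<notin> (\<lambda>a. cyl G [a]) ` arcs G" using cyl_nonempty[OF arc_word] by auto
    qed (auto simp: mem)
    moreover have "finite A" "A \<subseteq> events" by (auto simp: A_def sets_prob_measures[OF P])
    ultimately have A: "partition_on (space M) A" "finite A" "A \<subseteq> events" by auto
    have "itinerary_entropy (\<lambda>u. u 0) \<le> itinerary_entropy (cell_of A)"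
    proof (rule itinerary_entropy_le_refine[OF simple_function_cell_of[OF A] simple_function_first[OF P]])
      fix u v assume uv: "u \<in> space M" "v \<in> space M" "cell_of A u = cell_of A v"
      have "u \<in> cell_of A u" "v \<in> cell_of A v" "cell_of A u \<in> A" using cell_of_in[OF A(1)] uv by auto
      then show "u 0 = v 0" using uv(3) by (auto simp: A_def mem)
    qed
    then have "ereal (itinerary_entropy (\<lambda>u. u 0)) \<le>
        ereal (lim (\<lambda>n. partition_entropy M (refinement (space M) shift A n) / real n))"
      by (simp add: partition_entropy_rate[OF A])
    also have "\<dots> \<le> (SUP P\<in>{P. finite P \<and> P \<subseteq> events \<and> partition_on (space M) P}.
        ereal (lim (\<lambda>n. partition_entropy M (refinement (space M) shift P n) / real n)))"
      by (rule SUP_upper) (use A in auto)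
    finally show "ereal (itinerary_entropy (\<lambda>u. u 0)) \<le> (SUP P\<in>{P. finite P \<and> P \<subseteq> events \<and> partition_on (space M) P}.
        ereal (lim (\<lambda>n. partition_entropy M (refinement (space M) shift P n) / real n)))" .
  qed
qed

end

section \<open>The upper bound for the pressure\<close>

definition birkhoff_sum :: "((nat \<Rightarrow> 'e) \<Rightarrow> real) \<Rightarrow> nat \<Rightarrow> (nat \<Rightarrow> 'e) \<Rightarrow> real" where
  "birkhoff_sum g n u = (\<Sum>k<n. g ((shift ^^ k) u))"

lemma birkhoff_sum_add: "birkhoff_sum g (m + n) u = birkhoff_sum g m u + birkhoff_sum g n ((shift ^^ m) u)"
proof (induction n)
  case (Suc n)
  have "(shift ^^ (m + n)) u = (shift ^^ n) ((shift ^^ m) u)"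
    by (simp add: shift_power add_ac)
  then show ?case using Suc by (simp add: birkhoff_sum_def)
qed (simp add: birkhoff_sum_def)

lemma abs_birkhoff_sum_le:
  assumes "u \<in> paths G" "\<And>v. v \<in> paths G \<Longrightarrow> \<bar>g v\<bar> \<le> B"
  shows "\<bar>birkhoff_sum g n u\<bar> \<le> n * B"
proof -
  have "\<bar>birkhoff_sum g n u\<bar> \<le> (\<Sum>k<n. B)"
    unfolding birkhoff_sum_def
    by (rule order_trans[OF sum_abs]) (intro sum_mono assms paths_shift_power)
  then show ?thesis by simp
qed

text \<open>The conditional probability of \<open>w\<close> given its first \<open>q\<close>
  letters, for a chain whose transitions \<open>g\<close> look back \<open>q\<close> letters. The
  initial block itself gets weight 1.\<close>

definition markov_weight :: "nat \<Rightarrow> ('e list \<Rightarrow> 'e \<Rightarrow> real) \<Rightarrow> 'e list \<Rightarrow> real" where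
  "markov_weight q g w = (\<Prod>t<length w - q. g (take q (drop t w)) (w ! (t + q)))"

lemma markov_weight_snoc:
  assumes "length w \<ge> q"
  shows "markov_weight q g (w @ [a]) = markov_weight q g w * g (drop (length w - q) w) a"
proof -
  have n: "length (w @ [a]) - q = Suc (length w - q)" using assms by simp
  have "(\<Prod>t<length w - q. g (take q (drop t (w @ [a]))) ((w @ [a]) ! (t + q))) = markov_weight q g w"
    unfolding markov_weight_def by (intro prod.cong refl) (auto simp: nth_append)
  then show ?thesis unfolding markov_weight_def[of _ _ "w @ [a]"] n
    using assms by simp
qed

text \<open>Summing out the last letter costs a factor of at most 1, until only the
  \<open>card A ^ q\<close> initial blocks of weight 1 remain.\<close>

lemma sum_markov_weight_le:
  fixes A :: "'e set"
  assumes A: "finite A" and g: "\<And>v a. g v a \<ge> 0" "\<And>v. (\<Sum>a\<in>A. g v a) \<le> 1" and n: "n \<ge> q"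
  shows "(\<Sum>w\<in>{w. set w \<subseteq> A \<and> length w = n}. markov_weight q g w) \<le> card A ^ q"
  using n
proof (induction n rule: dec_induct)
  case base
  have "(\<Sum>w\<in>{w. set w \<subseteq> A \<and> length w = q}. markov_weight q g w) = (\<Sum>w\<in>{w. set w \<subseteq> A \<and> length w = q}. 1)"
    by (intro sum.cong refl) (auto simp: markov_weight_def)
  then show ?case using card_lists_length_eq[OF A, of q] by simp
next
  case (step n)
  let ?L = "\<lambda>n. {w. set w \<subseteq> A \<and> length w = n}"
  have L: "?L (Suc n) = (\<lambda>(w, a). w @ [a]) ` (?L n \<times> A)"
  proof (intro subset_antisym subsetI)
    fix w assume w: "w \<in> ?L (Suc n)"
    then have "w = butlast w @ [last w]" by (cases w rule: rev_cases) auto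
    moreover have "(butlast w, last w) \<in> ?L n \<times> A" using w by (cases w rule: rev_cases) auto
    ultimately show "w \<in> (\<lambda>(w, a). w @ [a]) ` (?L n \<times> A)" by force
  qed auto
  have "(\<Sum>w\<in>?L (Suc n). markov_weight q g w) = (\<Sum>(w, a)\<in>?L n \<times> A. markov_weight q g (w @ [a]))"
    unfolding L by (subst sum.reindex) (auto simp: inj_on_def case_prod_unfold)
  also have "\<dots> = (\<Sum>w\<in>?L n. \<Sum>a\<in>A. markov_weight q g (w @ [a]))"
    by (simp add: sum.cartesian_product)
  also have "\<dots> = (\<Sum>w\<in>?L n. markov_weight q g w * (\<Sum>a\<in>A. g (drop (length w - q) w) a))"
    using step.hyps by (intro sum.cong refl) (auto simp: markov_weight_snoc sum_distrib_left)
  also have "\<dots> \<le> (\<Sum>w\<in>?L n. markov_weight q g w * 1)"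
    by (intro sum_mono mult_left_mono g) (auto simp: markov_weight_def intro!: prod_nonneg g)
  finally show ?case using step.IH by simp
qed

lemma infdist_lessE:
  assumes "infdist x A < e" "A \<noteq> {}" obtains a where "a \<in> A" "dist x a < e"
proof -
  have "(INF a\<in>A. dist x a) < e" using assms by (simp add: infdist_notempty)
  then show ?thesis using that assms(2) by (subst (asm) cINF_less_iff) auto
qed

lemma sum_UN_le:
  fixes g :: "'a \<Rightarrow> real"
  assumes "finite F" "\<And>c. c \<in> F \<Longrightarrow> finite (V c)" "\<And>c x. c \<in> F \<Longrightarrow> x \<in> V c \<Longrightarrow> g x \<ge> 0"
  shows "sum g (\<Union>c\<in>F. V c) \<le> (\<Sum>c\<in>F. sum g (V c))"
  using assms
proof (induction F)
  case (insert c F)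
  have "sum g (V c \<union> (\<Union>c\<in>F. V c)) = sum g (V c) + sum g (\<Union>c\<in>F. V c) - sum g (V c \<inter> (\<Union>c\<in>F. V c))"
    using insert by (intro sum_Un) auto
  also have "\<dots> \<le> sum g (V c) + sum g (\<Union>c\<in>F. V c)"
  proof -
    have "0 \<le> sum g (V c \<inter> (\<Union>c\<in>F. V c))" by (intro sum_nonneg) (use insert.prems in auto)
    then show ?thesis by simp
  qed
  also have "sum g (\<Union>c\<in>F. V c) \<le> (\<Sum>c\<in>F. sum g (V c))"
    by (rule insert.IH) (use insert.prems in auto)
  finally show ?case using insert.hyps by simp
qed simp

lemma set_ball_mono: "r \<le> r' \<Longrightarrow> set_ball C r \<subseteq> set_ball C r'"
  by (auto simp: set_ball_def)

lemma eventually_const_le_exp: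
  assumes "d > 0" shows "\<forall>\<^sub>F n in sequentially. (K::real) \<le> exp (real n * d)"
proof -
  have "filterlim (\<lambda>n. exp (real n * d)) at_top sequentially"
    using assms by real_asymp
  then show ?thesis by (simp add: filterlim_at_top)
qed

section \<open>Distortion on cylinders and the words that are summed\<close>

context graph_shift
begin

text \<open>Except for the last \<open>k\<close> terms, the two orbits agree on at least
  \<open>k\<close> letters, so the terms differ by less than \<open>e/2\<close>; the last
  \<open>k\<close> terms are bounded independently of \<open>n\<close>.\<close>

lemma distortion:
  fixes e :: real
  assumes g: "continuous_map (path_topology G) euclideanreal g" and e: "e > 0"
  shows "\<exists>n0. \<forall>n\<ge>n0. \<forall>u\<in>paths G. \<forall>v\<in>paths G. initial n u = initial n v \<longrightarrow>
    \<bar>birkhoff_sum g n u - birkhoff_sum g n v\<bar> \<le> e * n"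
proof -
  obtain k where k: "\<And>u v. u \<in> paths G \<Longrightarrow> v \<in> paths G \<Longrightarrow> initial k u = initial k v \<Longrightarrow> \<bar>g u - g v\<bar> < e/2"
    using uniformly_continuous_initial[OF g, of "e/2"] e by auto
  obtain B where B: "B > 0" "\<And>u. u \<in> paths G \<Longrightarrow> \<bar>g u\<bar> \<le> B" using bounded_continuous_map[OF g] by blast
  have main: "\<bar>birkhoff_sum g n u - birkhoff_sum g n v\<bar> \<le> e * n"
    \<comment> \<open>This threshold makes the bound \<open>2 * k * B\<close> for the last
      \<open>k\<close> terms at most \<open>n * (e/2)\<close>.\<close>
    if n: "n \<ge> nat \<lceil>4 * B * k / e\<rceil>" "n \<ge> k" and uv: "u \<in> paths G" "v \<in> paths G" "initial n u = initial n v" for n u v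
  proof -
    obtain m where m: "n = m + k" using n(2) by (metis le_Suc_ex add.commute)
    have "\<bar>birkhoff_sum g m u - birkhoff_sum g m v\<bar> \<le> (\<Sum>j<m. \<bar>g ((shift ^^ j) u) - g ((shift ^^ j) v)\<bar>)"
      unfolding birkhoff_sum_def sum_subtractf[symmetric] by (rule sum_abs)
    also have "\<dots> \<le> (\<Sum>j<m. e/2)"
    proof (intro sum_mono less_imp_le k paths_shift_power uv)
      fix j assume "j \<in> {..<m}"
      then show "initial k ((shift ^^ j) u) = initial k ((shift ^^ j) v)"
        using uv(3) by (auto simp: initial_eq_iff shift_power_apply m)
    qed
    also have "\<dots> \<le> n * (e/2)" using e m by simp
    finally have 1: "\<bar>birkhoff_sum g m u - birkhoff_sum g m v\<bar> \<le> n * (e/2)" .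
    have 2: "\<bar>birkhoff_sum g k ((shift ^^ m) u)\<bar> \<le> k * B" "\<bar>birkhoff_sum g k ((shift ^^ m) v)\<bar> \<le> k * B"
      by (intro abs_birkhoff_sum_le[of _ G] paths_shift_power uv B; simp)+
    have "4 * B * k / e \<le> n" using n(1) by linarith
    then have "2 * (k * B) \<le> n * (e/2)" using e by (simp add: field_simps)
    moreover have "birkhoff_sum g n u = birkhoff_sum g m u + birkhoff_sum g k ((shift ^^ m) u)"
      "birkhoff_sum g n v = birkhoff_sum g m v + birkhoff_sum g k ((shift ^^ m) v)"
      unfolding m birkhoff_sum_add by simp_all
    moreover have "e * n = 2 * (n * (e/2))" by simp
    ultimately show ?thesis using 1 2 by linarith
  qed
  show ?thesis
    by (intro exI[of _ "max (nat \<lceil>4 * B * k / e\<rceil>) k"]) (use main in auto)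
qed

lemma birkhoff_integral:
  assumes "continuous_map (path_topology G) euclideanreal g" "n > 0" "u \<in> paths G"
  shows "birkhoff_sum g n u = n * (\<integral>u. g u \<partial>(empirical G n u))"
  using integral_empirical[OF assms(2,3) continuous_measurable[OF assms(1)]] assms(2)
  by (simp add: birkhoff_sum_def)

lemma bdd_above_exp_birkhoff:
  assumes "continuous_map (path_topology G) euclideanreal g"
  shows "bdd_above ((\<lambda>u. exp (birkhoff_sum g n u)) ` cyl G w)"
proof -
  obtain B where B: "B > 0" "\<And>u. u \<in> paths G \<Longrightarrow> \<bar>g u\<bar> \<le> B" using bounded_continuous_map[OF assms] by blast
  have "exp (birkhoff_sum g n u) \<le> exp (n * B)" if "u \<in> cyl G w" for u
    using abs_birkhoff_sum_le[of u G g B n] B that by (simp add: cyl_def)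
  then show ?thesis by (intro bdd_aboveI2)
qed

definition cyl_sup :: "((nat \<Rightarrow> 'e) \<Rightarrow> real) \<Rightarrow> nat \<Rightarrow> 'e list \<Rightarrow> real" where
  "cyl_sup \<phi> n w = (SUP u\<in>cyl G w. exp (birkhoff_sum \<phi> n u))"

lemma cyl_sup_ge:
  assumes "continuous_map (path_topology G) euclideanreal \<phi>" "u \<in> cyl G w"
  shows "exp (birkhoff_sum \<phi> n u) \<le> cyl_sup \<phi> n w"
  unfolding cyl_sup_def by (intro cSUP_upper bdd_above_exp_birkhoff assms)

lemma cyl_sup_le:
  assumes "w \<in> words G k" "\<And>u. u \<in> cyl G w \<Longrightarrow> birkhoff_sum \<phi> n u \<le> b"
  shows "cyl_sup \<phi> n w \<le> exp b"
  unfolding cyl_sup_def using cyl_nonempty[OF assms(1)] assms(2) by (intro cSUP_least) auto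

lemma cyl_sup_pos:
  assumes "continuous_map (path_topology G) euclideanreal \<phi>" "w \<in> words G k"
  shows "cyl_sup \<phi> n w > 0"
proof -
  obtain u where "u \<in> cyl G w" using cyl_nonempty[OF assms(2)] by auto
  then show ?thesis using cyl_sup_ge[OF assms(1), of u w n] by (meson exp_gt_zero less_le_trans)
qed

definition good_words :: "((nat \<Rightarrow> 'e) measure \<Rightarrow> 'x) \<Rightarrow> 'x set \<Rightarrow> nat \<Rightarrow> 'e list set" where
  "good_words U D n = {w \<in> words G n. (\<lambda>u. U (empirical G n u)) ` cyl G w \<subseteq> D}"

lemma multifractal_sum_eq: "multifractal_sum G U D \<phi> n = (\<Sum>w\<in>good_words U D n. cyl_sup \<phi> n w)"
  unfolding multifractal_sum_def good_words_def cyl_sup_def birkhoff_sum_def ..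

lemma good_words_subset: "good_words U D n \<subseteq> words G n"
  by (auto simp: good_words_def)

lemma finite_good_words [simp]: "finite (good_words U D n)"
  by (rule finite_subset[OF good_words_subset finite_words'])

lemma good_words_mono: "D \<subseteq> D' \<Longrightarrow> good_words U D n \<subseteq> good_words U D' n"
  by (auto simp: good_words_def)

section \<open>Block frequencies of words\<close>

definition rep :: "'e list \<Rightarrow> nat \<Rightarrow> 'e" where
  "rep w = (SOME u. u \<in> cyl G w)"

lemma rep_in_cyl: "w \<in> words G n \<Longrightarrow> rep w \<in> cyl G w"
  unfolding rep_def some_in_eq by (rule cyl_nonempty)

lemma rep_path: "w \<in> words G n \<Longrightarrow> rep w \<in> paths G"
  using rep_in_cyl by (auto simp: cyl_def)

lemma initial_rep: "w \<in> words G n \<Longrightarrow> initial n (rep w) = w"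
  using rep_in_cyl[of w n] by (simp add: cyl_word)

text \<open>Frequency of the block \<open>v\<close> along the chosen point of the cylinder of
  \<open>w\<close>. Another choice of point could change it only through occurrences that start in
  \<open>w\<close> and reach beyond its end.\<close>

definition freq :: "nat \<Rightarrow> 'e list \<Rightarrow> 'e list \<Rightarrow> real" where
  "freq n w v = measure (empirical G n (rep w)) (cyl G v)"

lemma freq_bounds:
  assumes "w \<in> words G n" "n > 0" shows "freq n w v \<in> {0..1}"
proof -
  interpret prob_space "empirical G n (rep w)"
    by (rule prob_space_prob_measures[OF empirical_prob[OF assms(2) rep_path[OF assms(1)]]])
  show ?thesis unfolding freq_def by auto
qed

text \<open>Some frequency vector carries, in each of its neighbourhoods, the full exponential growth:
  otherwise finitely many neighbourhoods of slower growth would cover the compact cube.\<close>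

lemma growth_concentrates:
  fixes U :: "(nat \<Rightarrow> 'e) measure \<Rightarrow> 'x::metric_space" and s :: real
  assumes \<phi>: "continuous_map (path_topology G) euclideanreal \<phi>"
    and growth: "\<And>r. r > 0 \<Longrightarrow>
      \<not> (\<forall>\<^sub>F n in sequentially. multifractal_sum G U (set_ball C r) \<phi> n \<le> exp (n * s))"
  obtains c where "\<And>A r (s' :: real). openin (product_topology (\<lambda>_. euclideanreal) UNIV) A \<Longrightarrow> c \<in> A \<Longrightarrow> r > 0 \<Longrightarrow> s' < s \<Longrightarrow>
      \<not> (\<forall>\<^sub>F n in sequentially.
        (\<Sum>w\<in>{w \<in> good_words U (set_ball C r) n. freq n w \<in> A}. cyl_sup \<phi> n w) \<le> exp (n * s'))"
proof -
  let ?T = "product_topology (\<lambda>_::'e list. euclideanreal) UNIV"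
  let ?Y = "Pi\<^sub>E (UNIV :: 'e list set) (\<lambda>_. {0..1::real})"
  let ?Z = "\<lambda>A r n. \<Sum>w\<in>{w \<in> good_words U (set_ball C r) n. freq n w \<in> A}. cyl_sup \<phi> n w"
  have "\<exists>c. \<forall>A r (s' :: real). openin ?T A \<longrightarrow> c \<in> A \<longrightarrow> r > 0 \<longrightarrow> s' < s \<longrightarrow>
      \<not> (\<forall>\<^sub>F n in sequentially. ?Z A r n \<le> exp (n * s'))"
  proof (rule ccontr)
    assume none: "\<not> ?thesis"
    define slow where "slow c A r s' \<longleftrightarrow> openin ?T A \<and> c \<in> A \<and> r > 0 \<and> s' < s \<and>
      (\<forall>\<^sub>F n in sequentially. ?Z A r n \<le> exp (n * s'))" for c A r and s' :: real
    have "\<exists>A r s'. slow c A r s'" for c using none unfolding slow_def by blast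
    then obtain A r s' where slow: "\<And>c. slow c (A c) (r c) (s' c)" by metis
    have A: "\<And>c. openin ?T (A c)" "\<And>c. c \<in> A c" and r: "\<And>c. r c > 0" and s': "\<And>c. s' c < s"
      and ev: "\<And>c. \<forall>\<^sub>F n in sequentially. ?Z (A c) (r c) n \<le> exp (n * s' c)"
      using slow unfolding slow_def by blast+
    \<comment> \<open>Tychonoff: the cube containing all frequency vectors is compact.\<close>
    have "compactin ?T ?Y" by (simp add: compactin_PiE del: PiE_UNIV_domain)
    then have "\<And>\<U>. \<forall>A\<in>\<U>. openin ?T A \<Longrightarrow> ?Y \<subseteq> \<Union>\<U> \<Longrightarrow> \<exists>\<F>. finite \<F> \<and> \<F> \<subseteq> \<U> \<and> ?Y \<subseteq> \<Union>\<F>"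
      unfolding compactin_def by blast
    moreover have "\<forall>B\<in>A ` ?Y. openin ?T B" using A(1) by blast
    moreover have "?Y \<subseteq> \<Union> (A ` ?Y)" using A(2) by blast
    ultimately obtain \<F> where \<F>: "finite \<F>" "\<F> \<subseteq> A ` ?Y" "?Y \<subseteq> \<Union> \<F>" by metis
    obtain F where "F \<subseteq> ?Y" "finite F" "\<F> = A ` F"
      using finite_subset_image[OF \<F>(1,2)] by blast
    then have F: "finite F" "F \<subseteq> ?Y" "?Y \<subseteq> \<Union> (A ` F)" using \<F>(3) by simp_all
    have "(\<lambda>_. 0) \<in> ?Y" by auto
    then have ne: "F \<noteq> {}" using F(3) by auto
    define r0 where "r0 = Min (r ` F)"
    define s0 where "s0 = Max (s' ` F)"
    have r0: "r0 > 0" "\<And>c. c \<in> F \<Longrightarrow> r0 \<le> r c" unfolding r0_def using F(1) ne r by auto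
    have s0: "s0 < s" "\<And>c. c \<in> F \<Longrightarrow> s' c \<le> s0" unfolding s0_def using F(1) ne s' by auto
    have "\<forall>\<^sub>F n in sequentially. \<forall>c\<in>F. ?Z (A c) (r c) n \<le> exp (n * s' c)"
      by (intro eventually_ball_finite F(1) ballI ev)
    \<comment> \<open>The number of neighbourhoods in the cover is absorbed by the gap between
      \<open>s0\<close> and \<open>s\<close>.\<close>
    moreover have "\<forall>\<^sub>F n in sequentially. real (card F) \<le> exp (n * (s - s0))"
      by (rule eventually_const_le_exp) (use s0 in simp)
    ultimately have "\<forall>\<^sub>F n in sequentially. multifractal_sum G U (set_ball C r0) \<phi> n \<le> exp (n * s)"
      using eventually_gt_at_top[of 0]
    proof eventually_elim
      case (elim n)
      let ?W = "good_words U (set_ball C r0) n"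
      let ?V = "\<lambda>c. {w \<in> good_words U (set_ball C (r c)) n. freq n w \<in> A c}"
      have pos: "cyl_sup \<phi> n w \<ge> 0" if "w \<in> words G n" for w
        using cyl_sup_pos[OF \<phi> that] by (simp add: less_imp_le)
      have "multifractal_sum G U (set_ball C r0) \<phi> n = (\<Sum>w\<in>?W. cyl_sup \<phi> n w)"
        by (rule multifractal_sum_eq)
      also have "\<dots> \<le> (\<Sum>w\<in>(\<Union>c\<in>F. ?V c). cyl_sup \<phi> n w)"
      proof (intro sum_mono2)
        show "finite (\<Union>c\<in>F. ?V c)" using F(1) by auto
        show "?W \<subseteq> (\<Union>c\<in>F. ?V c)"
        proof
          fix w assume w: "w \<in> ?W"
          then have "w \<in> words G n" by (simp add: good_words_def)
          then have "freq n w \<in> ?Y" using freq_bounds[OF _ elim(3)] by (intro PiE_I) auto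
          then obtain c where c: "c \<in> F" "freq n w \<in> A c" using F(3) by auto
          then have "w \<in> good_words U (set_ball C (r c)) n"
            using w good_words_mono[OF set_ball_mono[OF r0(2)[OF c(1)]]] by blast
          then show "w \<in> (\<Union>c\<in>F. ?V c)" using c by blast
        qed
      qed (simp add: good_words_def pos)
      also have "\<dots> \<le> (\<Sum>c\<in>F. ?Z (A c) (r c) n)"
        by (rule sum_UN_le) (simp_all add: F(1) good_words_def pos)
      also have "\<dots> \<le> (\<Sum>c\<in>F. exp (n * s0))"
        using elim(1) s0(2) by (intro sum_mono) (meson exp_le_cancel_iff mult_left_mono of_nat_0_le_iff order_trans)
      also have "\<dots> \<le> exp (n * (s - s0)) * exp (n * s0)" using elim(2) by simp
      also have "\<dots> = exp (n * s)" by (simp add: exp_add[symmetric] algebra_simps)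
      finally show ?case .
    qed
    then show False using growth r0(1) by blast
  qed
  then show ?thesis using that by blast
qed

section \<open>Counting words with prescribed block frequencies\<close>

lemma cyl_empty:
  assumes "w \<notin> words G (length w)" shows "cyl G w = {}"
proof (rule ccontr)
  assume "cyl G w \<noteq> {}"
  then obtain u where "u \<in> paths G" "initial (length w) u = w" by (auto simp: cyl_eq)
  then show False using assms initial_in_words[of u G "length w"] by simp
qed

lemma sum_cyl_snoc_le:
  assumes M: "M \<in> prob_measures G"
  shows "(\<Sum>a\<in>arcs G. measure M (cyl G (v @ [a]))) \<le> measure M (cyl G v)"
proof -
  interpret prob_space M using M by (rule prob_space_prob_measures)
  have "prob (\<Union>a\<in>arcs G. cyl G (v @ [a])) = (\<Sum>a\<in>arcs G. prob (cyl G (v @ [a])))"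
  proof (rule finite_measure_finite_Union[OF finite_arcs])
    show "(\<lambda>a. cyl G (v @ [a])) ` arcs G \<subseteq> events" by (auto simp: sets_prob_measures[OF M])
    show "disjoint_family_on (\<lambda>a. cyl G (v @ [a])) (arcs G)"
      by (auto simp: disjoint_family_on_def cyl_def)
  qed
  moreover have "prob (\<Union>a\<in>arcs G. cyl G (v @ [a])) \<le> prob (cyl G v)"
  proof (rule finite_measure_mono)
    show "(\<Union>a\<in>arcs G. cyl G (v @ [a])) \<subseteq> cyl G v" by (auto simp: cyl_def)
  qed (simp add: sets_prob_measures[OF M])
  ultimately show ?thesis by simp
qed

lemma sum_words_Suc_take:
  assumes M: "M \<in> prob_measures G"
  shows "(\<Sum>v\<in>words G (Suc q). c (take q v) * measure M (cyl G v)) = (\<Sum>v\<in>words G q. c v * measure M (cyl G v))"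
proof -
  have "(\<Sum>v\<in>words G (Suc q). c (take q v) * measure M (cyl G v)) = (\<integral>u. c (take q (initial (Suc q) u)) \<partial>M)"
    using integral_initial(1)[OF M, of "\<lambda>v. c (take q v)" "Suc q"] by simp
  also have "\<dots> = (\<Sum>v\<in>words G q. c v * measure M (cyl G v))"
    using integral_initial(1)[OF M, of c q] by (simp add: take_initial)
  finally show ?thesis .
qed

text \<open>A word with block frequencies close to those of \<open>N\<close> has weight about \<open>exp (- n h)\<close> under the
  Markov chain with transition probabilities \<open>N [v a] / N [v]\<close>, where \<open>h\<close> is its entropy; the
  \<open>\<eta>\<close>-smoothing keeps all transition probabilities positive.\<close>

lemma card_words_near:
  fixes \<eta> e :: real
  assumes N: "N \<in> prob_measures G" and \<eta>: "0 < \<eta>" "\<eta> < 1" and e: "e > 0"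
  obtains d where "d > 0" "\<And>n T. q \<le> n \<Longrightarrow> n > 0 \<Longrightarrow> T \<subseteq> words G n \<Longrightarrow>
    (\<And>w v. w \<in> T \<Longrightarrow> v \<in> words G (Suc q) \<Longrightarrow> \<bar>freq n w v - measure N (cyl G v)\<bar> < d) \<Longrightarrow>
    card T \<le> real (card (arcs G)) ^ q *
      exp (n * (word_entropy N (Suc q) - word_entropy N q - ln (1 - \<eta>) + e))"
proof -
  interpret N: prob_space N using N by (rule prob_space_prob_measures)
  define K where "K = real (card (arcs G))"
  have K: "K > 0" unfolding K_def using arcs_nonempty by (simp add: card_gt_0_iff)
  let ?m = "\<lambda>v. measure N (cyl G v)"
  \<comment> \<open>The share \<open>\<eta> / K\<close> keeps the logarithms finite, as a word close
    to \<open>N\<close> may still contain blocks of \<open>N\<close>-measure 0; after a null block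
    the transitions are uniform.\<close>
  define g where "g v a = (if ?m v > 0 then (1 - \<eta>) * (?m (v @ [a]) / ?m v) + \<eta> / K else 1 / K)" for v a
  have gpos: "g v a > 0" for v a
    unfolding g_def using K \<eta> by (auto intro!: add_nonneg_pos)
  have gsum: "(\<Sum>a\<in>arcs G. g v a) \<le> 1" for v
  proof (cases "?m v > 0")
    case True
    have "(\<Sum>a\<in>arcs G. g v a) = (1 - \<eta>) * ((\<Sum>a\<in>arcs G. ?m (v @ [a])) / ?m v) + \<eta>"
      using True K arcs_nonempty by (simp add: g_def sum.distrib sum_distrib_left sum_divide_distrib K_def)
    also have "\<dots> \<le> (1 - \<eta>) * 1 + \<eta>"
      using True \<eta> sum_cyl_snoc_le[OF N, of v] by (intro add_mono mult_left_mono) (auto simp: divide_le_eq)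
    finally show ?thesis by simp
  next
    case False
    then show ?thesis using K by (simp add: g_def K_def)
  qed
  define l where "l v = ln (g (take q v) (v ! q))" for v
  have lneg: "l v \<le> 0" if v: "v \<in> words G (Suc q)" for v
  proof -
    have "v ! q \<in> arcs G" using v by (auto simp: words_def)
    then have "g (take q v) (v ! q) \<le> (\<Sum>a\<in>arcs G. g (take q v) a)"
      by (intro member_le_sum) (auto intro: less_imp_le gpos)
    then show ?thesis unfolding l_def using gsum[of "take q v"] gpos by simp
  qed
  \<comment> \<open>The mean logarithm of the transition weight under \<open>N\<close>. Up to
    \<open>ln (1 - \<eta>)\<close> it is at least minus the conditional entropy of a letter given
    the \<open>q\<close> preceding ones.\<close>
  define S where "S = (\<Sum>v\<in>words G (Suc q). l v * ?m v)"
  have S: "S \<ge> ln (1 - \<eta>) - (word_entropy N (Suc q) - word_entropy N q)"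
  proof -
    have "(ln (1 - \<eta>) + ln (?m v) - ln (?m (take q v))) * ?m v \<le> l v * ?m v" if v: "v \<in> words G (Suc q)" for v
    proof (cases "?m v = 0")
      case False
      then have v0: "?m v > 0" by (simp add: zero_less_measure_iff)
      have vq: "take q v @ [v ! q] = v" using v take_Suc_conv_app_nth[of q v] by (auto simp: words_def)
      have "?m v \<le> ?m (take q v)"
      proof (rule N.finite_measure_mono)
        show "cyl G v \<subseteq> cyl G (take q v)"
        proof
          fix u assume "u \<in> cyl G v"
          then have u: "u \<in> paths G" "v = initial (Suc q) u" using v by (auto simp: cyl_word)
          then show "u \<in> cyl G (take q v)" by (simp add: take_initial cyl_initial)
        qed
      qed (simp add: sets_prob_measures[OF N])
      then have t0: "?m (take q v) > 0" using v0 by simp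
      have "ln (1 - \<eta>) + ln (?m v) - ln (?m (take q v)) = ln ((1 - \<eta>) * (?m v / ?m (take q v)))"
        using v0 t0 \<eta> by (simp add: ln_mult ln_div)
      also have "\<dots> \<le> ln (g (take q v) (v ! q))"
        using v0 t0 \<eta> K by (subst ln_le_cancel_iff) (auto simp: g_def vq intro!: mult_pos_pos add_pos_pos)
      finally show ?thesis unfolding l_def using v0 by simp
    qed simp
    then have "(\<Sum>v\<in>words G (Suc q). (ln (1 - \<eta>) + ln (?m v) - ln (?m (take q v))) * ?m v) \<le> S"
      unfolding S_def by (intro sum_mono)
    moreover have "(\<Sum>v\<in>words G (Suc q). (ln (1 - \<eta>) + ln (?m v) - ln (?m (take q v))) * ?m v) =
        (\<Sum>v\<in>words G (Suc q). ln (1 - \<eta>) * ?m v) + (\<Sum>v\<in>words G (Suc q). ?m v * ln (?m v)) -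
        (\<Sum>v\<in>words G (Suc q). ln (?m (take q v)) * ?m v)"
      by (simp add: algebra_simps sum.distrib sum_subtractf)
    moreover have "(\<Sum>v\<in>words G (Suc q). ln (?m (take q v)) * ?m v) = (\<Sum>v\<in>words G q. ?m v * ln (?m v))"
      using sum_words_Suc_take[OF N, of "\<lambda>v. ln (?m v)" q] by (simp add: mult.commute)
    moreover have "(\<Sum>v\<in>words G (Suc q). ln (1 - \<eta>) * ?m v) = ln (1 - \<eta>)"
      using sum_measure_cyl[OF N, of "Suc q"] by (simp add: sum_distrib_left[symmetric])
    ultimately show ?thesis by (simp add: word_entropy_def)
  qed
  define B where "B = (\<Sum>v\<in>words G (Suc q). \<bar>l v\<bar>)"
  have B: "B \<ge> 0" unfolding B_def by (intro sum_nonneg) auto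
  define d where "d = e / (B + 1)"
  have d: "d > 0" "B * d \<le> e" using B e by (auto simp: d_def field_simps)
  show ?thesis
  proof (rule that[OF d(1)])
    fix n T assume n: "q \<le> n" "n > 0" and T: "T \<subseteq> words G n"
      and near: "\<And>w v. w \<in> T \<Longrightarrow> v \<in> words G (Suc q) \<Longrightarrow> \<bar>freq n w v - ?m v\<bar> < d"
    have weight: "exp (n * (S - e)) \<le> markov_weight q g w" if w: "w \<in> T" for w
    proof -
      have ww: "w \<in> words G n" using w T by auto
      define u where "u = rep w"
      have u: "u \<in> paths G" "initial n u = w" using rep_path[OF ww] initial_rep[OF ww] by (auto simp: u_def)
      let ?L = "\<lambda>u. l (initial (Suc q) u)"
      have "markov_weight q g w = (\<Prod>t<n - q. exp (?L ((shift ^^ t) u)))"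
        unfolding markov_weight_def length_words[OF ww]
      proof (intro prod.cong refl)
        fix t assume "t \<in> {..<n - q}"
        then have t: "t + q < n" by auto
        have "take q (drop t w) = take q (initial (Suc q) ((shift ^^ t) u))"
          unfolding take_initial[OF le_SucI[OF order_refl]] u(2)[symmetric]
          using t by (intro nth_equalityI) (auto simp: shift_power_apply)
        moreover have "w ! (t + q) = initial (Suc q) ((shift ^^ t) u) ! q"
          using t u(2) by (auto simp: shift_power_apply)
        ultimately show "g (take q (drop t w)) (w ! (t + q)) = exp (?L ((shift ^^ t) u))"
          using gpos by (simp add: l_def)
      qed
      also have "\<dots> = exp (\<Sum>t<n - q. ?L ((shift ^^ t) u))" by (simp add: exp_sum)
      finally have eq: "markov_weight q g w = exp (\<Sum>t<n - q. ?L ((shift ^^ t) u))" .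
      have E: "empirical G n u \<in> prob_measures G" using empirical_prob n u by auto
      have meas: "?L \<in> borel_measurable (path_borel G)"
        using borel_measurable_integrable[OF integral_initial(2)[OF E, of l "Suc q"]]
        unfolding measurable_cong_sets[OF sets_prob_measures[OF E] refl] .
      have "(\<Sum>t<n. ?L ((shift ^^ t) u)) = n * (\<Sum>v\<in>words G (Suc q). l v * freq n w v)"
        using integral_empirical[OF n(2) u(1) meas] integral_initial(1)[OF E, of l "Suc q"] n(2)
        by (simp add: freq_def u_def field_simps)
      \<comment> \<open>The last \<open>q\<close> windows reach beyond \<open>w\<close>; as
        \<open>l\<close> is nonpositive on words, including them only lowers the sum, and the full
        sum is an empirical integral.\<close>
      moreover have "(\<Sum>t<n. ?L ((shift ^^ t) u)) \<le> (\<Sum>t<n - q. ?L ((shift ^^ t) u))"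
      proof -
        have "(\<Sum>t\<in>{..<n}. - ?L ((shift ^^ t) u)) \<ge> (\<Sum>t\<in>{..<n - q}. - ?L ((shift ^^ t) u))"
          by (rule sum_mono2) (auto intro!: lneg initial_in_words paths_shift_power u)
        then show ?thesis by (simp add: sum_negf)
      qed
      moreover have "S - e \<le> (\<Sum>v\<in>words G (Suc q). l v * freq n w v)"
      proof -
        have "S - (\<Sum>v\<in>words G (Suc q). l v * freq n w v) = (\<Sum>v\<in>words G (Suc q). l v * (?m v - freq n w v))"
          unfolding S_def by (simp add: sum_subtractf algebra_simps)
        also have "\<dots> \<le> (\<Sum>v\<in>words G (Suc q). \<bar>l v\<bar> * d)"
        proof (intro sum_mono)
          fix v assume v: "v \<in> words G (Suc q)"
          have "l v * (?m v - freq n w v) \<le> \<bar>l v * (?m v - freq n w v)\<bar>" by simp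
          also have "\<dots> \<le> \<bar>l v\<bar> * d"
            unfolding abs_mult using near[OF w v] by (intro mult_left_mono) auto
          finally show "l v * (?m v - freq n w v) \<le> \<bar>l v\<bar> * d" .
        qed
        also have "\<dots> = B * d" by (simp add: B_def sum_distrib_right)
        finally show ?thesis using d(2) by simp
      qed
      ultimately have "n * (S - e) \<le> (\<Sum>t<n - q. ?L ((shift ^^ t) u))"
        by (metis (no_types, lifting) mult_left_mono of_nat_0_le_iff order_trans)
      then show ?thesis using eq by simp
    qed
    \<comment> \<open>Every word in \<open>T\<close> has weight at least
      \<open>exp (n * (S - e))\<close>, while the total weight is at most
      \<open>K ^ q\<close>.\<close>
    have "card T * exp (n * (S - e)) = (\<Sum>w\<in>T. exp (n * (S - e)))" by simp
    also have "\<dots> \<le> (\<Sum>w\<in>T. markov_weight q g w)" by (intro sum_mono weight)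
    also have "\<dots> \<le> (\<Sum>w\<in>{w. set w \<subseteq> arcs G \<and> length w = n}. markov_weight q g w)"
    proof (rule sum_mono2)
      show "finite {w. set w \<subseteq> arcs G \<and> length w = n}" by (intro finite_lists_length_eq finite_arcs)
      show "T \<subseteq> {w. set w \<subseteq> arcs G \<and> length w = n}" using T by (auto simp: words_def)
      show "0 \<le> markov_weight q g w" for w unfolding markov_weight_def by (intro prod_nonneg less_imp_le gpos)
    qed
    also have "\<dots> \<le> K ^ q"
      unfolding K_def using sum_markov_weight_le[OF finite_arcs less_imp_le[OF gpos] gsum n(1)] by simp
    finally have "card T * exp (n * (S - e)) * exp (- (n * (S - e))) \<le> K ^ q * exp (- (n * (S - e)))"
      by (rule mult_right_mono) simp
    then have "card T \<le> K ^ q * exp (- (n * (S - e)))"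
      by (simp only: mult.assoc exp_minus_inverse mult_1_right)
    moreover have "K ^ q * exp (- (n * (S - e))) \<le>
        K ^ q * exp (n * (word_entropy N (Suc q) - word_entropy N q - ln (1 - \<eta>) + e))"
    proof -
      have "- (S - e) \<le> word_entropy N (Suc q) - word_entropy N q - ln (1 - \<eta>) + e" using S by simp
      then have "n * (- (S - e)) \<le> n * (word_entropy N (Suc q) - word_entropy N q - ln (1 - \<eta>) + e)"
        by (rule mult_left_mono) simp
      then have "exp (- (n * (S - e))) \<le> exp (n * (word_entropy N (Suc q) - word_entropy N q - ln (1 - \<eta>) + e))"
        by (simp only: exp_le_cancel_iff mult_minus_right)
      then show ?thesis using K by (intro mult_left_mono) simp_all
    qed
    ultimately show "card T \<le> real (card (arcs G)) ^ q *
      exp (n * (word_entropy N (Suc q) - word_entropy N q - ln (1 - \<eta>) + e))"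
      unfolding K_def by (rule order_trans)
  qed
qed

text \<open>The two counts run over the same orbit shifted by one step, so their difference
  telescopes to the two endpoints.\<close>

lemma empirical_shift_diff:
  assumes "n > 0" "u \<in> paths G" "A \<in> sets (path_borel G)"
  shows "\<bar>measure (empirical G n u) (shift -` A \<inter> paths G) - measure (empirical G n u) A\<bar> \<le> 1 / n"
proof -
  let ?i = "\<lambda>k. indicator A ((shift ^^ k) u) :: real"
  have card: "real (card {k. k < n \<and> P k}) = (\<Sum>k<n. if P k then 1 else 0)" for P
    by (simp add: sum.If_cases Int_def)
  have S: "shift -` A \<inter> paths G \<in> sets (path_borel G)"
    using measurable_sets[OF measurable_shift assms(3)] by simp
  have 1: "measure (empirical G n u) A = (\<Sum>k<n. ?i k) / n"
    unfolding measure_empirical[OF assms] card by (simp add: indicator_def of_bool_def)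
  have 2: "measure (empirical G n u) (shift -` A \<inter> paths G) = (\<Sum>k<n. ?i (Suc k)) / n"
    unfolding measure_empirical[OF assms(1,2) S] card
    using paths_shift_power[OF assms(2)] by (simp add: indicator_def of_bool_def)
  have "(\<Sum>k<n. ?i (Suc k)) - (\<Sum>k<n. ?i k) = ?i n - ?i 0"
    unfolding sum_subtractf[symmetric] by (rule sum_lessThan_telescope)
  then have "\<bar>(\<Sum>k<n. ?i (Suc k)) - (\<Sum>k<n. ?i k)\<bar> \<le> 1" by (auto simp: indicator_def)
  then show ?thesis unfolding 1 2 diff_divide_distrib[symmetric] abs_divide
    using assms(1) by (simp add: divide_right_mono)
qed

text \<open>Concentration gives many words near one frequency vector \<open>c\<close>. The measure
  \<open>N\<close> with these cylinder probabilities is the limit of empirical measures of such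
  words, and it must then account for both their number and their Birkhoff sums.\<close>

theorem pressure_upper_bound:
  fixes U :: "(nat \<Rightarrow> 'e) measure \<Rightarrow> 'x::metric_space" and s :: real
  assumes U: "continuous_map (weak_topology G) euclidean U"
    and \<phi>: "continuous_map (path_topology G) euclideanreal \<phi>"
    and growth: "\<And>r. r > 0 \<Longrightarrow>
      \<not> (\<forall>\<^sub>F n in sequentially. multifractal_sum G U (set_ball C r) \<phi> n \<le> exp (n * s))"
  shows "\<exists>M\<in>invariant_measures G. U M \<in> closure C \<and> s \<le> entropy_rate M + (\<integral>u. \<phi> u \<partial>M)"
proof -
  obtain c where c: "\<And>A r (s' :: real). openin (product_topology (\<lambda>_. euclideanreal) UNIV) A \<Longrightarrow> c \<in> A \<Longrightarrow> r > 0 \<Longrightarrow> s' < s \<Longrightarrow>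
      \<not> (\<forall>\<^sub>F n in sequentially.
        (\<Sum>w\<in>{w \<in> good_words U (set_ball C r) n. freq n w \<in> A}. cyl_sup \<phi> n w) \<le> exp (n * s'))"
    using growth_concentrates[OF \<phi> growth] by blast
  define F where "F i = (\<Union>k\<le>i. words G k)" for i :: nat
  have finF: "finite (F i)" for i by (auto simp: F_def)
  \<comment> \<open>The radius around \<open>C\<close>, the tolerance and the collection of tested
    blocks are governed by one index \<open>i\<close>, so that a single limit in \<open>i\<close>
    settles all of them.\<close>
  define T where "T i n = {w \<in> good_words U (set_ball C (1 / Suc i)) n. \<forall>v\<in>F i. \<bar>freq n w v - c v\<bar> < 1 / Suc i}" for i n
  have "\<exists>n. n \<ge> Suc i \<and> exp (n * (s - 1 / Suc i)) < (\<Sum>w\<in>T i n. cyl_sup \<phi> n w)" for i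
  proof -
    define A where "A = Pi\<^sub>E UNIV (\<lambda>v. if v \<in> F i then ball (c v) (1 / Suc i) else UNIV)"
    have "openin (product_topology (\<lambda>_. euclideanreal) UNIV) A"
      unfolding A_def
    proof (intro product_topology_basis)
      show "finite {v. (if v \<in> F i then ball (c v) (1 / real (Suc i)) else UNIV) \<noteq> topspace euclideanreal}"
        by (rule finite_subset[OF _ finF[of i]]) (auto split: if_splits)
    qed auto
    moreover have "c \<in> A" by (auto simp: A_def)
    ultimately have "\<not> (\<forall>\<^sub>F n in sequentially.
        (\<Sum>w\<in>{w \<in> good_words U (set_ball C (1 / Suc i)) n. freq n w \<in> A}. cyl_sup \<phi> n w) \<le> exp (n * (s - 1 / Suc i)))"
      by (intro c) auto
    then obtain n where n: "n \<ge> Suc i" "exp (n * (s - 1 / Suc i)) <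
        (\<Sum>w\<in>{w \<in> good_words U (set_ball C (1 / Suc i)) n. freq n w \<in> A}. cyl_sup \<phi> n w)"
      unfolding eventually_sequentially by (meson linorder_not_le)
    have "f \<in> A \<longleftrightarrow> (\<forall>v\<in>F i. \<bar>f v - c v\<bar> < 1 / Suc i)" for f
      unfolding A_def by (auto simp: PiE_def Pi_def dist_real_def abs_minus_commute split: if_splits)
    then show ?thesis using n unfolding T_def by auto
  qed
  then obtain n where n: "\<And>i. n i \<ge> Suc i"
    and big: "\<And>i. exp (n i * (s - 1 / Suc i)) < (\<Sum>w\<in>T i (n i). cyl_sup \<phi> (n i) w)" by metis
  have npos: "n i > 0" for i using n[of i] by simp
  have Tw: "T i m \<subseteq> words G m" for i m unfolding T_def good_words_def by auto
  have "T i (n i) \<noteq> {}" for i using big[of i] exp_gt_zero[of "n i * (s - 1 / Suc i)"] by auto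
  \<comment> \<open>One word per index suffices to build the limit measure, since all words in
    \<open>T i (n i)\<close> have frequencies close to \<open>c\<close>.\<close>
  then have "\<exists>w. \<forall>i. w i \<in> T i (n i)" by (intro choice allI) auto
  then obtain w where w: "\<And>i. w i \<in> T i (n i)" by blast
  have ww: "w i \<in> words G (n i)" for i using w Tw by blast
  define M where "M i = empirical G (n i) (rep (w i))" for i
  have M: "M i \<in> prob_measures G" for i
    unfolding M_def by (intro empirical_prob npos rep_path[OF ww])
  have inv0: "(\<lambda>i. 1 / real (Suc i)) \<longlonglongrightarrow> 0"
    using LIMSEQ_inverse_real_of_nat by (simp add: inverse_eq_divide)
  have lim_c: "(\<lambda>i. measure (M i) (cyl G v)) \<longlonglongrightarrow> c v" if v: "v \<in> words G k" for v k
  proof (rule LIM_zero_cancel, rule Lim_null_comparison[OF _ inv0])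
    show "\<forall>\<^sub>F i in sequentially. norm (measure (M i) (cyl G v) - c v) \<le> 1 / real (Suc i)"
    proof (rule eventually_sequentiallyI[of k])
      fix i assume "k \<le> i"
      then have "v \<in> F i" using v by (auto simp: F_def)
      then have "\<bar>freq (n i) (w i) v - c v\<bar> < 1 / Suc i" using w[of i] unfolding T_def by blast
      then show "norm (measure (M i) (cyl G v) - c v) \<le> 1 / real (Suc i)"
        by (simp add: M_def freq_def)
    qed
  qed
  have conv: "convergent (\<lambda>i. measure (M i) (cyl G v))" for v
  proof (cases "v \<in> words G (length v)")
    case True then show ?thesis using lim_c by (auto simp: convergent_def)
  next
    case False
    then have "cyl G v = {}" by (rule cyl_empty)
    then show ?thesis by (simp add: convergent_const)
  qed
  obtain N where N: "N \<in> prob_measures G"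
    and lim: "\<And>A. A \<in> cylsets \<Longrightarrow> (\<lambda>i. measure (M i) A) \<longlonglongrightarrow> measure N A"
    using limit_measure_exists[of M, OF M conv] by blast
  \<comment> \<open>Hence closeness to \<open>c\<close> is closeness to \<open>N\<close> on genuine
    words, for every word in \<open>T i (n i)\<close> and not just for \<open>w i\<close>.\<close>
  have cN: "c v = measure N (cyl G v)" if "v \<in> words G k" for v k
    using LIMSEQ_unique[OF lim_c[OF that] lim[OF cyl_in_cylsets]] .
  have invariant: "N \<in> invariant_measures G"
  proof (rule invariantI[OF N])
    fix v
    have "(\<lambda>i. measure (M i) (shift -` cyl G v \<inter> paths G) - measure (M i) (cyl G v)) \<longlonglongrightarrow> 0"
    proof (rule Lim_null_comparison[OF _ inv0], intro always_eventually allI)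
      fix i
      have "\<bar>measure (M i) (shift -` cyl G v \<inter> paths G) - measure (M i) (cyl G v)\<bar> \<le> 1 / n i"
        unfolding M_def by (intro empirical_shift_diff npos rep_path[OF ww] cyl_sets)
      also have "\<dots> \<le> 1 / Suc i" using n[of i] by (intro divide_left_mono) auto
      finally show "norm (measure (M i) (shift -` cyl G v \<inter> paths G) - measure (M i) (cyl G v)) \<le> 1 / real (Suc i)"
        by simp
    qed
    moreover have "(\<lambda>i. measure (M i) (shift -` cyl G v \<inter> paths G) - measure (M i) (cyl G v)) \<longlonglongrightarrow>
        measure N (shift -` cyl G v \<inter> paths G) - measure N (cyl G v)"
      by (intro tendsto_diff lim shift_vimage_cylsets cyl_in_cylsets)
    ultimately show "measure N (shift -` cyl G v \<inter> paths G) = measure N (cyl G v)"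
      using LIMSEQ_unique by fastforce
  qed
  have "U N \<in> closure C"
    unfolding closure_approachable
  proof (intro allI impI)
    fix e :: real assume e: "e > 0"
    obtain A d where A: "finite A" "d > 0" "\<And>M. M \<in> prob_measures G \<Longrightarrow>
       (\<And>w. w \<in> A \<Longrightarrow> \<bar>measure M (cyl G w) - measure N (cyl G w)\<bar> < d) \<Longrightarrow> dist (U M) (U N) < e/2"
      using weak_continuous_near[OF U N, of "e/2"] e by (metis half_gt_zero)
    have "\<forall>\<^sub>F i in sequentially. dist (measure (M i) (cyl G v)) (measure N (cyl G v)) < d" for v
      using tendstoD[OF lim[OF cyl_in_cylsets] A(2)] .
    then have "\<forall>\<^sub>F i in sequentially. \<forall>v\<in>A. dist (measure (M i) (cyl G v)) (measure N (cyl G v)) < d"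
      by (intro eventually_ball_finite A(1)) auto
    moreover have "\<forall>\<^sub>F i in sequentially. 1 / real (Suc i) < e/2"
      by (rule order_tendstoD[OF inv0]) (use e in simp)
    ultimately have "\<forall>\<^sub>F i in sequentially.
        (\<forall>v\<in>A. dist (measure (M i) (cyl G v)) (measure N (cyl G v)) < d) \<and> 1 / real (Suc i) < e/2"
      by (rule eventually_conj)
    then obtain i where i: "\<forall>v\<in>A. dist (measure (M i) (cyl G v)) (measure N (cyl G v)) < d" "1 / real (Suc i) < e/2"
      by (auto simp: eventually_sequentially)
    have close: "dist (U (M i)) (U N) < e/2" by (rule A(3)[OF M]) (use i(1) in \<open>simp add: dist_real_def\<close>)
    have "U (M i) \<in> set_ball C (1 / Suc i)"
      using w[of i] rep_in_cyl[OF ww[of i]] unfolding T_def good_words_def M_def by blast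
    then obtain y where y: "y \<in> C" "dist (U (M i)) y < 1 / Suc i"
      unfolding set_ball_def by (auto elim: infdist_lessE)
    have "dist y (U N) \<le> dist (U (M i)) y + dist (U (M i)) (U N)" by (rule dist_triangle3)
    then show "\<exists>y\<in>C. dist y (U N) < e" using y i(2) close by (intro bexI[of _ y]) auto
  qed
  moreover have "s \<le> entropy_rate N + (\<integral>u. \<phi> u \<partial>N)"
  proof -
    let ?I = "\<integral>u. \<phi> u \<partial>N"
    have step: "s \<le> ?I + (word_entropy N (Suc q) - word_entropy N q)" for q
    proof (rule ccontr)
      assume neg: "\<not> s \<le> ?I + (word_entropy N (Suc q) - word_entropy N q)"
      define \<delta> where "\<delta> = s - ?I - (word_entropy N (Suc q) - word_entropy N q)"
      have \<delta>: "\<delta> > 0" using neg by (simp add: \<delta>_def)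
      \<comment> \<open>Six errors of size \<open>e\<close>: the factor \<open>K ^ q\<close>, the
        smoothing (\<open>\<eta>\<close> is chosen with \<open>ln (1 - \<eta>) = - e\<close>) and
        the frequency tolerance in the count; the integral and the distortion in
        \<open>cyl_sup\<close>; and the loss \<open>1 / Suc i\<close> in the rate.\<close>
      define e where "e = \<delta> / 6"
      have e: "e > 0" using \<delta> by (simp add: e_def)
      define \<eta> where "\<eta> = 1 - exp (- e)"
      have \<eta>: "0 < \<eta>" "\<eta> < 1" "ln (1 - \<eta>) = - e" using e by (auto simp: \<eta>_def)
      define K where "K = real (card (arcs G))"
      have K: "K > 0" unfolding K_def using arcs_nonempty by (simp add: card_gt_0_iff)
      obtain d where d: "d > 0" "\<And>n T. q \<le> n \<Longrightarrow> n > 0 \<Longrightarrow> T \<subseteq> words G n \<Longrightarrow>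
        (\<And>w v. w \<in> T \<Longrightarrow> v \<in> words G (Suc q) \<Longrightarrow> \<bar>freq n w v - measure N (cyl G v)\<bar> < d) \<Longrightarrow>
        card T \<le> real (card (arcs G)) ^ q *
          exp (n * (word_entropy N (Suc q) - word_entropy N q - ln (1 - \<eta>) + e))"
        using card_words_near[OF N \<eta>(1,2) e, of q] by blast
      obtain A d' where A: "finite A" "d' > 0"
        "\<And>M N. M \<in> prob_measures G \<Longrightarrow> N \<in> prob_measures G \<Longrightarrow>
          (\<And>w. w \<in> A \<Longrightarrow> \<bar>measure M (cyl G w) - measure N (cyl G w)\<bar> < d') \<Longrightarrow>
          \<bar>(\<integral>u. \<phi> u \<partial>M) - (\<integral>u. \<phi> u \<partial>N)\<bar> < e" by (rule integral_near[OF \<phi> e]) metis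
      obtain n0 where n0: "\<And>n u v. n \<ge> n0 \<Longrightarrow> u \<in> paths G \<Longrightarrow> v \<in> paths G \<Longrightarrow> initial n u = initial n v \<Longrightarrow>
        \<bar>birkhoff_sum \<phi> n u - birkhoff_sum \<phi> n v\<bar> \<le> e * n"
        using distortion[OF \<phi> e] by blast
      define m where "m = Max (length ` insert [] A)"
      have m: "length v \<le> m" if "v \<in> A" for v unfolding m_def using A(1) that by auto
      have "\<forall>\<^sub>F i in sequentially. 1 / real (Suc i) < min d (min d' e)"
        by (rule order_tendstoD[OF inv0]) (use e d A in simp)
      moreover have "\<forall>\<^sub>F i in sequentially. K ^ q \<le> exp (real i * e)"
        by (rule eventually_const_le_exp[OF e])
      ultimately have "\<forall>\<^sub>F i in sequentially. 1 / real (Suc i) < min d (min d' e) \<and> K ^ q \<le> exp (real i * e)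
          \<and> i \<ge> max (max m n0) (Suc q)"
        using eventually_ge_at_top[of "max (max m n0) (Suc q)"] by eventually_elim simp
      then obtain i where i: "1 / real (Suc i) < min d (min d' e)" "K ^ q \<le> exp (real i * e)"
          "i \<ge> m" "i \<ge> n0" "i \<ge> Suc q" by (auto simp: eventually_sequentially)
      have close: "\<bar>freq (n i) w v - measure N (cyl G v)\<bar> < 1 / Suc i"
        if "w \<in> T i (n i)" "v \<in> words G k" "k \<le> i" for w v k
      proof -
        have "v \<in> F i" using that by (auto simp: F_def)
        then show ?thesis using that(1) cN[OF that(2)] unfolding T_def by auto
      qed
      have sup: "cyl_sup \<phi> (n i) w \<le> exp (n i * (?I + 2 * e))" if w: "w \<in> T i (n i)" for w
      proof -
        have ww: "w \<in> words G (n i)" using w Tw by blast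
        have E: "empirical G (n i) (rep w) \<in> prob_measures G"
          by (intro empirical_prob npos rep_path[OF ww])
        have "\<bar>(\<integral>u. \<phi> u \<partial>(empirical G (n i) (rep w))) - ?I\<bar> < e"
        proof (rule A(3)[OF E N])
          fix v assume v: "v \<in> A"
          show "\<bar>measure (empirical G (n i) (rep w)) (cyl G v) - measure N (cyl G v)\<bar> < d'"
          proof (cases "v \<in> words G (length v)")
            case True
            then show ?thesis using close[OF w True] m[OF v] i by (simp add: freq_def)
          next
            case False
            then have "cyl G v = {}" by (rule cyl_empty)
            then show ?thesis using A(2) by simp
          qed
        qed
        then have int: "birkhoff_sum \<phi> (n i) (rep w) \<le> n i * (?I + e)"
          unfolding birkhoff_integral[OF \<phi> npos rep_path[OF ww]] by (intro mult_left_mono) auto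
        show ?thesis
        proof (rule cyl_sup_le[OF ww])
          fix u assume u: "u \<in> cyl G w"
          have "\<bar>birkhoff_sum \<phi> (n i) u - birkhoff_sum \<phi> (n i) (rep w)\<bar> \<le> e * n i"
            by (rule n0) (use u ww n[of i] i rep_path[OF ww] initial_rep[OF ww] in \<open>auto simp: cyl_word\<close>)
          then show "birkhoff_sum \<phi> (n i) u \<le> n i * (?I + 2 * e)" using int by (simp add: algebra_simps)
        qed
      qed
      have "card (T i (n i)) \<le> K ^ q *
          exp (n i * (word_entropy N (Suc q) - word_entropy N q - ln (1 - \<eta>) + e))"
        unfolding K_def
      proof (rule d(2)[OF _ npos Tw])
        show "q \<le> n i" using i n[of i] by simp
        fix w v assume "w \<in> T i (n i)" "v \<in> words G (Suc q)"
        from close[OF this] i show "\<bar>freq (n i) w v - measure N (cyl G v)\<bar> < d" by simp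
      qed
      also have "\<dots> \<le> exp (n i * e) * exp (n i * (word_entropy N (Suc q) - word_entropy N q - ln (1 - \<eta>) + e))"
      proof (intro mult_right_mono order_trans[OF i(2)])
        show "exp (real i * e) \<le> exp (n i * e)" using n[of i] e by (simp add: mult_right_mono)
      qed auto
      finally have card: "card (T i (n i)) \<le> exp (n i * (word_entropy N (Suc q) - word_entropy N q + 3 * e))"
        by (simp add: exp_add[symmetric] \<eta>(3) algebra_simps)
      have "exp (n i * (s - e)) \<le> exp (n i * (s - 1 / Suc i))"
        using i(1) by (simp add: mult_left_mono)
      also have "\<dots> < (\<Sum>w\<in>T i (n i). cyl_sup \<phi> (n i) w)" by (rule big)
      also have "\<dots> \<le> (\<Sum>w\<in>T i (n i). exp (n i * (?I + 2 * e)))" by (intro sum_mono sup)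
      also have "\<dots> = card (T i (n i)) * exp (n i * (?I + 2 * e))" by simp
      also have "\<dots> \<le> exp (n i * (word_entropy N (Suc q) - word_entropy N q + 3 * e)) * exp (n i * (?I + 2 * e))"
        by (intro mult_right_mono card) simp
      also have "\<dots> = exp (n i * (s - \<delta> + 5 * e))"
        by (simp add: exp_add[symmetric] \<delta>_def algebra_simps)
      finally have "n i * (s - e) < n i * (s - \<delta> + 5 * e)" by simp
      then have "s - e < s - \<delta> + 5 * e" using npos[of i] by simp
      then show False by (simp add: e_def)
    qed
    have "(s - ?I) * q \<le> word_entropy N q" for q
    proof (induction q)
      case 0 then show ?case using word_entropy_nonneg[OF N, of 0] by simp
    next
      case (Suc q) then show ?case using step[of q] by (simp add: algebra_simps)
    qed
    then have "s - ?I \<le> entropy_rate N" by (intro entropy_rate_ge) auto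
    then show ?thesis by simp
  qed
  ultimately show ?thesis using invariant by blast
qed

end

section \<open>The lower bound for the pressure\<close>

lemma ln_fact_bounds:
  shows "real n * ln n - n \<le> ln (fact n)"
    and "ln (fact n) \<le> real n * ln n - n + 1 + ln n"
proof -
  \<comment> \<open>Both inductions follow from these increments of the logarithm; the start
    \<open>n = 0\<close> holds because \<open>ln 0 = 0\<close>.\<close>
  have step: "1 / (real n + 1) \<le> ln (real (Suc n)) - ln n" "ln (real (Suc n)) - ln n \<le> 1 / n" if "n > 0" for n
  proof -
    have "ln (real n / real (Suc n)) \<le> real n / real (Suc n) - 1"
      "ln (real (Suc n) / real n) \<le> real (Suc n) / real n - 1"
      using that by (intro ln_le_minus_one; simp)+
    then show "1 / (real n + 1) \<le> ln (real (Suc n)) - ln n" "ln (real (Suc n)) - ln n \<le> 1 / n"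
      using that by (simp_all add: ln_div field_simps)
  qed
  have ln_fact_Suc: "ln (fact (Suc n)) = ln (real (Suc n)) + ln (fact n :: real)" for n
    by (simp add: ln_mult del: of_nat_Suc)
  show "real n * ln n - n \<le> ln (fact n)"
  proof (induction n)
    case (Suc n)
    show ?case
    proof (cases "n = 0")
      case False
      then have "real n * (ln (real (Suc n)) - ln n) \<le> real n * (1 / n)"
        by (intro mult_left_mono step) auto
      then have "real n * ln (real (Suc n)) - real n * ln n \<le> 1" using False by (simp add: right_diff_distrib)
      moreover have "real (Suc n) * ln (real (Suc n)) = real n * ln (real (Suc n)) + ln (real (Suc n))"
        by (simp add: distrib_right)
      ultimately show ?thesis using Suc unfolding ln_fact_Suc by linarith
    qed simp
  qed simp
  show "ln (fact n) \<le> real n * ln n - n + 1 + ln n"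
  proof (induction n)
    case (Suc n)
    show ?case
    proof (cases "n = 0")
      case False
      then have "(real n + 1) * (1 / (real n + 1)) \<le> (real n + 1) * (ln (real (Suc n)) - ln n)"
        by (intro mult_left_mono step) auto
      then have "1 \<le> real n * ln (real (Suc n)) - real n * ln n + ln (real (Suc n)) - ln n"
        by (simp add: algebra_simps)
      moreover have "real (Suc n) * ln (real (Suc n)) = real n * ln (real (Suc n)) + ln (real (Suc n))"
        by (simp add: distrib_right)
      ultimately show ?thesis using Suc unfolding ln_fact_Suc by linarith
    qed simp
  qed simp
qed

text \<open>Stirling's bounds turn the logarithm of the multinomial coefficient into
  \<open>j\<close> times the entropy of \<open>p\<close>, up to a constant and a multiple of
  \<open>ln j\<close>. Rounding down loses less than one unit for each element of
  \<open>X\<close>.\<close>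

lemma multinomial_entropy_bound:
  fixes p :: "'a \<Rightarrow> real" and j :: nat
  assumes X: "finite X" and p: "\<And>b. b \<in> X \<Longrightarrow> 0 \<le> p b" "(\<Sum>b\<in>X. p b) = 1" and j: "j > 0" "j > card X"
  defines "m \<equiv> \<lambda>b. nat \<lfloor>j * p b\<rfloor>"
  shows "(\<Sum>b\<in>X. m b) \<le> j" "j \<le> (\<Sum>b\<in>X. m b) + card X"
    and "ln (fact (\<Sum>b\<in>X. m b)) - (\<Sum>b\<in>X. ln (fact (m b))) \<ge>
      j * (- (\<Sum>b\<in>X. p b * ln (p b))) + (\<Sum>b\<in>X. ln (p b)) - 2 * card X - card X * ln j"
proof -
  have m: "real (m b) \<le> j * p b" "j * p b \<le> real (m b) + 1" if "b \<in> X" for b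
  proof -
    have "real (m b) = of_int \<lfloor>j * p b\<rfloor>" using p(1)[OF that] unfolding m_def by simp
    then show "real (m b) \<le> j * p b" "j * p b \<le> real (m b) + 1" by linarith+
  qed
  have sum_jp: "(\<Sum>b\<in>X. j * p b) = j" using p(2) by (simp add: sum_distrib_left[symmetric])
  have "real (\<Sum>b\<in>X. m b) \<le> (\<Sum>b\<in>X. j * p b)" unfolding of_nat_sum by (intro sum_mono m)
  then show le: "(\<Sum>b\<in>X. m b) \<le> j" by (simp only: sum_jp of_nat_le_iff)
  have "(\<Sum>b\<in>X. j * p b) \<le> (\<Sum>b\<in>X. real (m b) + 1)" by (intro sum_mono m)
  then have "real j \<le> real ((\<Sum>b\<in>X. m b) + card X)" using sum_jp by (simp add: sum.distrib)
  then show ge: "j \<le> (\<Sum>b\<in>X. m b) + card X" by (simp only: of_nat_le_iff)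
  define J where "J = (\<Sum>b\<in>X. m b)"
  have J: "J > 0" "real j - card X \<le> J" using ge j unfolding J_def by linarith+
  have p1: "p b \<le> 1" if "b \<in> X" for b
    using member_le_sum[OF that, of p] p X by auto
  \<comment> \<open>Since \<open>ln (p b) \<le> 0\<close>, the lower bound
    \<open>j * p b - 1\<close> for \<open>m b\<close> is the one to use in front of it; elements
    with \<open>p b = 0\<close> contribute no logarithm, as \<open>ln 0 = 0\<close>.\<close>
  have fact_le: "ln (fact (m b)) \<le> m b * ln j + (j * p b - 1) * ln (p b) - m b + 1 + ln j" if b: "b \<in> X" for b
  proof (cases "m b = 0")
    case True
    have "(j * p b - 1) * ln (p b) \<ge> 0"
    proof (cases "p b = 0")
      case False
      then show ?thesis using p1[OF b] p(1)[OF b] m(2)[OF b] True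
        by (intro mult_nonpos_nonpos) auto
    qed simp
    then show ?thesis using True j by simp
  next
    case False
    then have pb: "p b > 0" using m(1)[OF b] j p(1)[OF b] by (cases "p b = 0") auto
    have "ln (real (m b)) \<le> ln (j * p b)" using False m(1)[OF b] by simp
    also have "\<dots> = ln j + ln (p b)" using pb j by (simp add: ln_mult)
    finally have ln_m: "ln (real (m b)) \<le> ln j + ln (p b)" .
    have lnp: "ln (p b) \<le> 0" using pb p1[OF b] by simp
    have "real (m b) * ln (m b) \<le> m b * (ln j + ln (p b))" using ln_m by (intro mult_left_mono) auto
    moreover have "m b * ln (p b) \<le> (j * p b - 1) * ln (p b)"
      using m(2)[OF b] lnp by (intro mult_right_mono_neg) auto
    moreover have "ln (real (m b)) \<le> ln j" using ln_m lnp by simp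
    ultimately show ?thesis using ln_fact_bounds(2)[of "m b"] by (simp add: algebra_simps)
  qed
  have "(\<Sum>b\<in>X. ln (fact (m b))) \<le> (\<Sum>b\<in>X. m b * ln j + (j * p b - 1) * ln (p b) - m b + 1 + ln j)"
    by (intro sum_mono fact_le)
  also have "\<dots> = J * ln j + j * (\<Sum>b\<in>X. p b * ln (p b)) - (\<Sum>b\<in>X. ln (p b)) - J + card X + card X * ln j"
    by (simp add: J_def sum.distrib sum_subtractf algebra_simps sum_distrib_left sum_distrib_right)
  finally have upper: "(\<Sum>b\<in>X. ln (fact (m b))) \<le>
      J * ln j + j * (\<Sum>b\<in>X. p b * ln (p b)) - (\<Sum>b\<in>X. ln (p b)) - J + card X + card X * ln j" .
  \<comment> \<open>Replaces \<open>ln J\<close> by \<open>ln j\<close>, at a cost of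
    \<open>J * ln (j / J) \<le> j - J \<le> card X\<close>.\<close>
  have "ln (real j / J) \<le> real j / J - 1" by (rule ln_le_minus_one) (use j J in simp)
  then have "J * ln (real j / J) \<le> J * (real j / J - 1)" by (intro mult_left_mono) auto
  also have "\<dots> = real j - J" using J by (simp add: right_diff_distrib)
  finally have "J * ln (real j / J) \<le> card X" using J by simp
  then have "J * ln j - J * ln J \<le> card X" using J j by (simp add: ln_div right_diff_distrib)
  then show "ln (fact (\<Sum>b\<in>X. m b)) - (\<Sum>b\<in>X. ln (fact (m b))) \<ge>
      j * (- (\<Sum>b\<in>X. p b * ln (p b))) + (\<Sum>b\<in>X. ln (p b)) - 2 * card X - card X * ln j"
    using upper ln_fact_bounds(1)[of J] unfolding J_def[symmetric] by simp
qed

lemma sum_list_mset_sum: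
  fixes f :: "'a \<Rightarrow> real"
  assumes X: "finite X" and xs: "mset xs = (\<Sum>b\<in>X. replicate_mset (m b) b)"
  shows "(\<Sum>x\<leftarrow>xs. f x) = (\<Sum>b\<in>X. m b * f b)"
proof -
  have "(\<Sum>x\<in>#(\<Sum>b\<in>X. replicate_mset (m b) b). f x) = (\<Sum>b\<in>X. m b * f b)"
    using X by induction simp_all
  then show ?thesis using xs by (metis mset_map sum_mset_sum_list)
qed

lemma set_mset_sum_replicate:
  assumes "finite X" shows "set_mset (\<Sum>b\<in>X. replicate_mset (m b) b) \<subseteq> X"
  using assms by (auto simp: set_mset_sum split: if_splits)

lemma ln_card_permutations:
  fixes m :: "'a \<Rightarrow> nat"
  assumes X: "finite X"
  defines "A \<equiv> \<Sum>b\<in>X. replicate_mset (m b) b"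
  shows "ln (card (permutations_of_multiset A)) = ln (fact (\<Sum>b\<in>X. m b)) - (\<Sum>b\<in>X. ln (fact (m b)))"
proof -
  have count: "count A b = m b" if "b \<in> X" for b
    unfolding A_def count_sum using that X by (simp add: sum.delta)
  have sub: "set_mset A \<subseteq> X" unfolding A_def by (rule set_mset_sum_replicate[OF X])
  have size: "size A = (\<Sum>b\<in>X. m b)" unfolding A_def using X by induction simp_all
  have "(\<Prod>b\<in>set_mset A. fact (count A b)) = (\<Prod>b\<in>X. fact (count A b) :: nat)"
    by (rule prod.mono_neutral_left[OF X sub]) (auto simp: not_in_iff)
  also have "\<dots> = (\<Prod>b\<in>X. fact (m b))" by (intro prod.cong refl) (simp add: count)
  finally have prod: "(\<Prod>b\<in>set_mset A. fact (count A b)) = (\<Prod>b\<in>X. fact (m b) :: nat)" .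
  have "card (permutations_of_multiset A) * (\<Prod>b\<in>X. fact (m b)) = fact (\<Sum>b\<in>X. m b)"
    using card_permutations_of_multiset_aux[of A] unfolding prod size .
  then have "real (card (permutations_of_multiset A) * (\<Prod>b\<in>X. fact (m b))) = real (fact (\<Sum>b\<in>X. m b))"
    by (rule arg_cong)
  then have "real (card (permutations_of_multiset A)) * (\<Prod>b\<in>X. fact (m b)) = fact (\<Sum>b\<in>X. m b)"
    by simp
  then have eq: "real (card (permutations_of_multiset A)) = fact (\<Sum>b\<in>X. m b) / (\<Prod>b\<in>X. fact (m b))"
    using X by (subst nonzero_eq_divide_eq) auto
  have "ln (real (card (permutations_of_multiset A))) = ln (fact (\<Sum>b\<in>X. m b)) - ln (\<Prod>b\<in>X. fact (m b))"
  proof -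
    have "(\<Prod>b\<in>X. fact (m b) :: real) > 0" by (intro prod_pos) simp
    then show ?thesis unfolding eq by (simp add: ln_div)
  qed
  then show ?thesis using X by (simp add: ln_prod)
qed

text \<open>Concatenated code words \<open>p b @ b @ q b\<close> are decoded from left to right once the lengths of the
  prefixes \<open>p b\<close> are known.\<close>

lemma concat_code_inject:
  assumes code: "\<And>b. code b = p b @ b @ q b"
    and "\<And>b. b \<in> set bs \<Longrightarrow> length b = k" "\<And>b. b \<in> set bs' \<Longrightarrow> length b = k"
    and "concat (map code bs) = concat (map code bs')"
    and "map (\<lambda>b. length (p b)) bs = map (\<lambda>b. length (p b)) bs'"
  shows "bs = bs'"
  using assms(2-)
proof (induction bs arbitrary: bs')
  case (Cons b bs)
  then obtain b' cs where bs': "bs' = b' # cs" by (cases bs') auto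
  have len: "length (p b) = length (p b')" "length b = length b'" using Cons.prems bs' by auto
  have "p b @ b @ q b @ concat (map code bs) = p b' @ b' @ q b' @ concat (map code cs)"
    using Cons.prems(3) bs' code[of b] code[of b'] by simp
  then have "b = b'" "q b @ concat (map code bs) = q b' @ concat (map code cs)" using len by auto
  then have "b = b'" "concat (map code bs) = concat (map code cs)" by auto
  moreover have "bs = cs"
    by (rule Cons.IH) (use Cons.prems bs' \<open>concat (map code bs) = concat (map code cs)\<close> in auto)
  ultimately show ?case using bs' by simp
qed simp

text \<open>A list of blocks is recovered from its concatenation together with the lengths of the
  prefixes, and there are at most \<open>Suc L ^ J\<close> vectors of such lengths.\<close>

lemma card_concat_code:
  assumes code: "\<And>b. code b = p b @ b @ q b" and p: "\<And>b. length (p b) \<le> L"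
    and S: "finite S" "\<And>bs. bs \<in> S \<Longrightarrow> length bs = J" "\<And>bs b. bs \<in> S \<Longrightarrow> b \<in> set bs \<Longrightarrow> length b = k"
  shows "card S \<le> card ((\<lambda>bs. concat (map code bs)) ` S) * Suc L ^ J"
proof -
  let ?f = "\<lambda>bs. (concat (map code bs), map (\<lambda>b. length (p b)) bs)"
  let ?W = "(\<lambda>bs. concat (map code bs)) ` S"
  let ?L = "{ls. set ls \<subseteq> {..L} \<and> length ls = J}"
  have "inj_on ?f S"
    by (rule inj_onI) (use concat_code_inject[of code p q _ k, OF code] S(3) in auto)
  moreover have "?f ` S \<subseteq> ?W \<times> ?L" using p S(2) by auto
  ultimately have "card S \<le> card (?W \<times> ?L)"
    using S(1) by (intro card_inj_on_le finite_cartesian_product finite_imageI finite_lists_length_eq) auto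
  then show ?thesis by (simp add: card_cartesian_product card_lists_length_eq)
qed

section \<open>Loops at a fixed vertex and typical words\<close>

context graph_shift
begin

lemma birkhoff_sum_concat:
  fixes code :: "'b \<Rightarrow> 'e list" and a :: "'b \<Rightarrow> real" and c :: real
  assumes block: "\<And>b u. b \<in> set bs \<Longrightarrow> u \<in> paths G \<Longrightarrow> initial (length (code b)) u = code b \<Longrightarrow>
      \<bar>birkhoff_sum g (length (code b)) u - a b\<bar> \<le> c"
    and u: "u \<in> paths G" "initial (length (concat (map code bs))) u = concat (map code bs)"
  shows "\<bar>birkhoff_sum g (length (concat (map code bs))) u - (\<Sum>b\<leftarrow>bs. a b)\<bar> \<le> length bs * c"
  using assms
proof (induction bs arbitrary: u)
  case Nil
  then show ?case by (simp add: birkhoff_sum_def)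
next
  case (Cons b bs)
  let ?w = "concat (map code bs)"
  let ?v = "(shift ^^ length (code b)) u"
  have "initial (length (code b)) u @ initial (length ?w) ?v = code b @ ?w"
    using Cons.prems(3) by (simp add: initial_add)
  then have 1: "initial (length (code b)) u = code b" and 2: "initial (length ?w) ?v = ?w" by auto
  have "\<bar>birkhoff_sum g (length (code b)) u - a b\<bar> \<le> c" using Cons.prems 1 by auto
  moreover have "\<bar>birkhoff_sum g (length ?w) ?v - (\<Sum>b\<leftarrow>bs. a b)\<bar> \<le> length bs * c"
    by (rule Cons.IH) (use Cons.prems 2 in \<open>auto intro: paths_shift_power\<close>)
  moreover have "birkhoff_sum g (length (concat (map code (b # bs)))) u =
      birkhoff_sum g (length (code b)) u + birkhoff_sum g (length ?w) ?v"
    by (simp add: birkhoff_sum_add)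
  ultimately show ?case by (simp add: algebra_simps)
qed

lemma awalk_concat:
  assumes "x \<in> verts G" "\<And>b. b \<in> set bs \<Longrightarrow> awalk x (code b) x"
  shows "awalk x (concat (map code bs)) x"
  using assms
proof (induction bs)
  case (Cons b bs)
  show ?case unfolding list.map concat.simps
    by (rule awalk_appendI[of x _ x]) (use Cons in auto)
qed (simp add: awalk_Nil_iff)

text \<open>Strong connectivity gives walks between \<open>x\<close> and every vertex in both
  directions; as there are finitely many vertices, their lengths have a common bound
  \<open>L\<close>, whatever the length of the block.\<close>

lemma loop_codes_exist:
  obtains x L p q where "x \<in> verts G"
    "\<And>k b. b \<in> words G k \<Longrightarrow> k > 0 \<Longrightarrow> awalk x (p b @ b @ q b) x"
    "\<And>b :: 'e list. length (p b) \<le> L" "\<And>b :: 'e list. length (q b) \<le> (L::nat)"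
proof -
  obtain x where x: "x \<in> verts G" using strongly_connected by (auto simp: strongly_connected_def)
  \<comment> \<open>The empty default outside the graph makes the bound \<open>L\<close> valid for
    arbitrary lists.\<close>
  define P where "P y = (if y \<in> verts G then SOME w. awalk x w y else [])" for y
  define Q where "Q y = (if y \<in> verts G then SOME w. awalk y w x else [])" for y
  have P: "awalk x (P y) y" if "y \<in> verts G" for y
    unfolding P_def using someI_ex[OF awalk_exists[OF x that]] that by simp
  have Q: "awalk y (Q y) x" if "y \<in> verts G" for y
    unfolding Q_def using someI_ex[OF awalk_exists[OF that x]] that by simp
  define L where "L = Max (insert 0 ((\<lambda>y. length (P y)) ` verts G \<union> (\<lambda>y. length (Q y)) ` verts G))"
  have L: "length (P y) \<le> L" "length (Q y) \<le> L" for y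
    by (cases "y \<in> verts G"; force simp: L_def P_def Q_def intro!: Max_ge)+
  show ?thesis
  proof (rule that[OF x, of "\<lambda>b. P (tail G (hd b))" "\<lambda>b. Q (head G (last b))" L])
    fix k b assume b: "b \<in> words G k" "k > 0"
    have w: "awalk (tail G (hd b)) b (head G (last b))" by (rule words_imp_awalk[OF b])
    then show "awalk x (P (tail G (hd b)) @ b @ Q (head G (last b))) x"
    proof (intro awalk_appendI[OF P awalk_appendI[OF w Q]])
      have "b \<noteq> []" "set b \<subseteq> arcs G" using b by (auto simp: words_def)
      then have "hd b \<in> arcs G" "last b \<in> arcs G" by auto
      then show "tail G (hd b) \<in> verts G" "head G (last b) \<in> verts G" by auto
    qed
  qed (rule L)+
qed

lemma integral_birkhoff_sum:
  assumes M: "M \<in> invariant_measures G" and g: "continuous_map (path_topology G) euclideanreal g"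
  shows "integrable M (birkhoff_sum g n)" "(\<integral>u. birkhoff_sum g n u \<partial>M) = n * (\<integral>u. g u \<partial>M)"
proof -
  interpret measure_preserving M shift using M by (rule invariant_measure_preserving)
  have gi: "integrable M g" by (rule integrable_continuous[OF g invariant_imp_prob[OF M]])
  have i: "integrable M (\<lambda>u. g ((shift ^^ k) u))" for k
    by (rule integrable_distr[OF measurable_T_power]) (simp add: distr_T_power gi)
  have "(\<integral>u. g u \<partial>(distr M M (shift ^^ k))) = (\<integral>u. g ((shift ^^ k) u) \<partial>M)" for k
    by (intro integral_distr measurable_T_power borel_measurable_integrable gi)
  then have eq: "(\<integral>u. g ((shift ^^ k) u) \<partial>M) = (\<integral>u. g u \<partial>M)" for k
    by (simp add: distr_T_power)
  show "integrable M (birkhoff_sum g n)" unfolding birkhoff_sum_def[abs_def] using i by simp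
  show "(\<integral>u. birkhoff_sum g n u \<partial>M) = n * (\<integral>u. g u \<partial>M)"
    unfolding birkhoff_sum_def using i eq by (simp add: Bochner_Integration.integral_sum)
qed

text \<open>Up to controlled errors, the Birkhoff sum along a concatenation depends only on the
  multiset of blocks, so all orders are equally typical. The block length \<open>N\<close> is fixed
  before the number \<open>j\<close>: a large \<open>N\<close> makes the loops cheap, a large
  \<open>j\<close> makes rounding and the Stirling errors negligible.\<close>

lemma many_typical_words:
  fixes e :: real and \<G> :: "((nat \<Rightarrow> 'e) \<Rightarrow> real) set"
  assumes M: "M \<in> invariant_measures G" and fin: "finite \<G>"
    and cont: "\<And>g. g \<in> \<G> \<Longrightarrow> continuous_map (path_topology G) euclideanreal g" and e: "e > 0"
  shows "\<exists>n\<ge>n0. n > 0 \<and> (\<exists>W\<subseteq>words G n.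
    (\<forall>w\<in>W. \<forall>u\<in>cyl G w. \<forall>g\<in>\<G>. \<bar>birkhoff_sum g n u - n * (\<integral>u. g u \<partial>M)\<bar> \<le> e * n) \<and>
    exp (n * (entropy_rate M - e)) \<le> card W)"
proof -
  note P = invariant_imp_prob[OF M]
  interpret prob_space M using P by (rule prob_space_prob_measures)
  have "\<forall>g\<in>\<G>. \<exists>B. \<forall>u\<in>paths G. \<bar>g u\<bar> \<le> B"
  proof
    fix g assume g: "g \<in> \<G>"
    obtain B where "B > 0" "\<And>u. u \<in> paths G \<Longrightarrow> \<bar>g u\<bar> \<le> B"
      using bounded_continuous_map[OF cont[OF g]] by blast
    then show "\<exists>B. \<forall>u\<in>paths G. \<bar>g u\<bar> \<le> B" by blast
  qed
  from bchoice[OF this] obtain b where b: "\<And>g u. g \<in> \<G> \<Longrightarrow> u \<in> paths G \<Longrightarrow> \<bar>g u\<bar> \<le> b g" by blast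
  define B where "B = Max (insert 1 (b ` \<G>))"
  have B1: "B \<ge> 1" unfolding B_def using fin by (intro Max_ge) auto
  have B: "\<bar>g u\<bar> \<le> B" if "g \<in> \<G>" "u \<in> paths G" for g u
  proof -
    have "b g \<le> B" unfolding B_def using fin that by (intro Max_ge) auto
    then show ?thesis using b[OF that] by simp
  qed
  obtain x L p q where x: "x \<in> verts G"
    and loop: "\<And>k b. b \<in> words G k \<Longrightarrow> k > 0 \<Longrightarrow> awalk x (p b @ b @ q b) x"
    and L: "\<And>b :: 'e list. length (p b) \<le> L" "\<And>b :: 'e list. length (q b) \<le> (L::nat)"
    using loop_codes_exist by metis
  define code where "code b = p b @ b @ q b" for b
  \<comment> \<open>Distortion is paid three times, once inside the blocks and, because of
    \<open>j \<le> 2 * J\<close>, twice in the passage to the integral; that is \<open>e / 4\<close>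
    per letter. Loops and rounding take another \<open>e / 4\<close> each.\<close>
  define \<delta> where "\<delta> = e / 12"
  have \<delta>: "\<delta> > 0" using e by (simp add: \<delta>_def)
  have "\<forall>g\<in>\<G>. \<exists>k. \<forall>n\<ge>k. \<forall>u\<in>paths G. \<forall>v\<in>paths G. initial n u = initial n v \<longrightarrow>
      \<bar>birkhoff_sum g n u - birkhoff_sum g n v\<bar> \<le> \<delta> * n"
    using distortion[OF cont \<delta>] by blast
  from bchoice[OF this] obtain k where
    "\<forall>g\<in>\<G>. \<forall>n\<ge>k g. \<forall>u\<in>paths G. \<forall>v\<in>paths G. initial n u = initial n v \<longrightarrow>
      \<bar>birkhoff_sum g n u - birkhoff_sum g n v\<bar> \<le> \<delta> * n" by (elim exE)
  then have k: "\<And>g n u v. g \<in> \<G> \<Longrightarrow> n \<ge> k g \<Longrightarrow> u \<in> paths G \<Longrightarrow> v \<in> paths G \<Longrightarrow>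
      initial n u = initial n v \<Longrightarrow> \<bar>birkhoff_sum g n u - birkhoff_sum g n v\<bar> \<le> \<delta> * n" by blast
  define h where "h = entropy_rate M"
  have h: "h \<ge> 0" unfolding h_def by (rule entropy_rate_nonneg[OF M])
  \<comment> \<open>From \<open>N \<ge> R\<close> follow \<open>16 * L * B \<le> N * e\<close>,
    which bounds the Birkhoff sums along the loops, and
    \<open>8 * L * h + 4 * ln (Suc L) \<le> N * e\<close>, which pays for the added length and for
    the ambiguity of decoding.\<close>
  define R where "R = (16 * L * B + 8 * L * h + 4 * ln (Suc L)) / e"
  define N where "N = Max (insert 1 (insert (nat \<lceil>R\<rceil>) (k ` \<G>)))"
  have N: "i \<le> N" if "i \<in> insert 1 (insert (nat \<lceil>R\<rceil>) (k ` \<G>))" for i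
    unfolding N_def by (rule Max_ge) (use fin that in auto)
  have N1: "N \<ge> 1" and NR: "N \<ge> nat \<lceil>R\<rceil>" by (rule N, simp)+
  have Nk: "N \<ge> k g" if "g \<in> \<G>" for g by (rule N) (use that in simp)
  have "R \<le> N" using NR by linarith
  then have NR': "16 * L * B + 8 * L * h + 4 * ln (Suc L) \<le> N * e"
    using e by (simp add: R_def field_simps)
  have N2: "16 * L * B \<le> N * e" "8 * L * h + 4 * ln (Suc L) \<le> N * e"
  proof -
    have "0 \<le> 16 * L * B" "0 \<le> 8 * L * h" "0 \<le> 4 * ln (Suc L)" using B1 h by auto
    then show "16 * L * B \<le> N * e" "8 * L * h + 4 * ln (Suc L) \<le> N * e" using NR' by linarith+
  qed
  define X where "X = words G N"
  have X: "finite X" by (simp add: X_def)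
  define D where "D = card X"
  define pr where "pr b = measure M (cyl G b)" for b
  have pr: "\<And>b. b \<in> X \<Longrightarrow> 0 \<le> pr b" "(\<Sum>b\<in>X. pr b) = 1"
    using sum_measure_cyl[OF P, of N] by (auto simp: pr_def X_def)
  define H where "H = - (\<Sum>b\<in>X. pr b * ln (pr b))"
  have H: "N * h \<le> H"
    using entropy_rate_le[OF M N1] N1 by (simp add: h_def H_def word_entropy_def X_def pr_def field_simps)
  define E where "E = 2 * D - (\<Sum>b\<in>X. ln (pr b))"
  have "((\<lambda>j. (E + D * ln (real j)) / real j) \<longlongrightarrow> 0) sequentially" by real_asymp
  then have "\<forall>\<^sub>F j in sequentially. (E + D * ln (real j)) / real j < N * e / 4"
    by (rule order_tendstoD) (use N1 e in simp)
  \<comment> \<open>The first threshold makes the effect of rounding on Birkhoff sums small. The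
    second gives \<open>J \<ge> j / 2\<close>, as at most \<open>D\<close> blocks are lost by
    rounding, and with it the third gives \<open>J > n0\<close>.\<close>
  moreover have "\<forall>\<^sub>F j in sequentially. j \<ge> max (nat \<lceil>16 * D * B / e\<rceil>) (max (2 * D + 1) (2 * n0 + 2))"
    by (rule eventually_ge_at_top)
  ultimately have "\<forall>\<^sub>F j in sequentially. (E + D * ln (real j)) / real j < N * e / 4 \<and>
      j \<ge> max (nat \<lceil>16 * D * B / e\<rceil>) (max (2 * D + 1) (2 * n0 + 2))" by (rule eventually_conj)
  then obtain j where j: "(E + D * ln (real j)) / real j < N * e / 4"
      "j \<ge> nat \<lceil>16 * D * B / e\<rceil>" "j \<ge> 2 * D + 1" "j \<ge> 2 * n0 + 2"
    by (auto simp: eventually_sequentially)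
  have j0: "j > 0" "j > card X" using j by (auto simp: D_def)
  have j1: "E + D * ln (real j) \<le> j * (N * e / 4)" using j(1) j0 by (simp add: field_simps)
  have "16 * D * B / e \<le> j" using j(2) by linarith
  then have j2: "16 * D * B \<le> j * e" using e by (simp add: field_simps)
  define m where "m b = nat \<lfloor>j * pr b\<rfloor>" for b
  define J where "J = (\<Sum>b\<in>X. m b)"
  note bounds = multinomial_entropy_bound[OF X pr j0, folded m_def]
  have J: "J \<le> j" "j \<le> J + D" using bounds(1,2) by (auto simp: J_def D_def)
  have J2: "real j \<le> 2 * J" "n0 < J" using J j by linarith+
  define A where "A = (\<Sum>b\<in>X. replicate_mset (m b) b)"
  define S where "S = permutations_of_multiset A"
  have mset_S: "mset bs = A" if "bs \<in> S" for bs using that by (simp add: S_def permutations_of_multisetD)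
  have set_S: "set bs \<subseteq> X" if "bs \<in> S" for bs
    using set_mset_sum_replicate[OF X, of m] mset_S[OF that] by (simp add: A_def flip: set_mset_mset)
  have sum_S: "(\<Sum>b\<leftarrow>bs. f b) = (\<Sum>b\<in>X. m b * f b)" if "bs \<in> S" for bs and f :: "'e list \<Rightarrow> real"
    using sum_list_mset_sum[OF X] mset_S[OF that] by (simp add: A_def)
  have len_S: "length bs = J" if "bs \<in> S" for bs
  proof -
    have "real (length bs) = real J" using sum_S[OF that, of "\<lambda>_. 1"] by (simp add: J_def sum_list_triv)
    then show ?thesis by simp
  qed
  define n where "n = (\<Sum>b\<in>X. m b * length (code b))"
  have len_X: "length b = N" if "b \<in> X" for b using that by (simp add: X_def length_words)
  have len_concat: "length (concat (map code bs)) = n" if "bs \<in> S" for bs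
  proof -
    have "real (length (concat (map code bs))) = (\<Sum>b\<leftarrow>bs. real (length (code b)))"
      by (induction bs) auto
    also have "\<dots> = real n" using sum_S[OF that] by (simp add: n_def)
    finally show ?thesis by simp
  qed
  have n: "N * J \<le> n" "n \<le> (N + 2 * L) * J"
  proof -
    have "(\<Sum>b\<in>X. m b * N) \<le> n" unfolding n_def by (intro sum_mono) (simp add: code_def len_X)
    then show "N * J \<le> n" by (simp only: J_def sum_distrib_left mult.commute)
    have "n \<le> (\<Sum>b\<in>X. m b * (N + 2 * L))" unfolding n_def
    proof (intro sum_mono mult_left_mono)
      fix b assume "b \<in> X"
      then show "length (code b) \<le> N + 2 * L" using L[of b] by (simp add: code_def len_X)
    qed simp
    also have "\<dots> = (N + 2 * L) * J" unfolding J_def sum_distrib_left by (simp only: mult.commute)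
    finally show "n \<le> (N + 2 * L) * J" .
  qed
  have n': "real N * J \<le> n" "real n \<le> (N + 2 * L) * real J"
    using n by (simp_all only: flip: of_nat_mult of_nat_le_iff[where 'a = real])
  have Jn: "J \<le> n" using n(1) N1 by (metis mult_le_mono1 mult_1 order_trans)
  define W where "W = (\<lambda>bs. concat (map code bs)) ` S"
  have typical: "\<bar>birkhoff_sum g n u - n * (\<integral>u. g u \<partial>M)\<bar> \<le> e * n"
    if g: "g \<in> \<G>" and w: "w \<in> W" "u \<in> cyl G w" for g w u
  proof -
    obtain bs where bs: "bs \<in> S" "w = concat (map code bs)" using w(1) by (auto simp: W_def)
    have u: "u \<in> paths G" "initial n u = w" using w(2) len_concat[OF bs(1)] bs(2) by (auto simp: cyl_eq)
    define a where "a b = birkhoff_sum g N (rep b)" for b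
    let ?I = "\<integral>u. g u \<partial>M"
    have block: "\<bar>birkhoff_sum g (length (code b)) v - a b\<bar> \<le> \<delta> * N + 2 * (L * B)"
      if bX: "b \<in> X" and v: "v \<in> paths G" "initial (length (code b)) v = code b" for b v
    proof -
      let ?v = "(shift ^^ length (p b)) v"
      let ?v' = "(shift ^^ N) ?v"
      have len: "length (code b) = length (p b) + (N + length (q b))" by (simp add: code_def len_X[OF bX])
      have "initial (length (p b)) v @ initial N ?v @ initial (length (q b)) ?v' = p b @ b @ q b"
        using v(2)[unfolded len initial_add] by (simp only: code_def)
      then have "initial N ?v = b" using len_X[OF bX] by auto
      then have "\<bar>birkhoff_sum g N ?v - a b\<bar> \<le> \<delta> * N"
        unfolding a_def using bX
        by (intro k g Nk paths_shift_power v) (auto simp: X_def initial_rep rep_path)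
      moreover have "\<bar>birkhoff_sum g (length (p b)) v\<bar> \<le> length (p b) * B"
        "\<bar>birkhoff_sum g (length (q b)) ?v'\<bar> \<le> length (q b) * B"
        by (intro abs_birkhoff_sum_le[of _ G] B g paths_shift_power v; assumption)+
      moreover have "length (p b) * B \<le> L * B" "length (q b) * B \<le> L * B"
        using L[of b] B1 by (auto intro!: mult_right_mono)
      ultimately show ?thesis unfolding len birkhoff_sum_add by linarith
    qed
    \<comment> \<open>From the Birkhoff sum to \<open>n * ?I\<close> in four comparisons: with the
      block values taken \<open>m b\<close> times, with the unrounded multiplicities
      \<open>j * pr b\<close>, with \<open>j * (N * ?I)\<close>, and finally with the true length
      \<open>n\<close> in place of \<open>j * N\<close>.\<close>
    have 1: "\<bar>birkhoff_sum g n u - (\<Sum>b\<in>X. m b * a b)\<bar> \<le> J * (\<delta> * N + 2 * (L * B))"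
    proof -
      have "\<bar>birkhoff_sum g (length (concat (map code bs))) u - (\<Sum>b\<leftarrow>bs. a b)\<bar>
          \<le> length bs * (\<delta> * N + 2 * (L * B))"
      proof (rule birkhoff_sum_concat)
        fix b v assume "b \<in> set bs" "v \<in> paths G" "initial (length (code b)) v = code b"
        then show "\<bar>birkhoff_sum g (length (code b)) v - a b\<bar> \<le> \<delta> * N + 2 * (L * B)"
          using block set_S[OF bs(1)] by blast
      qed (use u bs len_concat in auto)
      then show ?thesis using len_concat len_S sum_S bs by simp
    qed
    have a_bound: "\<bar>a b\<bar> \<le> N * B" if "b \<in> X" for b
      unfolding a_def using that by (intro abs_birkhoff_sum_le[of _ G] B g) (auto simp: X_def rep_path)
    have 2: "\<bar>(\<Sum>b\<in>X. m b * a b) - (\<Sum>b\<in>X. j * pr b * a b)\<bar> \<le> D * (N * B)"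
    proof -
      have "\<bar>(\<Sum>b\<in>X. m b * a b) - (\<Sum>b\<in>X. j * pr b * a b)\<bar> \<le> (\<Sum>b\<in>X. \<bar>m b * a b - j * pr b * a b\<bar>)"
        unfolding sum_subtractf[symmetric] by (rule sum_abs)
      also have "\<dots> \<le> (\<Sum>b\<in>X. 1 * (N * B))"
      proof (intro sum_mono)
        fix b assume bX: "b \<in> X"
        have "real (m b) = of_int \<lfloor>j * pr b\<rfloor>" using pr(1)[OF bX] by (simp add: m_def)
        then have "\<bar>real (m b) - j * pr b\<bar> \<le> 1" by linarith
        then show "\<bar>m b * a b - j * pr b * a b\<bar> \<le> 1 * (N * B)"
          unfolding left_diff_distrib[symmetric] abs_mult using a_bound[OF bX] by (intro mult_mono) auto
      qed
      finally show ?thesis by (simp add: D_def)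
    qed
    have 3: "\<bar>(\<Sum>b\<in>X. j * pr b * a b) - j * (N * ?I)\<bar> \<le> j * (\<delta> * N)"
    proof -
      have i: "integrable M (birkhoff_sum g N)" "(\<integral>u. birkhoff_sum g N u \<partial>M) = N * ?I"
        using integral_birkhoff_sum[OF M cont[OF g]] by auto
      have i': "integrable M (\<lambda>u. a (initial N u))" "(\<integral>u. a (initial N u) \<partial>M) = (\<Sum>b\<in>X. a b * pr b)"
        using integral_initial[OF P, of a N] by (auto simp: X_def pr_def)
      have "\<bar>(\<integral>u. a (initial N u) \<partial>M) - (\<integral>u. birkhoff_sum g N u \<partial>M)\<bar> =
          \<bar>\<integral>u. a (initial N u) - birkhoff_sum g N u \<partial>M\<bar>"
        using i(1) i'(1) by (simp add: Bochner_Integration.integral_diff)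
      also have "\<dots> \<le> (\<integral>u. \<bar>a (initial N u) - birkhoff_sum g N u\<bar> \<partial>M)" by (rule integral_abs_bound)
      also have "\<dots> \<le> (\<integral>u. \<delta> * N \<partial>M)"
      proof (rule integral_mono)
        fix u assume "u \<in> space M"
        then have up: "u \<in> paths G" by (simp add: space_prob_measures[OF P])
        show "\<bar>a (initial N u) - birkhoff_sum g N u\<bar> \<le> \<delta> * N"
          unfolding a_def using initial_in_words[OF up, of N] up
          by (intro k g Nk) (auto simp: initial_rep rep_path)
      qed (use i i' in auto)
      finally have "\<bar>(\<Sum>b\<in>X. a b * pr b) - N * ?I\<bar> \<le> \<delta> * N" using i(2) i'(2) by (simp add: prob_space)
      then have "j * \<bar>(\<Sum>b\<in>X. a b * pr b) - N * ?I\<bar> \<le> j * (\<delta> * N)" by (intro mult_left_mono) auto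
      moreover have "j * \<bar>(\<Sum>b\<in>X. a b * pr b) - N * ?I\<bar> = \<bar>(\<Sum>b\<in>X. j * pr b * a b) - j * (N * ?I)\<bar>"
      proof -
        have "(\<Sum>b\<in>X. j * pr b * a b) = j * (\<Sum>b\<in>X. a b * pr b)" by (simp add: sum_distrib_left mult_ac)
        then show ?thesis by (simp add: abs_mult flip: right_diff_distrib)
      qed
      ultimately show ?thesis by simp
    qed
    have 4: "\<bar>j * (N * ?I) - n * ?I\<bar> \<le> (2 * L * J + N * D) * B"
    proof -
      have "\<bar>?I\<bar> \<le> (\<integral>u. \<bar>g u\<bar> \<partial>M)" by (rule integral_abs_bound)
      also have "\<dots> \<le> (\<integral>u. B \<partial>M)"
        using integrable_continuous[OF cont[OF g] P] B[OF g] space_prob_measures[OF P]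
        by (intro integral_mono) auto
      finally have I: "\<bar>?I\<bar> \<le> B" by (simp add: prob_space)
      have "real N * j \<le> N * (real J + D)" using J(2) by (intro mult_left_mono) linarith+
      moreover have "real N * J \<le> real N * j" using J(1) by (intro mult_left_mono) auto
      ultimately have "\<bar>j * real N - n\<bar> \<le> 2 * L * J + N * D"
        using n' by (simp add: algebra_simps abs_le_iff)
      then have "\<bar>j * real N - n\<bar> * \<bar>?I\<bar> \<le> (2 * L * J + N * D) * B" using I by (intro mult_mono) auto
      then show ?thesis by (simp add: abs_mult[symmetric] algebra_simps)
    qed
    have s1: "J * (\<delta> * N) \<le> \<delta> * n" using mult_left_mono[OF n'(1), of \<delta>] \<delta> by (simp add: mult_ac)
    have s2: "4 * (L * B) * J \<le> e * n / 4"
    proof -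
      have "16 * L * B * J \<le> N * e * J" using N2(1) by (rule mult_right_mono) simp
      also have "\<dots> \<le> e * n" using mult_left_mono[OF n'(1), of e] e by (simp add: mult_ac)
      finally show ?thesis by simp
    qed
    have s3: "2 * (D * (N * B)) \<le> e * n / 4"
    proof -
      have "16 * D * B * N \<le> j * e * N" using j2 by (rule mult_right_mono) simp
      also have "\<dots> \<le> (2 * J) * e * N" using J2(1) e by (intro mult_right_mono) auto
      also have "\<dots> \<le> 2 * (e * n)" using mult_left_mono[OF n'(1), of e] e by (simp add: mult_ac)
      finally show ?thesis by (simp add: mult_ac)
    qed
    have s4: "j * (\<delta> * N) \<le> 2 * (\<delta> * n)"
    proof -
      have "j * (\<delta> * N) \<le> (2 * J) * (\<delta> * N)" using J2(1) \<delta> by (intro mult_right_mono) auto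
      then show ?thesis using s1 by simp
    qed
    have "J * (\<delta> * N + 2 * (L * B)) + D * (N * B) + j * (\<delta> * N) + (2 * L * J + N * D) * B
        = J * (\<delta> * N) + 4 * (L * B) * J + 2 * (D * (N * B)) + j * (\<delta> * N)"
      by (simp add: algebra_simps)
    also have "\<dots> \<le> \<delta> * n + e * n / 4 + e * n / 4 + 2 * (\<delta> * n)"
      by (intro add_mono s1 s2 s3 s4)
    also have "\<dots> = e * n * (3 / 4)" by (simp add: \<delta>_def)
    also have "\<dots> \<le> e * n" using e by simp
    finally show ?thesis using 1 2 3 4 by linarith
  qed
  have words: "W \<subseteq> words G n"
  proof
    fix w assume "w \<in> W"
    then obtain bs where bs: "bs \<in> S" "w = concat (map code bs)" by (auto simp: W_def)
    have "awalk x w x"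
      unfolding bs(2)
    proof (rule awalk_concat[OF x])
      fix b assume "b \<in> set bs"
      then have "b \<in> words G N" using set_S[OF bs(1)] by (auto simp: X_def)
      then show "awalk x (code b) x" unfolding code_def using loop N1 by simp
    qed
    then show "w \<in> words G n" using awalk_in_words len_concat[OF bs(1)] bs(2) by blast
  qed
  have "exp (n * (h - e)) \<le> card W"
  proof -
    have finS: "finite S" by (simp add: S_def)
    have S0: "card S > 0" using finS by (simp add: S_def card_gt_0_iff)
    have cS: "card S \<le> card W * Suc L ^ J"
      unfolding W_def
    proof (rule card_concat_code[where p = p and q = q and k = N])
      show "length b = N" if "bs \<in> S" "b \<in> set bs" for bs b using len_X set_S that by blast
    qed (use L finS len_S in \<open>auto simp: code_def\<close>)
    then have W0: "card W > 0" using S0 by (cases "card W = 0") auto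
    have "real (card S) \<le> real (card W) * real (Suc L) ^ J" using cS by (simp only: flip: of_nat_power of_nat_mult of_nat_le_iff[where 'a = real])
    then have "ln (real (card S)) \<le> ln (real (card W) * real (Suc L) ^ J)" using S0 by (subst ln_le_cancel_iff) auto
    also have "\<dots> = ln (card W) + J * ln (Suc L)" using W0 by (simp add: ln_mult ln_realpow)
    finally have "ln (card S) \<le> ln (card W) + J * ln (Suc L)" .
    moreover have "j * H + (\<Sum>b\<in>X. ln (pr b)) - 2 * D - D * ln j \<le> ln (card S)"
      using bounds(3) ln_card_permutations[OF X, of m] by (simp add: S_def A_def H_def D_def)
    moreover have "J * ln (Suc L) \<le> j * ln (Suc L)" using J(1) by (intro mult_right_mono) auto
    moreover have "j * (N * h) \<le> j * H" using H by (intro mult_left_mono) auto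
    ultimately have W1: "j * (N * h) - j * (N * e / 4) - j * ln (Suc L) \<le> ln (card W)"
      using j1 unfolding E_def by linarith
    have "j * (8 * L * h + 4 * ln (Suc L)) \<le> j * (N * e)" using N2(2) by (intro mult_left_mono) auto
    then have W2: "j * (2 * L * h) + j * ln (Suc L) \<le> j * (N * e / 4)" by (simp add: algebra_simps)
    have "real n * h \<le> (N + 2 * L) * real J * h" using n'(2) h by (rule mult_right_mono)
    also have "\<dots> \<le> (N + 2 * L) * real j * h" using J(1) h by (intro mult_right_mono mult_left_mono) auto
    finally have n1: "n * h \<le> j * (N * h) + j * (2 * L * h)" by (simp add: algebra_simps)
    have "real j * (N * e) \<le> (2 * J) * (N * e)" using J2(1) e by (intro mult_right_mono) auto
    also have "\<dots> \<le> 2 * (n * e)" using mult_left_mono[OF n'(1), of e] e by (simp add: mult_ac)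
    finally have n2: "j * (N * e / 4) * 2 \<le> n * e" by (simp add: mult_ac)
    have "n * (h - e) = n * h - n * e" by (rule right_diff_distrib)
    then have "n * (h - e) \<le> ln (card W)" using W1 W2 n1 n2 by linarith
    then show ?thesis using W0 by (subst ln_ge_iff[symmetric]) auto
  qed
  moreover have "n \<ge> n0" "n > 0" using Jn J2(2) by auto
  ultimately show ?thesis using typical words unfolding h_def by blast
qed

text \<open>Membership in a cylinder is decided by a prefix, so cylinder frequencies are Birkhoff
  averages of continuous functions and fall under \<open>many_typical_words\<close>.\<close>

lemma continuous_indicator_cyl:
  "continuous_map (path_topology G) euclideanreal (indicator (cyl G v))"
  unfolding continuous_map_def
proof (intro conjI allI impI)
  fix V :: "real set"
  have "{u \<in> paths G. indicator (cyl G v) u \<in> V} \<in> cylsets"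
    by (rule cylsetsI[of _ "length v"]) (auto simp: cyl_eq indicator_def split: if_splits)
  then show "openin (path_topology G) {u \<in> topspace (path_topology G). indicator (cyl G v) u \<in> V}"
    using cylsets_openin by simp
qed auto

text \<open>Typical words are taken for \<open>\<phi>\<close> together with the indicators of the
  finitely many cylinders that decide closeness to \<open>M\<close>. The estimates hold at every
  point of each cylinder, as membership in \<open>good_words\<close> demands.\<close>

theorem pressure_lower_bound:
  fixes U :: "(nat \<Rightarrow> 'e) measure \<Rightarrow> 'x::metric_space" and s :: real
  assumes U: "continuous_map (weak_topology G) euclidean U"
    and \<phi>: "continuous_map (path_topology G) euclideanreal \<phi>"
    and M: "M \<in> invariant_measures G" "U M \<in> closure C"
    and r: "r > 0" and s: "s < entropy_rate M + (\<integral>u. \<phi> u \<partial>M)"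
  shows "\<exists>n\<ge>n0. exp (n * s) \<le> multifractal_sum G U (set_ball C r) \<phi> n"
proof -
  note P = invariant_imp_prob[OF M(1)]
  let ?I = "\<integral>u. \<phi> u \<partial>M"
  obtain y where y: "y \<in> C" "dist y (U M) < r/2"
    using M(2) r unfolding closure_approachable by (meson half_gt_zero)
  obtain F d where F: "finite F" "d > 0" "\<And>N. N \<in> prob_measures G \<Longrightarrow>
       (\<And>w. w \<in> F \<Longrightarrow> \<bar>measure N (cyl G w) - measure M (cyl G w)\<bar> < d) \<Longrightarrow> dist (U N) (U M) < r/2"
    using weak_continuous_near[OF U P, of "r/2"] r by (metis half_gt_zero)
  \<comment> \<open>The first bound puts cylinder frequencies within \<open>d\<close>; the second
    leaves one \<open>e\<close> for the number of words and one for the Birkhoff sums of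
    \<open>\<phi>\<close>.\<close>
  define e where "e = min (d/2) ((entropy_rate M + ?I - s)/2)"
  have "e > 0" using F(2) s by (simp add: e_def)
  moreover have "e < d" using F(2) by (auto simp: e_def min_less_iff_disj)
  moreover have "e \<le> (entropy_rate M + ?I - s)/2" unfolding e_def by (rule min.cobounded2)
  then have "2 * e \<le> entropy_rate M + ?I - s" by simp
  then have "s \<le> entropy_rate M + ?I - 2 * e" by (simp add: le_diff_eq add.commute)
  ultimately have e: "e > 0" "e < d" "s \<le> entropy_rate M + ?I - 2 * e" by blast+
  define \<G> where "\<G> = insert \<phi> ((\<lambda>v. indicator (cyl G v)) ` F)"
  have "finite \<G>" using F(1) by (simp add: \<G>_def)
  moreover have "continuous_map (path_topology G) euclideanreal g" if "g \<in> \<G>" for g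
    using that \<phi> continuous_indicator_cyl by (auto simp: \<G>_def)
  ultimately have "\<exists>n\<ge>n0. n > 0 \<and> (\<exists>W\<subseteq>words G n.
    (\<forall>w\<in>W. \<forall>u\<in>cyl G w. \<forall>g\<in>\<G>. \<bar>birkhoff_sum g n u - n * (\<integral>u. g u \<partial>M)\<bar> \<le> e * n) \<and>
    exp (n * (entropy_rate M - e)) \<le> card W)"
    by (rule many_typical_words[OF M(1) _ _ e(1)])
  then obtain n W where n: "n \<ge> n0" "n > 0" and W: "W \<subseteq> words G n"
    and typical: "\<And>w u g. w \<in> W \<Longrightarrow> u \<in> cyl G w \<Longrightarrow> g \<in> \<G> \<Longrightarrow> \<bar>birkhoff_sum g n u - n * (\<integral>u. g u \<partial>M)\<bar> \<le> e * n"
    and card: "exp (n * (entropy_rate M - e)) \<le> card W"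
    by (elim exE conjE) blast
  have "W \<subseteq> good_words U (set_ball C r) n"
  proof
    fix w assume w: "w \<in> W"
    have "U (empirical G n u) \<in> set_ball C r" if u: "u \<in> cyl G w" for u
    proof -
      have up: "u \<in> paths G" using u by (simp add: cyl_def)
      note E = empirical_prob[OF n(2) up]
      have "dist (U (empirical G n u)) (U M) < r/2"
      proof (rule F(3)[OF E])
        fix v assume v: "v \<in> F"
        let ?g = "indicator (cyl G v) :: _ \<Rightarrow> real"
        have int: "(\<integral>u. ?g u \<partial>N) = measure N (cyl G v)" if "N \<in> prob_measures G" for N
          using that sets_prob_measures[OF that] space_prob_measures[OF that] by (simp add: cyl_def Int_absorb2)
        have "\<bar>birkhoff_sum ?g n u - n * (\<integral>u. ?g u \<partial>M)\<bar> \<le> e * n"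
          by (rule typical[OF w u]) (use v in \<open>auto simp: \<G>_def\<close>)
        then have "n * \<bar>measure (empirical G n u) (cyl G v) - measure M (cyl G v)\<bar> \<le> n * e"
          unfolding birkhoff_integral[OF continuous_indicator_cyl n(2) up] int[OF E] int[OF P]
          by (simp add: abs_mult mult.commute flip: right_diff_distrib)
        then show "\<bar>measure (empirical G n u) (cyl G v) - measure M (cyl G v)\<bar> < d"
          using n(2) e(2) by simp
      qed
      then have "dist (U (empirical G n u)) y < r"
        using y(2) dist_triangle_half_l by blast
      then show ?thesis using y(1) infdist_le[OF y(1), of "U (empirical G n u)"]
        by (auto simp: set_ball_def)
    qed
    then show "w \<in> good_words U (set_ball C r) n" using w W by (auto simp: good_words_def)
  qed
  have "exp (n * s) \<le> exp (n * (entropy_rate M - e)) * exp (n * (?I - e))"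
    using e(3) by (simp add: exp_add[symmetric] distrib_left[symmetric] mult_left_mono)
  also have "\<dots> \<le> card W * exp (n * (?I - e))" by (intro mult_right_mono card) simp
  also have "\<dots> = (\<Sum>w\<in>W. exp (n * (?I - e)))" by simp
  also have "\<dots> \<le> (\<Sum>w\<in>W. cyl_sup \<phi> n w)"
  proof (rule sum_mono)
    fix w assume w: "w \<in> W"
    then have ww: "w \<in> words G n" using W by auto
    have "\<bar>birkhoff_sum \<phi> n (rep w) - n * ?I\<bar> \<le> e * n"
      by (rule typical[OF w rep_in_cyl[OF ww]]) (simp add: \<G>_def)
    then have "exp (n * (?I - e)) \<le> exp (birkhoff_sum \<phi> n (rep w))" by (simp add: algebra_simps)
    also have "\<dots> \<le> cyl_sup \<phi> n w" by (rule cyl_sup_ge[OF \<phi> rep_in_cyl[OF ww]])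
    finally show "exp (n * (?I - e)) \<le> cyl_sup \<phi> n w" .
  qed
  also have "\<dots> \<le> (\<Sum>w\<in>good_words U (set_ball C r) n. cyl_sup \<phi> n w)"
    using \<open>W \<subseteq> good_words U (set_ball C r) n\<close>
    by (intro sum_mono2) (auto intro!: less_imp_le[OF cyl_sup_pos[OF \<phi>]] simp: good_words_def)
  finally show ?thesis unfolding multifractal_sum_eq using n(1) by blast
qed

end

section \<open>Growth rates, radii of convergence and roots\<close>

text \<open>This predicate and \<open>growth_above\<close> bracket an upper growth rate in real
  arithmetic: bounds from above hold eventually, bounds from below infinitely often. Pressure and
  radius of convergence are both derived from them.\<close>

definition growth_below :: "(nat \<Rightarrow> real) \<Rightarrow> real \<Rightarrow> bool" where
  "growth_below Z s \<longleftrightarrow> (\<forall>\<^sub>F n in sequentially. Z n \<le> exp (real n * s))"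

definition growth_above :: "(nat \<Rightarrow> real) \<Rightarrow> real \<Rightarrow> bool" where
  "growth_above Z s \<longleftrightarrow> (\<forall>n0. \<exists>n\<ge>n0. exp (real n * s) \<le> Z n)"

definition growth_rate :: "(nat \<Rightarrow> real) \<Rightarrow> ereal" where
  "growth_rate Z = limsup (\<lambda>n. ereal (1 / real n) * log_ereal (Z n))"

definition zeta_radius :: "(nat \<Rightarrow> real) \<Rightarrow> ereal" where
  "zeta_radius Z = fps_conv_radius (Abs_fps (\<lambda>n. complex_of_real (Z n / real n)))"

lemma growth_rate_le:
  assumes nonneg: "\<And>n. n > 0 \<Longrightarrow> Z n \<ge> 0" and Z: "growth_below Z s"
  shows "growth_rate Z \<le> ereal s"
  unfolding growth_rate_def
proof (rule Limsup_bounded)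
  show "\<forall>\<^sub>F n in sequentially. ereal (1 / real n) * log_ereal (Z n) \<le> ereal s"
    using Z[unfolded growth_below_def] eventually_gt_at_top[of 0]
  proof eventually_elim
    case (elim n)
    show ?case
    proof (cases "Z n = 0")
      case True
      then show ?thesis using elim(2) by (simp add: log_ereal_def)
    next
      case False
      then have "Z n > 0" using nonneg[OF elim(2)] by simp
      then have "ln (Z n) \<le> n * s" using elim(1) by (metis ln_exp ln_le_cancel_iff exp_gt_zero)
      then show ?thesis using elim(2) False by (simp add: log_ereal_def field_simps)
    qed
  qed
qed

lemma growth_rate_ge:
  assumes Z: "growth_above Z s" shows "ereal s \<le> growth_rate Z"
proof (rule ccontr)
  assume "\<not> ereal s \<le> growth_rate Z"
  then have "\<forall>\<^sub>F n in sequentially. ereal (1 / real n) * log_ereal (Z n) < ereal s"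
    unfolding growth_rate_def by (intro Limsup_lessD) simp
  then obtain n0 where n0: "\<And>n. n \<ge> n0 \<Longrightarrow> ereal (1 / real n) * log_ereal (Z n) < ereal s"
    by (auto simp: eventually_sequentially)
  obtain n where n: "n \<ge> max 1 n0" "exp (n * s) \<le> Z n" using Z unfolding growth_above_def by blast
  have pos: "Z n > 0" using n(2) exp_gt_zero[of "n * s"] by linarith
  have "n * s \<le> ln (Z n)" using n(2) pos by (simp add: ln_ge_iff)
  then have "ereal s \<le> ereal (1 / real n) * log_ereal (Z n)"
    using n(1) pos by (simp add: log_ereal_def field_simps)
  then show False using n0[of n] n(1) by simp
qed

text \<open>For \<open>r < exp (- s)\<close> the series is eventually dominated by the geometric
  series with ratio \<open>exp s * r < 1\<close>.\<close>

lemma zeta_radius_ge: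
  assumes nonneg: "\<And>n. n > 0 \<Longrightarrow> Z n \<ge> 0" and Z: "growth_below Z s"
  shows "ereal (exp (- s)) \<le> zeta_radius Z"
  unfolding zeta_radius_def fps_conv_radius_def
proof (rule conv_radius_geI_ex')
  fix r :: real assume r: "0 < r" "ereal r < ereal (exp (- s))"
  have "exp s * r < exp s * exp (- s)" using r by (intro mult_strict_left_mono) auto
  then have q: "exp s * r < 1" by (simp add: exp_minus_inverse)
  show "summable (\<lambda>n. fps_nth (Abs_fps (\<lambda>n. complex_of_real (Z n / real n))) n * of_real r ^ n)"
  proof (rule summable_comparison_test_ev)
    show "summable (\<lambda>n. (exp s * r) ^ n)" using q r by (intro summable_geometric) (simp add: abs_mult)
    show "\<forall>\<^sub>F n in sequentially. norm (fps_nth (Abs_fps (\<lambda>n. complex_of_real (Z n / real n))) n * of_real r ^ n)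
        \<le> (exp s * r) ^ n"
      using Z[unfolded growth_below_def] eventually_gt_at_top[of 0]
    proof eventually_elim
      case (elim n)
      have "norm (fps_nth (Abs_fps (\<lambda>n. complex_of_real (Z n / real n))) n * of_real r ^ n) = Z n / n * r ^ n"
        using nonneg[OF elim(2)] r(1) by (simp add: norm_mult norm_power norm_divide)
      also have "\<dots> \<le> Z n * r ^ n"
        using nonneg[OF elim(2)] elim(2) r(1) by (intro mult_right_mono) (auto simp: divide_le_eq mult_le_cancel_left1)
      also have "\<dots> \<le> exp (n * s) * r ^ n" using elim(1) r(1) by (intro mult_right_mono) auto
      also have "\<dots> = (exp s * r) ^ n" by (simp add: power_mult_distrib exp_of_nat_mult)
      finally show ?case .
    qed
  qed
qed

text \<open>For \<open>r > exp (- s)\<close> infinitely many terms are at least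
  \<open>(exp s * r) ^ n / n\<close>, which tends to infinity, so the terms do not tend to
  0.\<close>

lemma zeta_radius_le:
  assumes Z: "growth_above Z s" shows "zeta_radius Z \<le> ereal (exp (- s))"
  unfolding zeta_radius_def fps_conv_radius_def
proof (rule conv_radius_leI_ex')
  fix r :: real assume r: "0 < r" "ereal (exp (- s)) < ereal r"
  have "exp s * exp (- s) < exp s * r" using r by (intro mult_strict_left_mono) auto
  then have q: "exp s * r > 1" by (simp add: exp_minus_inverse)
  let ?a = "\<lambda>n. fps_nth (Abs_fps (\<lambda>n. complex_of_real (Z n / real n))) n * of_real r ^ n"
  show "\<not> summable ?a"
  proof
    assume "summable ?a"
    then have "(\<lambda>n. norm (?a n)) \<longlonglongrightarrow> 0" by (intro tendsto_norm_zero summable_LIMSEQ_zero)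
    then have "\<forall>\<^sub>F n in sequentially. norm (?a n) < 1" by (rule order_tendstoD) simp
    moreover have "\<forall>\<^sub>F n in sequentially. 1 \<le> (exp s * r) ^ n / real n"
    proof -
      define q where "q = exp s * r"
      have "q > 1" using q by (simp add: q_def)
      then have "filterlim (\<lambda>n. q ^ n / real n) at_top sequentially" by real_asymp
      then show ?thesis unfolding q_def by (simp add: filterlim_at_top)
    qed
    ultimately have "\<forall>\<^sub>F n in sequentially. norm (?a n) < 1 \<and> 1 \<le> (exp s * r) ^ n / real n"
      by (rule eventually_conj)
    then obtain n0 where n0: "\<And>n. n \<ge> n0 \<Longrightarrow> norm (?a n) < 1 \<and> 1 \<le> (exp s * r) ^ n / real n"
      by (auto simp: eventually_sequentially)
    obtain n where n: "n \<ge> n0" "exp (n * s) \<le> Z n" using Z unfolding growth_above_def by blast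
    have pos: "Z n > 0" using n(2) exp_gt_zero[of "n * s"] by linarith
    have "1 \<le> (exp s * r) ^ n / n" using n0 n(1) by simp
    also have "\<dots> = exp (n * s) * r ^ n / n" by (simp add: power_mult_distrib exp_of_nat_mult)
    also have "\<dots> \<le> Z n * r ^ n / n" using n(2) r by (intro divide_right_mono mult_right_mono) auto
    also have "\<dots> = norm (?a n)" using pos r(1) by (simp add: norm_mult norm_power norm_divide)
    finally show False using n0[OF n(1)] by simp
  qed
qed simp

text \<open>Both limits are functions of the same \<open>v\<close>, so the pressure tends to 0
  exactly if the radius tends to 1; this ties the two descriptions of f(C) together.\<close>

lemma growth_limit:
  fixes Z :: "real \<Rightarrow> nat \<Rightarrow> real" and v :: real
  assumes nonneg: "\<And>r n. n > 0 \<Longrightarrow> Z r n \<ge> 0"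
    and below: "\<And>s. v < s \<Longrightarrow> \<forall>\<^sub>F r in at_right 0. growth_below (Z r) s"
    and above: "\<And>s. s < v \<Longrightarrow> \<forall>\<^sub>F r in at_right 0. growth_above (Z r) s"
  shows "((\<lambda>r. growth_rate (Z r)) \<longlongrightarrow> ereal v) (at_right 0)"
    and "((\<lambda>r. zeta_radius (Z r)) \<longlongrightarrow> ereal (exp (- v))) (at_right 0)"
proof -
  show "((\<lambda>r. growth_rate (Z r)) \<longlongrightarrow> ereal v) (at_right 0)"
  proof (rule order_tendstoI)
    fix a assume "a < ereal v"
    then obtain s where s: "a < ereal s" "s < v" using ereal_dense2[of a "ereal v"] by auto
    show "\<forall>\<^sub>F r in at_right 0. a < growth_rate (Z r)"
      using above[OF s(2)] by eventually_elim (rule less_le_trans[OF s(1) growth_rate_ge])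
  next
    fix a assume "ereal v < a"
    then obtain s where s: "ereal s < a" "v < s" using ereal_dense2[of "ereal v" a] by auto
    show "\<forall>\<^sub>F r in at_right 0. growth_rate (Z r) < a"
      using below[OF s(2)] by eventually_elim (rule le_less_trans[OF growth_rate_le[OF nonneg] s(1)])
  qed
  show "((\<lambda>r. zeta_radius (Z r)) \<longlongrightarrow> ereal (exp (- v))) (at_right 0)"
  proof (rule order_tendstoI)
    fix a assume "a < ereal (exp (- v))"
    then obtain x where x: "a < ereal x" "x < exp (- v)" using ereal_dense2[of a "ereal (exp (- v))"] by auto
    obtain s where s: "v < s" "x \<le> exp (- s)"
    proof (cases "x > 0")
      case True
      then have "ln x < - v" using x(2) by (metis ln_exp ln_less_cancel_iff exp_gt_zero)
      then show ?thesis using True that[of "- ln x"] by simp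
    next
      case False
      then show ?thesis using that[of "v + 1"] by (meson exp_ge_zero less_add_one linorder_not_less order_trans)
    qed
    show "\<forall>\<^sub>F r in at_right 0. a < zeta_radius (Z r)"
      using below[OF s(1)]
    proof eventually_elim
      case (elim r)
      have "a < ereal (exp (- s))" using x(1) s(2) by (meson ereal_less_eq(3) less_le_trans)
      also have "\<dots> \<le> zeta_radius (Z r)" by (rule zeta_radius_ge[OF nonneg elim])
      finally show ?case .
    qed
  next
    fix a assume "ereal (exp (- v)) < a"
    then obtain x where x: "ereal x < a" "exp (- v) < x" using ereal_dense2[of "ereal (exp (- v))" a] by auto
    have x0: "x > 0" using x(2) exp_gt_zero[of "- v"] by linarith
    then have "- v < ln x" using x(2) by (metis ln_exp ln_less_cancel_iff exp_gt_zero)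
    then have "\<forall>\<^sub>F r in at_right 0. growth_above (Z r) (- ln x)" by (intro above) simp
    then show "\<forall>\<^sub>F r in at_right 0. zeta_radius (Z r) < a"
    proof eventually_elim
      case (elim r)
      have "zeta_radius (Z r) \<le> ereal x" using zeta_radius_le[OF elim] x0 by simp
      then show ?case using x(1) by (rule le_less_trans)
    qed
  qed
qed

text \<open>The degenerate case in which every rate is eventually an upper bound; the infinite
  limits then rule out both defining equations of f(C).\<close>

lemma growth_limit_none:
  fixes Z :: "real \<Rightarrow> nat \<Rightarrow> real"
  assumes nonneg: "\<And>r n. n > 0 \<Longrightarrow> Z r n \<ge> 0"
    and below: "\<And>s. \<forall>\<^sub>F r in at_right 0. growth_below (Z r) s"
  shows "((\<lambda>r. growth_rate (Z r)) \<longlongrightarrow> - \<infinity>) (at_right 0)"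
    and "((\<lambda>r. zeta_radius (Z r)) \<longlongrightarrow> \<infinity>) (at_right 0)"
proof -
  show "((\<lambda>r. growth_rate (Z r)) \<longlongrightarrow> - \<infinity>) (at_right 0)"
    unfolding tendsto_MInfty
  proof
    fix s :: real
    show "\<forall>\<^sub>F r in at_right 0. growth_rate (Z r) < ereal s"
      using below[of "s - 1"]
    proof eventually_elim
      case (elim r)
      have "growth_rate (Z r) \<le> ereal (s - 1)" by (rule growth_rate_le[OF nonneg elim])
      also have "\<dots> < ereal s" by simp
      finally show ?case .
    qed
  qed
  show "((\<lambda>r. zeta_radius (Z r)) \<longlongrightarrow> \<infinity>) (at_right 0)"
    unfolding tendsto_PInfty
  proof
    fix x :: real
    show "\<forall>\<^sub>F r in at_right 0. ereal x < zeta_radius (Z r)"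
      using below[of "- ln (\<bar>x\<bar> + 1)"]
    proof eventually_elim
      case (elim r)
      have "ereal x < ereal (\<bar>x\<bar> + 1)" by simp
      also have "\<dots> = ereal (exp (- (- ln (\<bar>x\<bar> + 1))))" by simp
      also have "\<dots> \<le> zeta_radius (Z r)" by (rule zeta_radius_ge[OF nonneg elim])
      finally show ?case .
    qed
  qed
qed

lemma pressure_zero_iff:
  "pressure_zero G U C \<Phi> t \<longleftrightarrow>
    ((\<lambda>r. growth_rate (multifractal_sum G U (set_ball C r) (\<lambda>u. t * \<Phi> u))) \<longlongrightarrow> 0) (at_right 0)"
  by (simp add: pressure_zero_def upper_pressure_def growth_rate_def)

lemma zeta_radius_one_iff:
  "zeta_radius_one G U C \<Phi> t \<longleftrightarrow>
    ((\<lambda>r. zeta_radius (multifractal_sum G U (set_ball C r) (\<lambda>u. t * \<Phi> u))) \<longlongrightarrow> 1) (at_right 0)"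
  by (simp add: zeta_radius_one_def zeta_dyn_def zeta_radius_def)

lemma no_root_if_no_growth:
  assumes nonneg: "\<And>r n. n > 0 \<Longrightarrow> multifractal_sum G U (set_ball C r) (\<lambda>u. t * \<Phi> u) n \<ge> 0"
    and below: "\<And>s. \<forall>\<^sub>F r in at_right 0. growth_below (multifractal_sum G U (set_ball C r) (\<lambda>u. t * \<Phi> u)) s"
  shows "\<not> pressure_zero G U C \<Phi> t" "\<not> zeta_radius_one G U C \<Phi> t"
  unfolding pressure_zero_iff zeta_radius_one_iff
  using tendsto_unique[OF _ growth_limit_none(1)[OF nonneg below]]
    tendsto_unique[OF _ growth_limit_none(2)[OF nonneg below]] by force+

section \<open>The zero of the limiting pressure\<close>

context graph_shift
begin

lemma multifractal_sum_nonneg: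
  assumes "continuous_map (path_topology G) euclideanreal \<phi>"
  shows "multifractal_sum G U D \<phi> n \<ge> 0"
  unfolding multifractal_sum_eq
  by (intro sum_nonneg less_imp_le[OF cyl_sup_pos[OF assms]]) (auto simp: good_words_def)

lemma multifractal_sum_mono:
  assumes \<phi>: "continuous_map (path_topology G) euclideanreal \<phi>" and "D \<subseteq> D'"
  shows "multifractal_sum G U D \<phi> n \<le> multifractal_sum G U D' \<phi> n"
  unfolding multifractal_sum_eq
  by (intro sum_mono2 good_words_mono assms less_imp_le[OF cyl_sup_pos[OF \<phi>]]) (auto simp: good_words_def)

text \<open>The contrapositive of \<open>pressure_upper_bound\<close> yields one radius, and the
  sums are monotone in the radius. Without any admissible measure the hypothesis is vacuous for
  every \<open>s\<close>, which covers the case without a root.\<close>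

lemma growth_below_at_right:
  fixes U :: "(nat \<Rightarrow> 'e) measure \<Rightarrow> 'x::metric_space"
  assumes U: "continuous_map (weak_topology G) euclidean U"
    and \<phi>: "continuous_map (path_topology G) euclideanreal \<phi>"
    and less: "\<And>M. M \<in> invariant_measures G \<Longrightarrow> U M \<in> closure C \<Longrightarrow> entropy_rate M + (\<integral>u. \<phi> u \<partial>M) < s"
  shows "\<forall>\<^sub>F r in at_right 0. growth_below (multifractal_sum G U (set_ball C r) \<phi>) s"
proof -
  obtain r0 where r0: "r0 > 0" "growth_below (multifractal_sum G U (set_ball C r0) \<phi>) s"
    using pressure_upper_bound[OF U \<phi>, of C s] less unfolding growth_below_def by force
  have "growth_below (multifractal_sum G U (set_ball C r) \<phi>) s" if "r < r0" for r
    using r0(2) unfolding growth_below_def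
    by eventually_elim
      (use multifractal_sum_mono[OF \<phi> set_ball_mono[OF less_imp_le[OF that]]] order_trans in blast)
  then show ?thesis using r0(1) unfolding eventually_at_right_field by blast
qed

lemma growth_above_at_right:
  fixes U :: "(nat \<Rightarrow> 'e) measure \<Rightarrow> 'x::metric_space"
  assumes U: "continuous_map (weak_topology G) euclidean U"
    and \<phi>: "continuous_map (path_topology G) euclideanreal \<phi>"
    and M: "M \<in> invariant_measures G" "U M \<in> closure C" and s: "s < entropy_rate M + (\<integral>u. \<phi> u \<partial>M)"
  shows "\<forall>\<^sub>F r in at_right 0. growth_above (multifractal_sum G U (set_ball C r) \<phi>) s"
  using eventually_at_right_less[of 0]
  by eventually_elim (use pressure_lower_bound[OF U \<phi> M _ s] in \<open>simp add: growth_above_def\<close>)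

lemma entropy_rate_bounded:
  assumes M: "M \<in> invariant_measures G"
  shows "entropy_rate M \<le> card (words G 1)"
proof -
  interpret prob_space M using M by (intro prob_space_prob_measures invariant_imp_prob)
  have "- (prob A * ln (prob A)) \<le> 1" for A
  proof (cases "prob A = 0")
    case False
    then have p: "prob A > 0" by (simp add: zero_less_measure_iff)
    have "ln (inverse (prob A)) \<le> inverse (prob A) - 1" by (rule ln_le_minus_one) (use p in simp)
    then have "prob A * - ln (prob A) \<le> prob A * (inverse (prob A) - 1)"
      using p by (intro mult_left_mono) (simp_all add: ln_inverse)
    also have "\<dots> \<le> 1" using p by (simp add: right_diff_distrib)
    finally show ?thesis by simp
  qed simp
  then have "word_entropy M 1 \<le> (\<Sum>w\<in>words G 1. 1)"
    unfolding word_entropy_def sum_negf[symmetric] by (intro sum_mono)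
  then show ?thesis using entropy_rate_le[OF M, of 1] by simp
qed

text \<open>By compactness \<open>\<Phi>\<close> attains a negative maximum, so its integrals stay
  away from 0 uniformly in the measure.\<close>

lemma integral_negative_bounds:
  assumes \<Phi>: "continuous_map (path_topology G) euclideanreal \<Phi>" and neg: "\<And>u. u \<in> paths G \<Longrightarrow> \<Phi> u < 0"
  obtains c B where "c > 0" "\<And>M. M \<in> prob_measures G \<Longrightarrow> (\<integral>u. \<Phi> u \<partial>M) \<le> - c"
    "\<And>M. M \<in> prob_measures G \<Longrightarrow> - B \<le> (\<integral>u. \<Phi> u \<partial>M)"
proof -
  have "compactin euclideanreal (\<Phi> ` paths G)"
    using image_compactin[OF _ \<Phi>] compact_space_path_topology
    by (metis compact_space_def topspace_path_topology)
  then have "compact (\<Phi> ` paths G)" by simp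
  then obtain x where x: "x \<in> \<Phi> ` paths G" "\<And>y. y \<in> \<Phi> ` paths G \<Longrightarrow> y \<le> x"
    using compact_attains_sup paths_nonempty by (metis image_is_empty)
  obtain B where B: "B > 0" "\<And>u. u \<in> paths G \<Longrightarrow> \<bar>\<Phi> u\<bar> \<le> B" using bounded_continuous_map[OF \<Phi>] by blast
  show ?thesis
  proof (rule that[of "- x" B])
    show "- x > 0" using x(1) neg by auto
    fix M assume M: "M \<in> prob_measures G"
    interpret prob_space M using M by (rule prob_space_prob_measures)
    note i = integrable_continuous[OF \<Phi> M]
    have "(\<integral>u. \<Phi> u \<partial>M) \<le> (\<integral>u. x \<partial>M)"
      using i x(2) by (intro integral_mono) (auto simp: space_prob_measures[OF M])
    then show "(\<integral>u. \<Phi> u \<partial>M) \<le> - (- x)" by (simp add: prob_space)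
    have "(\<integral>u. - B \<partial>M) \<le> (\<integral>u. \<Phi> u \<partial>M)"
    proof (rule integral_mono)
      fix u assume "u \<in> space M"
      then have "\<bar>\<Phi> u\<bar> \<le> B" using B(2) by (simp add: space_prob_measures[OF M])
      then show "- B \<le> \<Phi> u" by linarith
    qed (use i in auto)
    then show "- B \<le> (\<integral>u. \<Phi> u \<partial>M)" by (simp add: prob_space)
  qed
qed

text \<open>For each admissible \<open>M\<close> the function \<open>t \<mapsto> p t M\<close> is
  affine with zero \<open>Q M\<close> and slope between \<open>- B\<close> and \<open>- c\<close>.
  These uniform slope bounds make the supremum of the functions vanish exactly at the supremum
  \<open>f\<close> of the zeros.\<close>

lemma multifractal_roots:
  fixes U :: "(nat \<Rightarrow> 'e) measure \<Rightarrow> 'x::metric_space"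
  assumes U: "continuous_map (weak_topology G) euclidean U"
    and \<Phi>: "continuous_map (path_topology G) euclideanreal \<Phi>" and neg: "\<And>u. u \<in> paths G \<Longrightarrow> \<Phi> u < 0"
    and ne: "\<exists>M\<in>invariant_measures G. U M \<in> closure C"
  obtains f where "\<And>t. pressure_zero G U C \<Phi> t \<longleftrightarrow> t = f" "\<And>t. zeta_radius_one G U C \<Phi> t \<longleftrightarrow> t = f"
    "ereal f = (SUP M \<in> {M \<in> invariant_measures G. U M \<in> closure C}.
        - (ks_entropy M shift / ereal (\<integral>u. \<Phi> u \<partial>M)))"
proof -
  define F where "F = {M \<in> invariant_measures G. U M \<in> closure C}"
  have Fne: "F \<noteq> {}" using ne by (auto simp: F_def)
  have inv: "M \<in> invariant_measures G" if "M \<in> F" for M using that by (simp add: F_def)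
  define I where "I M = - (\<integral>u. \<Phi> u \<partial>M)" for M
  obtain c B where c: "c > 0" and "\<And>M. M \<in> prob_measures G \<Longrightarrow> (\<integral>u. \<Phi> u \<partial>M) \<le> - c"
    "\<And>M. M \<in> prob_measures G \<Longrightarrow> - B \<le> (\<integral>u. \<Phi> u \<partial>M)"
    using integral_negative_bounds[OF \<Phi> neg] by blast
  then have I: "c \<le> I M" "I M \<le> B" if "M \<in> F" for M
    using invariant_imp_prob[OF inv[OF that]] unfolding I_def by force+
  have I0: "I M > 0" if "M \<in> F" for M using I(1)[OF that] c by linarith
  have B0: "B > 0" using Fne I I0 by fastforce
  define K where "K = real (card (words G 1))"
  have h: "0 \<le> entropy_rate M" "entropy_rate M \<le> K" if "M \<in> F" for M
    using entropy_rate_nonneg[OF inv[OF that]] entropy_rate_bounded[OF inv[OF that]] by (auto simp: K_def)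
  define Q where "Q M = entropy_rate M / I M" for M
  define f where "f = (SUP M\<in>F. Q M)"
  have bddQ: "bdd_above (Q ` F)"
  proof (rule bdd_aboveI2)
    fix M assume M: "M \<in> F"
    show "Q M \<le> K / c" unfolding Q_def using h[OF M] I(1)[OF M] c by (intro frac_le) auto
  qed
  have Qf: "Q M \<le> f" if "M \<in> F" for M unfolding f_def by (rule cSUP_upper[OF that bddQ])
  have Q_eq: "entropy_rate M = Q M * I M" if "M \<in> F" for M using I0[OF that] by (simp add: Q_def)
  define p where "p t M = entropy_rate M - t * I M" for t M
  have p_eq: "p t M = entropy_rate M + (\<integral>u. t * \<Phi> u \<partial>M)" for t M by (simp add: p_def I_def)
  define v where "v t = (SUP M\<in>F. p t M)" for t
  have bddp: "bdd_above (p t ` F)" for t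
  proof (rule bdd_aboveI2)
    fix M assume M: "M \<in> F"
    have "\<bar>t * I M\<bar> \<le> \<bar>t\<bar> * B" unfolding abs_mult using I[OF M] I0[OF M] by (intro mult_left_mono) auto
    then show "p t M \<le> K + \<bar>t\<bar> * B" unfolding p_def using h[OF M] by linarith
  qed
  have cont: "continuous_map (path_topology G) euclideanreal (\<lambda>u. t * \<Phi> u)" for t
    by (intro continuous_map_real_mult continuous_map_const[THEN iffD2] \<Phi>) auto
  let ?Z = "\<lambda>t r. multifractal_sum G U (set_ball C r) (\<lambda>u. t * \<Phi> u)"
  have below: "\<forall>\<^sub>F r in at_right 0. growth_below (?Z t r) s" if s: "v t < s" for t s
  proof (rule growth_below_at_right[OF U cont])
    fix M assume "M \<in> invariant_measures G" "U M \<in> closure C"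
    then have "M \<in> F" by (simp add: F_def)
    then have "p t M \<le> v t" unfolding v_def by (intro cSUP_upper bddp)
    then show "entropy_rate M + (\<integral>u. t * \<Phi> u \<partial>M) < s" using s by (simp only: p_eq)
  qed
  have above: "\<forall>\<^sub>F r in at_right 0. growth_above (?Z t r) s" if s: "s < v t" for t s
  proof -
    obtain M where M: "M \<in> F" "s < p t M" using s less_cSUP_iff[OF Fne bddp] unfolding v_def by blast
    then show ?thesis
      unfolding p_eq by (intro growth_above_at_right[OF U cont]) (auto simp: F_def)
  qed
  have nonneg: "?Z t r n \<ge> 0" for t r n by (rule multifractal_sum_nonneg[OF cont])
  have P: "pressure_zero G U C \<Phi> t \<longleftrightarrow> v t = 0" for t
  proof -
    note lim = growth_limit(1)[of "?Z t" "v t", OF nonneg below above]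
    show ?thesis unfolding pressure_zero_iff
      using tendsto_unique[OF _ lim, of 0] lim by (auto simp: zero_ereal_def)
  qed
  have Zr: "zeta_radius_one G U C \<Phi> t \<longleftrightarrow> v t = 0" for t
  proof -
    note lim = growth_limit(2)[of "?Z t" "v t", OF nonneg below above]
    show ?thesis unfolding zeta_radius_one_iff
      using tendsto_unique[OF _ lim, of 1] lim by (auto simp: one_ereal_def)
  qed
  have root: "v t = 0 \<longleftrightarrow> t = f" for t
  proof -
    consider "t < f" | "t = f" | "t > f" by linarith
    then show ?thesis
    proof cases
      case 1
      then obtain M where M: "M \<in> F" "t < Q M" using less_cSUP_iff[OF Fne bddQ] unfolding f_def by blast
      then have "0 < (Q M - t) * I M" using I0 by (intro mult_pos_pos) auto
      then have "0 < p t M" using Q_eq[OF M(1)] by (simp add: p_def left_diff_distrib)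
      also have "p t M \<le> v t" unfolding v_def by (rule cSUP_upper[OF M(1) bddp])
      finally show ?thesis using 1 by simp
    next
      case 2
      have "v f \<le> 0" unfolding v_def
      proof (rule cSUP_least[OF Fne])
        fix M assume M: "M \<in> F"
        have "(Q M - f) * I M \<le> 0" using Qf[OF M] I0[OF M] by (intro mult_nonpos_nonneg) auto
        then show "p f M \<le> 0" using Q_eq[OF M] by (simp add: p_def left_diff_distrib)
      qed
      moreover have "0 \<le> v f"
      proof (rule field_le_epsilon)
        fix e :: real assume e: "e > 0"
        \<comment> \<open>A zero within \<open>e / B\<close> of \<open>f\<close>, together with the
          slope bound \<open>B\<close>, makes the value at \<open>f\<close> at least
          \<open>- e\<close>.\<close>
        have "f - e / B < f" using e B0 by simp
        then obtain M where M: "M \<in> F" "f - e / B < Q M" using less_cSUP_iff[OF Fne bddQ] unfolding f_def by blast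
        have "- (e / B) * I M \<le> (Q M - f) * I M" using M I0[OF M(1)] by (intro mult_right_mono) auto
        moreover have "(e / B) * I M \<le> (e / B) * B" using e B0 I(2)[OF M(1)] by (intro mult_left_mono) auto
        ultimately have "- e \<le> p f M" using Q_eq[OF M(1)] B0 by (simp add: p_def left_diff_distrib)
        also have "p f M \<le> v f" unfolding v_def by (rule cSUP_upper[OF M(1) bddp])
        finally show "0 \<le> v f + e" by simp
      qed
      ultimately show ?thesis using 2 by simp
    next
      case 3
      \<comment> \<open>The common slope bound \<open>c\<close> keeps the supremum strictly
        negative; negativity of each single value would not.\<close>
      have "v t \<le> - ((t - f) * c)" unfolding v_def
      proof (rule cSUP_least[OF Fne])
        fix M assume M: "M \<in> F"
        have "(Q M - t) * I M \<le> (f - t) * I M" using Qf[OF M] I0[OF M] by (intro mult_right_mono) auto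
        also have "\<dots> \<le> (f - t) * c" using 3 I(1)[OF M] by (intro mult_left_mono_neg) auto
        finally show "p t M \<le> - ((t - f) * c)" using Q_eq[OF M] by (simp add: p_def left_diff_distrib)
      qed
      moreover have "(t - f) * c > 0" using 3 c by simp
      ultimately show ?thesis using 3 by simp
    qed
  qed
  have "- (ks_entropy M shift / ereal (\<integral>u. \<Phi> u \<partial>M)) = ereal (Q M)" if M: "M \<in> F" for M
  proof -
    have "(\<integral>u. \<Phi> u \<partial>M) \<noteq> 0" using I0[OF M] by (auto simp: I_def)
    then show ?thesis using ks_entropy_eq[OF inv[OF M]] by (simp add: Q_def I_def)
  qed
  then have "(SUP M\<in>F. - (ks_entropy M shift / ereal (\<integral>u. \<Phi> u \<partial>M))) = (SUP M\<in>F. ereal (Q M))"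
    by (rule SUP_cong[OF refl])
  also have "\<dots> = ereal f"
  proof (rule antisym)
    show "(SUP M\<in>F. ereal (Q M)) \<le> ereal f" by (rule SUP_least) (simp add: Qf)
    show "ereal f \<le> (SUP M\<in>F. ereal (Q M))"
    proof (rule ccontr)
      assume "\<not> ereal f \<le> (SUP M\<in>F. ereal (Q M))"
      then have "(SUP M\<in>F. ereal (Q M)) < ereal f" by (simp only: not_le)
      from ereal_dense2[OF this] obtain y where y: "(SUP M\<in>F. ereal (Q M)) < ereal y" "y < f" by auto
      then obtain M where M: "M \<in> F" "y < Q M" using less_cSUP_iff[OF Fne bddQ] unfolding f_def by blast
      have "ereal (Q M) \<le> (SUP M\<in>F. ereal (Q M))" by (rule SUP_upper[OF M(1)])
      then show False using y(1) M(2) by (meson ereal_less_eq(3) le_less_trans linorder_not_less less_imp_le)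
    qed
  qed
  finally show ?thesis using that[of f] P Zr root unfolding F_def by simp
qed

end

text \<open>The formula is asserted for every number with either defining property. Existence and
  uniqueness are asserted if some invariant measure is mapped into \<open>closure C\<close>;
  otherwise the pressure tends to minus infinity and no such number exists.\<close>

theorem corollary4p5:
  fixes G :: "('v, 'e) pre_digraph"
    and U :: "(nat \<Rightarrow> 'e) measure \<Rightarrow> 'x::metric_space"
    and C :: "'x set"
    and \<Phi> :: "(nat \<Rightarrow> 'e) \<Rightarrow> real"
  assumes "fin_digraph G"
    and "strongly_connected G"
    and "continuous_map (weak_topology G) euclidean U"
    and "continuous_map (path_topology G) euclideanreal \<Phi>"
    and "\<And>u. u \<in> paths G \<Longrightarrow> \<Phi> u < 0"
  shows "(\<forall>f. pressure_zero G U C \<Phi> f \<or> zeta_radius_one G U C \<Phi> f \<longrightarrow>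
            ereal f = (SUP \<mu> \<in> {\<mu> \<in> invariant_measures G. U \<mu> \<in> closure C}.
                         - (ks_entropy \<mu> shift / ereal (\<integral>u. \<Phi> u \<partial>\<mu>))))
       \<and> ((\<exists>\<mu> \<in> invariant_measures G. U \<mu> \<in> closure C) \<longrightarrow>
            (\<exists>!f. pressure_zero G U C \<Phi> f) \<and> (\<exists>!f. zeta_radius_one G U C \<Phi> f))"
proof (cases "arcs G = {}")
  case True
  have "paths G = {}" using True by (auto simp: paths_def)
  then have "space (path_borel G) = {}" by (simp add: path_borel_def space_measure_of_conv)
  then have "M \<notin> prob_measures G" for M
    using prob_space.not_empty[of M] sets_eq_imp_space_eq[of M "path_borel G"] by (auto simp: prob_measures_def)
  then have none: "invariant_measures G = {}" by (auto simp: invariant_measures_def)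
  \<comment> \<open>For \<open>n = 0\<close> the empty word remains, with a supremum over an empty
    cylinder; hence the restriction to positive \<open>n\<close>, here and in the growth
    lemmas.\<close>
  have zero: "multifractal_sum G U D \<phi> n = 0" if "n > 0" for D \<phi> n
  proof -
    have "words G n = {}" using that True by (auto simp: words_def)
    then show ?thesis by (simp add: multifractal_sum_def)
  qed
  have "growth_below (multifractal_sum G U D \<phi>) s" for D \<phi> s
    unfolding growth_below_def by (rule eventually_sequentiallyI[of 1]) (simp add: zero)
  then have "\<not> pressure_zero G U C \<Phi> f \<and> \<not> zeta_radius_one G U C \<Phi> f" for f
    using no_root_if_no_growth[of G U C f \<Phi>] zero by simp
  then show ?thesis using none by simp
next
  case False
  then interpret graph_shift G
    using assms(1,2) by (simp add: graph_shift_def graph_shift_axioms_def)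
  show ?thesis
  proof (cases "\<exists>M\<in>invariant_measures G. U M \<in> closure C")
    case True
    then obtain f where "\<And>t. pressure_zero G U C \<Phi> t \<longleftrightarrow> t = f" "\<And>t. zeta_radius_one G U C \<Phi> t \<longleftrightarrow> t = f"
      "ereal f = (SUP M \<in> {M \<in> invariant_measures G. U M \<in> closure C}.
        - (ks_entropy M shift / ereal (\<integral>u. \<Phi> u \<partial>M)))"
      using multifractal_roots[OF assms(3,4,5) True] by blast
    then show ?thesis by simp
  next
    case none: False
    have "\<not> pressure_zero G U C \<Phi> t \<and> \<not> zeta_radius_one G U C \<Phi> t" for t
    proof -
      have cont: "continuous_map (path_topology G) euclideanreal (\<lambda>u. t * \<Phi> u)"
        by (intro continuous_map_real_mult continuous_map_const[THEN iffD2] assms(4)) auto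
      have "\<forall>\<^sub>F r in at_right 0. growth_below (multifractal_sum G U (set_ball C r) (\<lambda>u. t * \<Phi> u)) s" for s
        by (rule growth_below_at_right[OF assms(3) cont]) (use none in blast)
      then show ?thesis
        using no_root_if_no_growth[of G U C t \<Phi>] multifractal_sum_nonneg[OF cont] by blast
    qed
    then show ?thesis using none by blast
  qed
qed

end
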